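(* Let $d\ge 1$, $k\ge 0$ and $0\le s\le k$ be integers. For any integer $n\ge 2$ and any points $\{\theta_j^*\}_{j=1}^n\subset\mathbb{S}^d$, the mass matrix $$M=\Big(\int_{\mathbb{S}^d}\sigma_k(\theta_i^*\cdot\omega)\,\sigma_k(\theta_j^*\cdot\omega)\,d\omega\Big)_{i,j=1}^n$$ and the stiffness matrix $$K_s=\Big(\int_{\mathbb{S}^d}\big(\nabla_\omega^s\sigma_k(\theta_i^*\cdot\omega)\big)\cdot\big(\nabla_\omega^s\sigma_k(\theta_j^*\cdot\omega)\big)\,d\omega\Big)_{i,j=1}^n$$ satisfy $$h^{-d}\lesssim\lambda_1(M)\lesssim\underline{h}^{-d},\qquad \underline{h}^{2k+1}\lesssim\lambda_n(M)\lesssim h^{2k+1},$$ and $$h^{-d}\lesssim\lambda_1(K_s)\lesssim\underline{h}^{-d},\qquad \underline{h}^{2(k-s)+1}\lesssim\lambda_n(K_s)\lesssim h^{2(k-s)+1},$$ where the implicit constants depend only on $d,k,s$ (not on $n$ or on the points). In particular, if $h\simeq\underline{h}$ (i.e. $C_*^{-1}\underline{h}\le h\le C_*\underline{h}$ for a constant $C_*$), then $$\kappa(M)\simeq n^{\frac{d+2k+1}{d}},\qquad \kappa(K_s)\simeq n^{\frac{d+2(k-s)+1}{d}},$$ with implicit constants depending only on $d,k,s,C_*$.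
   Context: $\mathbb{S}^d$ is the unit sphere of $\mathbb{R}^{d+1}$ and $d\omega$ is the surface measure normalized so that $\int_{\mathbb{S}^d}d\omega=1$. $\sigma_k(x)=\max(0,x)^k$ ($\sigma_0$ is the Heaviside function $\mathbf 1_{x>0}$). $\nabla_\omega^s\sigma_k(\theta\cdot\omega)$ is the tensor of all $s$-th order partial derivatives in $\mathbb{R}^{d+1}$ of $\omega\mapsto\sigma_k(\theta\cdot\omega)$ (defined a.e.), i.e. $\frac{k!}{(k-s)!}\,\sigma_{k-s}(\theta\cdot\omega)\,\theta^{\otimes s}$, and $\cdot$ between such tensors is the Euclidean (Frobenius) inner product; thus $(K_s)_{ij}=\big(\tfrac{k!}{(k-s)!}\big)^2(\theta_i^*\cdot\theta_j^* )^s\int_{\mathbb{S}^d}\sigma_{k-s}(\theta_i^*\cdot\omega)\sigma_{k-s}(\theta_j^*\cdot\omega)\,d\omega$. With $\rho$ the geodesic distance on $\mathbb{S}^d$, the mesh size and antipodal separation distance are $$h=\max_{\theta\in\mathbb{S}^d}\min_{1\le j\le n}\rho(\theta,\theta_j^* ),\qquad \underline{h}=\min\big\{\min_{i\ne j}\rho(\theta_i^*,\theta_j^* ),\ \min_{i\ne j}\rho(-\theta_i^*,\theta_j^* )\big\}$$ (if $\underline h=0$ then $\underline h^{-d}=+\infty$). For a symmetric $n\times n$ matrix $A$, $\lambda_1(A)\ge\dots\ge\lambda_n(A)$ are its eigenvalues in descending order; $\kappa(A)=\|A\|_2\|A^{-1}\|_2$. $a\lesssim b$ means $a\le Cb$ for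 a constant $C$ as specified; $a\simeq b$ means $a\lesssim b\lesssim a$. *)

theory Defs
  imports "HOL-Analysis.Analysis" "Jordan_Normal_Form.Char_Poly"
    "Jordan_Normal_Form.Gauss_Jordan_Elimination"
begin

hide_const (open) Matrix.vec

text \<open>Both libraries write \<open>\<bullet>\<close>; here it always means the Euclidean inner product.\<close>

no_notation scalar_prod (infix \<open>\<bullet>\<close> 70)

section \<open>Integration on the sphere\<close>

text \<open>
  The normalized surface measure as the cone measure: a Borel set \<open>A\<close> of the unit sphere gets
  mass \<open>vol {t *\<^sub>R x | 0 < t < 1, x \<in> A} / vol (ball 0 1)\<close>. Note that
  \<open>sgn x = x /\<^sub>R norm x\<close> is the radial projection onto the sphere.
\<close>

definition sphere_measure :: "'a::euclidean_space measure" where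
  "sphere_measure =
     restrict_space (distr (uniform_measure lborel (ball 0 1)) borel sgn) (sphere 0 1)"

lemma space_sphere_measure: "space (sphere_measure :: 'a::euclidean_space measure) = sphere 0 1"
  by (simp add: sphere_measure_def space_restrict_space)

lemma sets_sphere_measure:
  "sets (sphere_measure :: 'a::euclidean_space measure) = sets (restrict_space borel (sphere 0 1))"
  unfolding sphere_measure_def by (intro sets_restrict_space_cong) simp

lemma emeasure_sphere_measure:
  fixes A :: "'a::euclidean_space set"
  assumes "A \<in> sets borel" "A \<subseteq> sphere 0 1"
  shows "emeasure sphere_measure A =
    emeasure lborel {x \<in> ball 0 1. sgn x \<in> A} / emeasure lborel (ball 0 1 :: 'a set)"
proof -
  have m: "(sgn :: 'a \<Rightarrow> 'a) \<in> borel_measurable borel"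
    unfolding sgn_div_norm by measurable
  have "emeasure sphere_measure A =
      emeasure (distr (uniform_measure lborel (ball 0 1)) borel sgn) A"
    unfolding sphere_measure_def using assms
    by (intro emeasure_restrict_space) auto
  also have "\<dots> = emeasure (uniform_measure lborel (ball 0 1)) (sgn -` A)"
    using m assms by (subst emeasure_distr) auto
  also have "\<dots> = emeasure lborel (ball 0 1 \<inter> sgn -` A) / emeasure lborel (ball 0 1 :: 'a set)"
    using measurable_sets[OF m assms(1)] by (intro emeasure_uniform_measure) auto
  also have "ball 0 1 \<inter> sgn -` A = {x \<in> ball 0 1. sgn x \<in> A}" by auto
  finally show ?thesis .
qed

lemma emeasure_sphere_measure_sphere:
  "emeasure sphere_measure (sphere 0 1 :: 'a::euclidean_space set) = 1"
proof -
  have "{x \<in> ball 0 1. sgn x \<in> sphere 0 1} = ball 0 1 - {0 :: 'a}"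
    by (auto simp: norm_sgn)
  moreover have "emeasure lborel (ball 0 1 - {0 :: 'a}) = emeasure lborel (ball 0 1 :: 'a set)"
    by (intro emeasure_Diff_null_set) auto
  moreover have "emeasure lborel (ball 0 1 :: 'a set) \<noteq> 0"
    using content_ball_pos[of 1 "0 :: 'a"] by (auto simp: measure_def)
  moreover have "emeasure lborel (ball 0 1 :: 'a set) \<noteq> \<infinity>"
    using emeasure_lborel_ball_finite[of "0 :: 'a" 1] by simp
  ultimately show ?thesis
    by (simp add: emeasure_sphere_measure ennreal_divide_self less_top)
qed

section \<open>Ridge powers and their derivative tensors\<close>

definition relu_pow :: "nat \<Rightarrow> real \<Rightarrow> real" where
  "relu_pow k x = (if k = 0 then indicator {0<..} x else max 0 x ^ k)"

definition partial_deriv :: "'a::euclidean_space \<Rightarrow> ('a \<Rightarrow> real) \<Rightarrow> 'a \<Rightarrow> real" where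
  "partial_deriv b f x = deriv (\<lambda>t. f (x + t *\<^sub>R b)) 0"

text \<open>
  The tensor of \<open>s\<close>-th order partial derivatives is indexed by the lists of basis vectors of
  length \<open>s\<close>. Where a derivative does not exist, \<open>deriv\<close> has an unspecified value; for the functions
  considered here this concerns only the null set \<open>\<theta> \<bullet> \<omega> = 0\<close>.
\<close>

definition deriv_tensor :: "('a::euclidean_space \<Rightarrow> real) \<Rightarrow> 'a \<Rightarrow> 'a list \<Rightarrow> real" where
  "deriv_tensor f x bs = foldr partial_deriv bs f x"

definition tensor_inner :: "nat \<Rightarrow> ('a::euclidean_space list \<Rightarrow> real) \<Rightarrow> ('a list \<Rightarrow> real) \<Rightarrow> real" where
  "tensor_inner s S T = (\<Sum>bs | set bs \<subseteq> Basis \<and> length bs = s. S bs * T bs)"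

definition mass_matrix :: "nat \<Rightarrow> nat \<Rightarrow> (nat \<Rightarrow> 'a::euclidean_space) \<Rightarrow> real mat" where
  "mass_matrix k n \<theta> = mat n n (\<lambda>(i, j).
     LINT \<omega>|sphere_measure. relu_pow k (\<theta> i \<bullet> \<omega>) * relu_pow k (\<theta> j \<bullet> \<omega>))"

definition stiffness_matrix :: "nat \<Rightarrow> nat \<Rightarrow> nat \<Rightarrow> (nat \<Rightarrow> 'a::euclidean_space) \<Rightarrow> real mat" where
  "stiffness_matrix s k n \<theta> = mat n n (\<lambda>(i, j).
     LINT \<omega>|sphere_measure. tensor_inner s
       (deriv_tensor (\<lambda>w. relu_pow k (\<theta> i \<bullet> w)) \<omega>)
       (deriv_tensor (\<lambda>w. relu_pow k (\<theta> j \<bullet> w)) \<omega>))"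

section \<open>Geometry of the point set\<close>

definition geodesic_dist :: "'a::euclidean_space \<Rightarrow> 'a \<Rightarrow> real" where
  "geodesic_dist x y = arccos (x \<bullet> y)"

definition mesh_size :: "nat \<Rightarrow> (nat \<Rightarrow> 'a::euclidean_space) \<Rightarrow> real" where
  "mesh_size n \<theta> = (SUP x\<in>sphere 0 1. MIN j\<in>{..<n}. geodesic_dist x (\<theta> j))"

definition antipodal_sep :: "nat \<Rightarrow> (nat \<Rightarrow> 'a::euclidean_space) \<Rightarrow> real" where
  "antipodal_sep n \<theta> =
     min (MIN (i, j)\<in>{(i, j). i < n \<and> j < n \<and> i \<noteq> j}. geodesic_dist (\<theta> i) (\<theta> j))
         (MIN (i, j)\<in>{(i, j). i < n \<and> j < n \<and> i \<noteq> j}. geodesic_dist (- \<theta> i) (\<theta> j))"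

section \<open>Eigenvalues and condition number\<close>

text \<open>
  The \<open>i\<close>-th largest eigenvalue (\<open>i = 1, \<dots>, n\<close>), counted with multiplicity. This is meant for
  real symmetric matrices, whose characteristic polynomial has \<open>n\<close> real roots.
\<close>

definition eigval_desc :: "real mat \<Rightarrow> nat \<Rightarrow> real" where
  "eigval_desc A i = rev (sorted_list_of_multiset (proots (char_poly A))) ! (i - 1)"

definition euclidean_norm_vec :: "real Matrix.vec \<Rightarrow> real" where
  "euclidean_norm_vec v = sqrt (scalar_prod v v)"

definition spectral_norm :: "real mat \<Rightarrow> real" where
  "spectral_norm A =
     (SUP v\<in>{v \<in> carrier_vec (dim_col A). euclidean_norm_vec v = 1}. euclidean_norm_vec (A *\<^sub>v v))"

text \<open>Only meaningful if \<open>A\<close> is invertible, since \<open>mat_inverse A = None\<close> otherwise.\<close>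

definition cond_number :: "real mat \<Rightarrow> real" where
  "cond_number A = spectral_norm A * spectral_norm (the (mat_inverse A))"

end

theory Submission
  imports Defs
begin

text \<open>
  The kernel of the mass matrix is a zonal function
  \<open>\<integral> \<sigma>\<^sub>m(x \<bullet> w) \<sigma>\<^sub>m(y \<bullet> w) dw = c J(x \<bullet> y)\<close>, where averaging over the rotations of the plane
  spanned by \<open>x\<close> and \<open>y\<close> gives \<open>J t = \<integral> (t - sin v)\<^sup>m dv\<close> over \<open>- pi / 2 \<le> v \<le> arcsin t\<close>.
  Splitting this integral at \<open>0\<close> and substituting \<open>sin v = t y\<close>, \<open>J\<close> becomes a power series in \<open>t\<close>
  with nonnegative coefficients, and those of \<open>t ^ l\<close> are of size \<open>l\<close> to the power \<open>- m - 3/2\<close> for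
  every second \<open>l\<close>. Each matrix of the powers \<open>(\<theta>\<^sub>i \<bullet> \<theta>\<^sub>j) ^ l\<close> is positive semidefinite; when \<open>l\<close>
  exceeds a multiple of the inverse square of the antipodal separation distance it is diagonally
  dominant, hence at least one half of the identity. Summing the coefficients over this range of \<open>l\<close>
  bounds the smallest eigenvalue from below.

  For the matching upper bound one picks boundedly many of the points within a multiple of the mesh
  size \<open>h\<close> of each other, and weights for them that annihilate all monomials of degree \<open>s + m\<close>. The
  resulting combination of ridge functions lives on a strip of width of order \<open>h\<close> around a great
  sphere, where it is of size \<open>h ^ m\<close>. The largest eigenvalue is comparable to the number of points,
  which is compared with the two distances through volumes of thin annuli.
\<close>

text \<open>Diagonalising the kernel in spherical harmonics would require asymptotics of Gegenbauer
  coefficients in every dimension. In the power series the dimension enters only through a constant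
  factor and through volume counts, and the tensor factor \<open>(x \<bullet> y) ^ s\<close> merely
  raises all exponents by \<open>s\<close>. High exponents of only one parity occur, and
  \<open>(- t) ^ l\<close> equals \<open>t ^ l\<close> up to sign, so the high part of the series
  cannot tell a point from its antipode; hence the separation distance must involve
  \<open>- \<theta> i\<close> too. The scales fit as follows. At distance \<open>e\<close> an inner
  product is about \<open>1 - e^2 / 2\<close>, so its powers die out once \<open>l\<close> exceeds a
  multiple of \<open>e^(-2)\<close>; the tail of the sum of \<open>l^(- m - 3/2)\<close> is then of
  order \<open>e^(2 * m + 1)\<close>. On the other side, a strip of width \<open>h\<close> carrying
  squared values \<open>h^(2 * m)\<close> gives \<open>h^(2 * m + 1)\<close>. The largest eigenvalue
  is at most a multiple of \<open>n\<close> because all entries are bounded, and at least one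
  because the constant vector already attains this order. If \<open>h\<close> and the separation are
  comparable, both are of order \<open>n^(- 1 / d)\<close>, which yields the condition
  numbers.\<close>

section \<open>Rotation invariance of the surface measure\<close>

text \<open>
  Uniqueness of translation-invariant measures: the product of the volume of the unit ball with the
  pushed-forward measure of \<open>A\<close> is evaluated by Fubini's theorem in two ways.
\<close>

lemma lborel_distr_orthogonal:
  fixes f :: "'a::euclidean_space \<Rightarrow> 'a"
  assumes f: "orthogonal_transformation f"
  shows "distr lborel borel f = lborel"
proof (rule measure_eqI)
  show "sets (distr lborel borel f) = sets lborel" by simp
next
  fix A assume "A \<in> sets (distr lborel borel f)"
  then have A [measurable]: "A \<in> sets borel" by simp
  have lin: "linear f" and inj: "inj f" and surj: "surj f"
    using f orthogonal_transformation_linear orthogonal_transformation_inj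
      orthogonal_transformation_surj by blast+
  have fm [measurable]: "f \<in> borel_measurable borel"
    by (intro borel_measurable_continuous_onI linear_continuous_on linear_conv_bounded_linear[THEN iffD1] lin)
  let ?B = "ball (0::'a) 1"
  have Bm [measurable]: "?B \<in> sets borel" by simp
  define B where "B = emeasure lborel ?B"
  have B0: "B \<noteq> 0" "B \<noteq> \<infinity>"
    using content_ball_pos[of 1 "0 :: 'a"] emeasure_lborel_ball_finite[of "0 :: 'a" 1]
    by (auto simp: measure_def B_def)
  have shift: "(\<integral>\<^sup>+ x. g (x + c) \<partial>lborel) = (\<integral>\<^sup>+ x. g x \<partial>lborel)"
    if [measurable]: "g \<in> borel_measurable borel" for g :: "'a \<Rightarrow> ennreal" and c
    by (subst (2) lborel_distr_plus[symmetric, of c])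
      (subst nn_integral_distr, auto simp: add.commute)
  \<comment> \<open>With \<open>y = f z\<close>, \<open>norm (y - f x) = norm (z - x)\<close>: the
    set of admissible \<open>x\<close> is again a unit ball.\<close>
  have int_refl: "(\<integral>\<^sup>+ x. indicator ?B (y - f x) \<partial>lborel) = B" for y
  proof -
    obtain z where z: "y = f z" using surj by (metis surjD)
    have "norm (y - f x) = norm (z - x)" for x
      using orthogonal_transformation_norm[OF f, of "z - x"] z linear_diff[OF lin] by simp
    then have "y - f x \<in> ?B \<longleftrightarrow> x \<in> ball z 1" for x
      unfolding mem_ball dist_0_norm by (simp only: dist_norm)
    then have "(\<lambda>x. indicator ?B (y - f x)) = (indicator (ball z 1) :: 'a \<Rightarrow> ennreal)"
      by (intro ext) (simp add: indicator_def del: mem_ball)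
    then have "(\<integral>\<^sup>+ x. indicator ?B (y - f x) \<partial>lborel) = emeasure lborel (ball z 1)"
      by simp
    also have "\<dots> = B"
      by (simp add: B_def emeasure_ball)
    finally show ?thesis .
  qed
  have "B * emeasure (distr lborel borel f) A = (\<integral>\<^sup>+ y. indicator ?B y * (\<integral>\<^sup>+ x. indicator A (f x) \<partial>lborel) \<partial>lborel)"
    by (subst nn_integral_multc) (auto simp: B_def emeasure_distr nn_integral_distr simp flip: nn_integral_indicator)
  \<comment> \<open>Adding \<open>y = f z\<close> after \<open>f\<close> is the same as adding
    \<open>z\<close> before \<open>f\<close>, so translation invariance removes it.\<close>
  also have "\<dots> = (\<integral>\<^sup>+ y. indicator ?B y * (\<integral>\<^sup>+ x. indicator A (f x + y) \<partial>lborel) \<partial>lborel)"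
  proof -
    have "(\<integral>\<^sup>+ x. indicator A (f x) \<partial>lborel) = (\<integral>\<^sup>+ x. indicator A (f x + y) \<partial>lborel :: ennreal)" for y
    proof -
      obtain z where z: "y = f z" using surj by (metis surjD)
      show ?thesis
        using shift[of "\<lambda>x. indicator A (f x)" z] by (simp add: z linear_add[OF lin])
    qed
    then show ?thesis by simp
  qed
  also have "\<dots> = (\<integral>\<^sup>+ y. \<integral>\<^sup>+ x. indicator ?B y * indicator A (f x + y) \<partial>lborel \<partial>lborel)"
    by (intro nn_integral_cong) (subst nn_integral_cmult, auto)
  also have "\<dots> = (\<integral>\<^sup>+ x. \<integral>\<^sup>+ y. indicator ?B y * indicator A (f x + y) \<partial>lborel \<partial>lborel)"
    by (rule lborel_pair.Fubini') measurable
  also have "\<dots> = (\<integral>\<^sup>+ x. \<integral>\<^sup>+ y. indicator ?B (y - f x) * indicator A y \<partial>lborel \<partial>lborel)"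
  proof (rule nn_integral_cong)
    fix x
    have "(\<integral>\<^sup>+ y. indicator ?B (y + f x - f x) * indicator A (y + f x) \<partial>lborel)
        = (\<integral>\<^sup>+ y. indicator ?B (y - f x) * indicator A y \<partial>lborel)"
      by (rule shift) measurable
    then show "(\<integral>\<^sup>+ y. indicator ?B y * indicator A (f x + y) \<partial>lborel)
        = (\<integral>\<^sup>+ y. indicator ?B (y - f x) * indicator A y \<partial>lborel)"
      by (simp add: add.commute)
  qed
  also have "\<dots> = (\<integral>\<^sup>+ y. \<integral>\<^sup>+ x. indicator ?B (y - f x) * indicator A y \<partial>lborel \<partial>lborel)"
    by (rule lborel_pair.Fubini') measurable
  also have "\<dots> = (\<integral>\<^sup>+ y. B * indicator A y \<partial>lborel)"
    by (intro nn_integral_cong) (subst nn_integral_multc, auto simp: int_refl)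
  also have "\<dots> = B * emeasure lborel A"
    by (subst nn_integral_cmult) auto
  finally show "emeasure (distr lborel borel f) A = emeasure lborel A"
    using B0 by (simp add: ennreal_mult_cancel_left)
qed

lemma borel_measurable_sgn_vec [measurable]:
  "(sgn :: 'a::euclidean_space \<Rightarrow> 'a) \<in> borel_measurable borel"
  unfolding sgn_div_norm by measurable

lemma borel_measurable_orthogonal:
  fixes f :: "'a::euclidean_space \<Rightarrow> 'a"
  assumes "orthogonal_transformation f"
  shows "f \<in> borel_measurable borel"
  using assms orthogonal_transformation_linear
  by (intro borel_measurable_continuous_onI linear_continuous_on linear_conv_bounded_linear[THEN iffD1]) blast

lemma emeasure_unit_ball:
  "emeasure lborel (ball 0 1 :: 'a::euclidean_space set) \<noteq> 0"
  "emeasure lborel (ball 0 1 :: 'a::euclidean_space set) \<noteq> \<infinity>"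
  using content_ball_pos[of 1 "0 :: 'a"] emeasure_lborel_ball_finite[of "0 :: 'a" 1]
  by (auto simp: measure_def)

lemma finite_measure_sphere_measure: "finite_measure (sphere_measure :: 'a::euclidean_space measure)"
  by (rule finite_measureI) (simp add: space_sphere_measure emeasure_sphere_measure_sphere)

lemma measurable_sphere_measure:
  assumes "g \<in> borel_measurable borel"
  shows "g \<in> borel_measurable (sphere_measure :: 'a::euclidean_space measure)"
  using measurable_restrict_space1[OF assms, of "sphere 0 1"]
    measurable_cong_sets[OF sets_sphere_measure refl] by blast

text \<open>\<open>f\<close> preserves norms and commutes with \<open>sgn\<close>, so the cone over
  a preimage is the preimage of the cone, and the invariance of Lebesgue measure applies.\<close>

lemma emeasure_sphere_measure_orthogonal:
  fixes f :: "'a::euclidean_space \<Rightarrow> 'a"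
  assumes f: "orthogonal_transformation f" and A: "A \<in> sets borel" "A \<subseteq> sphere 0 1"
  shows "emeasure sphere_measure (f -` A) = emeasure sphere_measure A"
proof -
  note fm [measurable] = borel_measurable_orthogonal[OF f]
  have nf: "norm (f x) = norm x" for x using orthogonal_transformation_norm[OF f] .
  have sf: "sgn (f x) = f (sgn x)" for x
    by (simp add: sgn_div_norm nf orthogonal_transformation_scaleR[OF f])
  have fA: "f -` A \<in> sets borel" using measurable_sets[OF fm A(1)] by simp
  have fA': "f -` A \<subseteq> sphere 0 1" using A(2) nf by auto
  have m: "{x \<in> ball 0 1. sgn x \<in> A} \<in> sets borel"
    using A(1) by measurable
  have "emeasure lborel {x \<in> ball 0 1. sgn x \<in> f -` A}
      = emeasure lborel (f -` {x \<in> ball 0 1. sgn x \<in> A})"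
    by (rule arg_cong[where f="emeasure lborel"]) (auto simp: sf nf)
  also have "\<dots> = emeasure (distr lborel borel f) {x \<in> ball 0 1. sgn x \<in> A}"
    using m by (subst emeasure_distr) auto
  also have "\<dots> = emeasure lborel {x \<in> ball 0 1. sgn x \<in> A}"
    by (simp add: lborel_distr_orthogonal[OF f])
  finally show ?thesis
    by (simp add: emeasure_sphere_measure fA fA' A)
qed

lemma integral_sphere_measure_orthogonal:
  fixes f :: "'a::euclidean_space \<Rightarrow> 'a" and g :: "'a \<Rightarrow> real"
  assumes f: "orthogonal_transformation f" and g: "g \<in> borel_measurable borel"
  shows "(LINT w|sphere_measure. g (f w)) = (LINT w|sphere_measure. g w)"
proof -
  have nf: "norm (f x) = norm x" for x using orthogonal_transformation_norm[OF f] .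
  have meas: "f \<in> measurable sphere_measure sphere_measure"
    using borel_measurable_orthogonal[OF f]
    by (subst measurable_cong_sets[OF sets_sphere_measure sets_sphere_measure])
      (intro measurable_restrict_space3, auto simp: nf)
  have "distr sphere_measure sphere_measure f = (sphere_measure :: 'a measure)"
  proof (rule measure_eqI)
    fix A assume "A \<in> sets (distr sphere_measure sphere_measure f)"
    then have A: "A \<in> sets sphere_measure" by simp
    then have A': "A \<in> sets borel" "A \<subseteq> sphere 0 1"
      by (auto simp: sets_sphere_measure sets_restrict_space)
    have "f -` A \<inter> sphere 0 1 = f -` A" using A'(2) nf by auto
    then show "emeasure (distr sphere_measure sphere_measure f) A = emeasure sphere_measure A"
      using emeasure_sphere_measure_orthogonal[OF f A']
      by (simp add: emeasure_distr[OF meas A] space_sphere_measure)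
  qed simp
  then show ?thesis
    using integral_distr[OF meas measurable_sphere_measure[OF g]] by simp
qed

text \<open>The cone over this great subsphere lies in a hyperplane, which is a Lebesgue null
  set.\<close>

lemma AE_sphere_measure_hyperplane:
  fixes u :: "'a::euclidean_space"
  assumes "u \<noteq> 0"
  shows "AE w in sphere_measure. u \<bullet> w \<noteq> 0"
proof (rule AE_I)
  let ?N = "{w \<in> sphere 0 1. u \<bullet> w = 0}"
  have N: "?N \<in> sets borel" by measurable
  have "{x \<in> ball 0 1. sgn x \<in> ?N} \<subseteq> {x. u \<bullet> x = 0}"
    by (auto simp: sgn_div_norm)
  moreover have "{x. u \<bullet> x = 0} \<in> null_sets lborel"
    using negligible_hyperplane[of u 0] assms
    by (auto simp: negligible_iff_null_sets null_sets_completion_iff)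
  moreover have "ball 0 1 \<inter> sgn -` ?N \<in> sets lborel"
    using measurable_sets[OF borel_measurable_sgn_vec N] by auto
  then have "{x \<in> ball 0 1. sgn x \<in> ?N} \<in> sets lborel"
    by (simp add: vimage_def Int_def)
  ultimately have "emeasure lborel {x \<in> ball 0 1. sgn x \<in> ?N} = 0"
    using null_sets_subset by blast
  then show "emeasure sphere_measure ?N = 0"
    by (subst emeasure_sphere_measure[OF N]) auto
  show "{w \<in> space sphere_measure. \<not> u \<bullet> w \<noteq> 0} \<subseteq> ?N"
    by (auto simp: space_sphere_measure)
  show "?N \<in> sets sphere_measure"
    by (auto simp: sets_sphere_measure sets_restrict_space intro!: image_eqI[of _ _ ?N] N)
qed

section \<open>Ridge kernels as zonal functions\<close>

text \<open>For orthonormal \<open>u\<close> and \<open>v\<close> this is the rotation by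
  \<open>\<phi>\<close> in their plane and the identity on its orthogonal complement. Writing it as
  a correction of \<open>w\<close> avoids completing \<open>u\<close>, \<open>v\<close> to a
  basis.\<close>

definition plane_rotation :: "'a::euclidean_space \<Rightarrow> 'a \<Rightarrow> real \<Rightarrow> 'a \<Rightarrow> 'a" where
  "plane_rotation u v \<phi> w =
     w + ((cos \<phi> - 1) * (u \<bullet> w) - sin \<phi> * (v \<bullet> w)) *\<^sub>R u
       + ((cos \<phi> - 1) * (v \<bullet> w) + sin \<phi> * (u \<bullet> w)) *\<^sub>R v"

lemma inner_plane_rotation:
  fixes u v :: "'a::euclidean_space"
  assumes "norm u = 1" "norm v = 1" "u \<bullet> v = 0"
  shows "u \<bullet> plane_rotation u v \<phi> w = cos \<phi> * (u \<bullet> w) - sin \<phi> * (v \<bullet> w)"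
    and "v \<bullet> plane_rotation u v \<phi> w = cos \<phi> * (v \<bullet> w) + sin \<phi> * (u \<bullet> w)"
  using assms by (simp_all add: plane_rotation_def inner_add_right inner_commute[of v u] norm_eq_1 algebra_simps)

lemma orthogonal_plane_rotation:
  fixes u v :: "'a::euclidean_space"
  assumes uv: "norm u = 1" "norm v = 1" "u \<bullet> v = 0"
  shows "orthogonal_transformation (plane_rotation u v \<phi>)"
  unfolding orthogonal_transformation
proof (intro conjI allI)
  define A where "A w = (cos \<phi> - 1) * (u \<bullet> w) - sin \<phi> * (v \<bullet> w)" for w
  define B where "B w = (cos \<phi> - 1) * (v \<bullet> w) + sin \<phi> * (u \<bullet> w)" for w
  have AB: "A (w + w') = A w + A w'" "B (w + w') = B w + B w'" "A (c *\<^sub>R w) = c * A w" "B (c *\<^sub>R w) = c * B w"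
    for w w' c
    by (simp_all add: A_def B_def inner_add_right algebra_simps)
  have rot: "plane_rotation u v \<phi> w = w + A w *\<^sub>R u + B w *\<^sub>R v" for w
    by (simp add: plane_rotation_def A_def B_def)
  show "linear (plane_rotation u v \<phi>)"
    by (rule linearI) (simp_all add: rot AB scaleR_add_left scaleR_add_right)
  fix w
  \<comment> \<open>Pythagoras: adding multiples of \<open>u\<close> and \<open>v\<close> changes
    only these two coordinates of \<open>w\<close>.\<close>
  have "(norm (w + a *\<^sub>R u + b *\<^sub>R v))\<^sup>2
      = (norm w)\<^sup>2 + (u \<bullet> w + a)\<^sup>2 - (u \<bullet> w)\<^sup>2 + (v \<bullet> w + b)\<^sup>2 - (v \<bullet> w)\<^sup>2" for a b
  proof -
    have "w \<bullet> u = u \<bullet> w" "w \<bullet> v = v \<bullet> w" "v \<bullet> u = 0" "u \<bullet> u = 1" "v \<bullet> v = 1"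
      using uv by (simp_all add: inner_commute norm_eq_1)
    then show ?thesis using uv(3) unfolding power2_norm_eq_inner inner_add_left inner_add_right
        inner_scaleR_left inner_scaleR_right
      by (simp only:) (simp add: power2_eq_square algebra_simps)
  qed
  moreover have "(c * x - s * y)\<^sup>2 + (c * y + s * x)\<^sup>2 = (c\<^sup>2 + s\<^sup>2) * (x\<^sup>2 + y\<^sup>2)" for c s x y :: real
    by (simp add: power2_eq_square algebra_simps)
  from this[of "cos \<phi>" "u \<bullet> w" "sin \<phi>" "v \<bullet> w"]
  have "(u \<bullet> w + ((cos \<phi> - 1) * (u \<bullet> w) - sin \<phi> * (v \<bullet> w)))\<^sup>2
      + (v \<bullet> w + ((cos \<phi> - 1) * (v \<bullet> w) + sin \<phi> * (u \<bullet> w)))\<^sup>2 = (u \<bullet> w)\<^sup>2 + (v \<bullet> w)\<^sup>2"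
    by (simp add: algebra_simps)
  ultimately have "(norm (plane_rotation u v \<phi> w))\<^sup>2 = (norm w)\<^sup>2"
    unfolding rot A_def B_def by simp
  then show "norm (plane_rotation u v \<phi> w) = norm w" by simp
qed

lemma borel_measurable_relu_pow [measurable]: "relu_pow k \<in> borel_measurable borel"
  unfolding relu_pow_def by (cases "k = 0") auto

lemma relu_pow_nonneg: "0 \<le> relu_pow k x"
  by (simp add: relu_pow_def)

lemma relu_pow_le_1: "\<bar>x\<bar> \<le> 1 \<Longrightarrow> relu_pow k x \<le> 1"
  by (auto simp: relu_pow_def indicator_def intro!: power_le_one)

lemma relu_pow_pos: "0 < x \<Longrightarrow> relu_pow k x = x ^ k"
  by (simp add: relu_pow_def)

lemma relu_pow_nonpos: "x \<le> 0 \<Longrightarrow> relu_pow k x = 0"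
  by (auto simp: relu_pow_def max_def)

text \<open>The factor is \<open>relu_pow k r\<close> rather than \<open>r ^ k\<close> so that the
  identity survives at \<open>r = 0\<close>, \<open>k = 0\<close>: the Heaviside function vanishes
  at 0 while \<open>0 ^ 0 = 1\<close>.\<close>

lemma relu_pow_mult: "0 \<le> r \<Longrightarrow> relu_pow k (r * x) = relu_pow k r * relu_pow k x"
  by (cases "r = 0"; cases "x > 0")
    (simp_all add: relu_pow_pos relu_pow_nonpos power_mult_distrib mult_nonneg_nonpos not_less)

lemma relu_pow_mult_self: "relu_pow k x * relu_pow j x = relu_pow (k + j) x"
  by (cases "x > 0") (simp_all add: relu_pow_pos relu_pow_nonpos power_add)

lemma relu_pow_times_power: "relu_pow k x * x ^ j = relu_pow (k + j) x"
  by (cases "x > 0") (simp_all add: relu_pow_pos relu_pow_nonpos power_add)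

lemma bounded_borel_set_integrable:
  fixes f :: "real \<Rightarrow> real"
  assumes "f \<in> borel_measurable borel" "\<And>x. \<bar>f x\<bar> \<le> B"
  shows "set_integrable lborel {a..b} f"
  unfolding set_integrable_def using assms
  by (intro integrableI_bounded_set_indicator[where B=B]) (auto simp: emeasure_lborel_Icc_eq)

lemma integral_restrict_lborel_Icc:
  fixes f :: "real \<Rightarrow> real"
  assumes "f \<in> borel_measurable borel" "\<And>x. \<bar>f x\<bar> \<le> B"
  shows "(LINT x|restrict_space lborel {a..b}. f x) = integral {a..b} f"
  using set_borel_integral_eq_integral(2)[OF bounded_borel_set_integrable[OF assms, of a b]]
  by (simp add: integral_restrict_space set_lebesgue_integral_def)

lemma integral_shift_Icc:
  fixes f :: "real \<Rightarrow> real"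
  shows "integral {a..b} (\<lambda>x. f (x + c)) = integral {a + c..b + c} f"
proof -
  have "((\<lambda>x. f (x + c)) has_integral I) {a..b} \<longleftrightarrow> (f has_integral I) {a + c..b + c}" for I
    using has_integral_shift_cbox_iff[of f c I a b] by (simp add: o_def add.commute)
  then show ?thesis by (simp add: integral_def integrable_on_def)
qed

lemma integral_periodic_shift:
  fixes f :: "real \<Rightarrow> real"
  assumes int: "\<And>a b. f integrable_on {a..b}" and per: "\<And>x. f (x + p) = f x"
    and c: "a \<le> c" "c \<le> a + p"
  shows "integral {c..c + p} f = integral {a..a + p} f"
proof -
  have "integral {a + p..c + p} f = integral {a..c} f"
    using integral_shift_Icc[of a c f p] per by simp
  moreover have "integral {a..c} f + integral {c..a + p} f = integral {a..a + p} f"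
    by (rule Henstock_Kurzweil_Integration.integral_combine) (use c int in auto)
  moreover have "integral {c..a + p} f + integral {a + p..c + p} f = integral {c..c + p} f"
    by (rule Henstock_Kurzweil_Integration.integral_combine) (use c int in auto)
  ultimately show ?thesis by linarith
qed

text \<open>At \<open>t = cos \<alpha>\<close> this is \<open>pi - \<alpha>\<close> for
  \<open>k = 0\<close> and \<open>sin \<alpha> + (pi - \<alpha>) * cos \<alpha>\<close> for
  \<open>k = 1\<close>: up to constants these are the arc-cosine kernels.\<close>

definition ridge_profile :: "nat \<Rightarrow> real \<Rightarrow> real" where
  "ridge_profile k t = integral {- pi / 2..arcsin t} (\<lambda>v. (t - sin v) ^ k)"

text \<open>Placing the two directions symmetrically at \<open>\<alpha> / 2\<close> and
  \<open>- \<alpha> / 2\<close> turns the product of the cosines into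
  \<open>(cos \<alpha> + cos (2 * \<phi>)) / 2\<close>, and both are positive exactly for
  \<open>\<bar>\<phi>\<bar> < \<gamma>\<close> within the period. The substitution
  \<open>v = 2 * \<phi> - pi / 2\<close> replaces \<open>cos (2 * \<phi>)\<close> by
  \<open>- sin v\<close>; its Jacobian 2 uses up the factor 2 from evenness.\<close>

lemma circle_ridge_integral:
  assumes \<alpha>: "0 \<le> \<alpha>" "\<alpha> \<le> pi"
  shows "integral {- pi..pi} (\<lambda>\<phi>. relu_pow k (cos (\<phi> - \<alpha> / 2)) * relu_pow k (cos (\<phi> + \<alpha> / 2)))
    = ridge_profile k (cos \<alpha>) / 2 ^ k"
proof -
  define F where "F \<phi> = relu_pow k (cos (\<phi> - \<alpha> / 2)) * relu_pow k (cos (\<phi> + \<alpha> / 2))" for \<phi>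
  define P where "P \<phi> = ((cos \<alpha> + cos (2 * \<phi>)) / 2) ^ k" for \<phi>
  define \<gamma> where "\<gamma> = (pi - \<alpha>) / 2"
  have \<gamma>: "0 \<le> \<gamma>" "\<gamma> \<le> pi / 2" using \<alpha> by (simp_all add: \<gamma>_def)
  have prod: "cos (\<phi> - \<alpha> / 2) * cos (\<phi> + \<alpha> / 2) = (cos \<alpha> + cos (2 * \<phi>)) / 2" for \<phi>
    by (simp add: cos_times_cos)
  have F_in: "F \<phi> = P \<phi>" if "- \<gamma> < \<phi>" "\<phi> < \<gamma>" for \<phi>
  proof -
    have "cos (\<phi> - \<alpha> / 2) > 0" "cos (\<phi> + \<alpha> / 2) > 0"
      using that \<alpha> by (auto intro!: cos_gt_zero_pi simp: \<gamma>_def field_simps)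
    then show ?thesis by (simp add: F_def P_def relu_pow_pos prod flip: power_mult_distrib)
  qed
  have F_out: "F \<phi> = 0" if h: "\<phi> \<in> {- pi..pi}" "\<not> (- \<gamma> < \<phi> \<and> \<phi> < \<gamma>)" for \<phi>
  proof -
    have neg: "cos x \<le> 0" if "pi / 2 \<le> x" "x \<le> 3 * pi / 2" for x
      using cos_ge_zero[of "x - pi"] that by (simp add: cos_diff field_simps)
    consider "\<gamma> \<le> \<phi>" | "\<phi> \<le> - \<gamma>" using h(2) by linarith
    then show ?thesis
    proof cases
      case 1
      have "cos (\<phi> + \<alpha> / 2) \<le> 0"
        using 1 h(1) \<alpha> by (intro neg) (auto simp: \<gamma>_def field_simps)
      then show ?thesis by (simp add: F_def relu_pow_nonpos)
    next
      case 2
      have "cos (- (\<phi> - \<alpha> / 2)) \<le> 0"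
        using 2 h(1) \<alpha> by (intro neg) (auto simp: \<gamma>_def field_simps)
      then have "cos (\<phi> - \<alpha> / 2) \<le> 0" unfolding cos_minus .
      then show ?thesis by (simp add: F_def relu_pow_nonpos)
    qed
  qed
  have contP: "continuous_on S P" for S
    unfolding P_def[abs_def] by (intro continuous_intros) auto
  have Pint: "P integrable_on {a..b}" for a b
    by (intro integrable_continuous_real contP)
  \<comment> \<open>The endpoints are excepted because for \<open>k = 0\<close> the polynomial is 1
    there while the Heaviside product is 0.\<close>
  have "integral {- pi..pi} F = integral {- pi..pi} (\<lambda>\<phi>. if \<phi> \<in> {- \<gamma>..\<gamma>} then P \<phi> else 0)"
    by (rule integral_spike[of "{- \<gamma>, \<gamma>}"]) (use F_in F_out in auto)
  also have "\<dots> = integral {- \<gamma>..\<gamma>} P"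
  proof -
    have "{- \<gamma>..\<gamma>} \<subseteq> {- pi..pi}"
    proof
      fix x assume "x \<in> {- \<gamma>..\<gamma>}"
      then show "x \<in> {- pi..pi}" using \<gamma>(2) pi_gt_zero unfolding atLeastAtMost_iff by linarith
    qed
    from has_integral_restrict[OF this, THEN iffD2, OF integrable_integral[OF Pint]]
    show ?thesis by (rule integral_unique)
  qed
  also have "\<dots> = integral {- \<gamma>..0} P + integral {0..\<gamma>} P"
    by (rule Henstock_Kurzweil_Integration.integral_combine[symmetric]) (use \<gamma>(1) Pint in auto)
  also have "integral {- \<gamma>..0} P = integral {0..\<gamma>} P"
  proof -
    have "P (- x) = P x" for x by (simp add: P_def)
    then show ?thesis
      using Henstock_Kurzweil_Integration.integral_reflect_real[where f=P and a=0 and b=\<gamma>] by simp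
  qed
  finally have F2: "integral {- pi..pi} F = 2 * integral {0..\<gamma>} P" by simp
  define f where "f v = ((cos \<alpha> - sin v) / 2) ^ k" for v
  have asin: "arcsin (cos \<alpha>) = pi / 2 - \<alpha>"
    using arcsin_sin[of "pi / 2 - \<alpha>"] \<alpha> by (simp add: sin_diff)
  have "((\<lambda>\<phi>. 2 *\<^sub>R f (2 * \<phi> - pi / 2)) has_integral
      integral {2 * 0 - pi / 2..2 * \<gamma> - pi / 2} f) {0..\<gamma>}"
  proof (rule has_integral_substitution)
    show "(\<lambda>x. 2 * x - pi / 2) ` {0..\<gamma>} \<subseteq> {- pi..pi}" using \<gamma> by auto
    show "continuous_on {- pi..pi} f" unfolding f_def[abs_def] by (intro continuous_intros) auto
    show "((\<lambda>x. 2 * x - pi / 2) has_real_derivative 2) (at x within {0..\<gamma>})" for x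
      by (auto intro!: derivative_eq_intros)
  qed (use \<gamma> in auto)
  moreover have "(\<lambda>\<phi>. 2 *\<^sub>R f (2 * \<phi> - pi / 2)) = (\<lambda>\<phi>. 2 * P \<phi>)"
    by (simp add: f_def P_def sin_diff)
  moreover have "2 * \<gamma> - pi / 2 = arcsin (cos \<alpha>)" by (simp add: asin \<gamma>_def field_simps)
  ultimately have "((\<lambda>\<phi>. 2 * P \<phi>) has_integral integral {- pi / 2..arcsin (cos \<alpha>)} f) {0..\<gamma>}"
    by simp
  then have "integral {0..\<gamma>} (\<lambda>\<phi>. 2 * P \<phi>) = integral {- pi / 2..arcsin (cos \<alpha>)} f"
    by (rule integral_unique)
  also have "\<dots> = integral {- pi / 2..arcsin (cos \<alpha>)} (\<lambda>v. (cos \<alpha> - sin v) ^ k / 2 ^ k)"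
    by (simp only: f_def[abs_def] power_divide)
  also have "\<dots> = ridge_profile k (cos \<alpha>) / 2 ^ k"
    by (simp add: ridge_profile_def)
  finally show ?thesis using F2 by (simp add: F_def[abs_def])
qed

definition ridge_kernel :: "nat \<Rightarrow> 'a::euclidean_space \<Rightarrow> 'a \<Rightarrow> real" where
  "ridge_kernel k x y = (LINT w|sphere_measure. relu_pow k (x \<bullet> w) * relu_pow k (y \<bullet> w))"

text \<open>
  Rotating in the plane of \<open>u\<close> and \<open>v\<close> leaves the integral unchanged; averaging over all angles
  separates the radial part of \<open>w\<close> from an integral over the circle.
\<close>

lemma ridge_kernel_plane:
  fixes u v :: "'a::euclidean_space"
  assumes uv: "norm u = 1" "norm v = 1" "u \<bullet> v = 0" and \<alpha>: "0 \<le> \<alpha>" "\<alpha> \<le> pi"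
  shows "2 * pi * ridge_kernel k u (cos \<alpha> *\<^sub>R u + sin \<alpha> *\<^sub>R v) =
    (LINT w|sphere_measure. (relu_pow k (sqrt ((u \<bullet> w)\<^sup>2 + (v \<bullet> w)\<^sup>2)))\<^sup>2)
     * (ridge_profile k (cos \<alpha>) / 2 ^ k)"
proof -
  let ?y = "cos \<alpha> *\<^sub>R u + sin \<alpha> *\<^sub>R v"
  let ?S = "sphere_measure :: 'a measure"
  let ?I = "restrict_space lborel {- pi..pi} :: real measure"
  define g where "g w = relu_pow k (u \<bullet> w) * relu_pow k (?y \<bullet> w)" for w
  define f where "f \<phi> w = g (plane_rotation u v \<phi> w)" for \<phi> w
  define r where "r w = sqrt ((u \<bullet> w)\<^sup>2 + (v \<bullet> w)\<^sup>2)" for w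
  interpret S: finite_measure ?S by (rule finite_measure_sphere_measure)
  interpret I: finite_measure ?I
    by (rule finite_measureI) (simp add: space_restrict_space emeasure_restrict_space)
  interpret P: pair_sigma_finite ?I ?S ..
  interpret PF: finite_measure "?I \<Otimes>\<^sub>M ?S"
    using S.finite_measure_axioms I.finite_measure_axioms by (intro finite_measure_pair_measure)
  have ny: "norm ?y = 1"
    using uv unfolding norm_eq_1
    by (simp add: inner_add_left inner_add_right inner_commute[of v u] norm_eq_1 flip: power2_eq_square)
  have g_meas [measurable]: "g \<in> borel_measurable borel" unfolding g_def by measurable
  have fexp: "f \<phi> w = relu_pow k (cos \<phi> * (u \<bullet> w) - sin \<phi> * (v \<bullet> w))
      * relu_pow k (cos \<alpha> * (cos \<phi> * (u \<bullet> w) - sin \<phi> * (v \<bullet> w))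
        + sin \<alpha> * (cos \<phi> * (v \<bullet> w) + sin \<phi> * (u \<bullet> w)))" for \<phi> w
    by (simp add: f_def g_def inner_add_left inner_plane_rotation[OF uv])
  have f_bound: "\<bar>f \<phi> w\<bar> \<le> 1" if "norm w = 1" for \<phi> w
  proof -
    let ?w = "plane_rotation u v \<phi> w"
    have w: "norm ?w = 1"
      using orthogonal_transformation_norm[OF orthogonal_plane_rotation[OF uv]] that by simp
    have "\<bar>u \<bullet> ?w\<bar> \<le> 1" "\<bar>?y \<bullet> ?w\<bar> \<le> 1"
      using Cauchy_Schwarz_ineq2[of u ?w] Cauchy_Schwarz_ineq2[of ?y ?w] w uv ny by simp_all
    then have "relu_pow k (u \<bullet> ?w) * relu_pow k (?y \<bullet> ?w) \<le> 1 * 1"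
      by (intro mult_mono relu_pow_le_1 relu_pow_nonneg) auto
    then show ?thesis by (simp add: f_def g_def relu_pow_nonneg)
  qed
  have [measurable]: "(\<lambda>w. u \<bullet> w) \<in> borel_measurable ?S" "(\<lambda>w. v \<bullet> w) \<in> borel_measurable ?S"
    by (intro measurable_sphere_measure; measurable)+
  have [measurable]: "(\<lambda>\<phi>. \<phi>) \<in> borel_measurable ?I"
    by (intro measurable_restrict_space1) simp
  have meas: "case_prod f \<in> borel_measurable (?I \<Otimes>\<^sub>M ?S)"
  proof -
    have [measurable]: "fst \<in> borel_measurable (?I \<Otimes>\<^sub>M ?S)"
      using measurable_compose[OF measurable_fst[of ?I ?S] \<open>(\<lambda>\<phi>. \<phi>) \<in> borel_measurable ?I\<close>] by simp
    have [measurable]: "(\<lambda>p. u \<bullet> snd p) \<in> borel_measurable (?I \<Otimes>\<^sub>M ?S)"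
        "(\<lambda>p. v \<bullet> snd p) \<in> borel_measurable (?I \<Otimes>\<^sub>M ?S)"
      by measurable
    show ?thesis unfolding fexp[abs_def] case_prod_beta by measurable
  qed
  have integrable: "integrable (?I \<Otimes>\<^sub>M ?S) (case_prod f)"
    by (rule PF.integrable_const_bound[where B=1])
      (use meas f_bound in \<open>auto simp: space_pair_measure space_sphere_measure\<close>)
  have inner1: "(LINT w|?S. f \<phi> w) = ridge_kernel k u ?y" for \<phi>
    unfolding f_def ridge_kernel_def g_def[symmetric]
    by (rule integral_sphere_measure_orthogonal[OF orthogonal_plane_rotation[OF uv] g_meas])
  have inner2: "(LINT \<phi>|?I. f \<phi> w) = (relu_pow k (r w))\<^sup>2 * (ridge_profile k (cos \<alpha>) / 2 ^ k)"
    if w: "norm w = 1" for w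
  proof -
    have r0: "r w \<ge> 0" by (simp add: r_def)
    \<comment> \<open>Polar coordinates of the projection of \<open>w\<close> to the plane; at
      radius 0 any angle serves.\<close>
    obtain \<psi> where \<psi>: "0 \<le> \<psi>" "\<psi> < 2 * pi" "u \<bullet> w = r w * cos \<psi>" "v \<bullet> w = r w * sin \<psi>"
    proof (cases "r w = 0")
      case True
      then have "u \<bullet> w = 0" "v \<bullet> w = 0" by (auto simp: r_def sum_power2_eq_zero_iff)
      then show thesis using True that[of 0] by simp
    next
      case False
      then have "(u \<bullet> w / r w)\<^sup>2 + (v \<bullet> w / r w)\<^sup>2 = 1"
        by (simp add: r_def power_divide add_divide_distrib[symmetric] sum_power2_eq_zero_iff)
      then obtain t where "0 \<le> t" "t < 2 * pi" "u \<bullet> w / r w = cos t" "v \<bullet> w / r w = sin t"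
        by (rule sincos_total_2pi)
      then show thesis using False that[of t] by (simp add: field_simps)
    qed
    define F where "F \<phi> = relu_pow k (cos (\<phi> - \<alpha> / 2)) * relu_pow k (cos (\<phi> + \<alpha> / 2))" for \<phi>
    have F_meas: "F \<in> borel_measurable borel" unfolding F_def by measurable
    have F_bound: "\<bar>F x\<bar> \<le> 1" for x
    proof -
      have "F x \<le> 1 * 1" unfolding F_def by (intro mult_mono relu_pow_le_1 relu_pow_nonneg) auto
      then show ?thesis by (simp add: F_def relu_pow_nonneg)
    qed
    have F_int: "F integrable_on {a..b}" for a b
      using set_borel_integral_eq_integral(1)[OF bounded_borel_set_integrable[OF F_meas F_bound]] .
    have F_per: "F (x + 2 * pi) = F x" for x
      using cos_periodic[of "x - \<alpha> / 2"] cos_periodic[of "x + \<alpha> / 2"]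
      by (simp add: F_def algebra_simps)
    \<comment> \<open>Rotating by \<open>\<phi>\<close> adds \<open>\<phi>\<close> to the polar
      angle \<open>\<psi>\<close>. The further shift by \<open>- \<alpha> / 2\<close> brings the two
      directions into the symmetric position of \<open>circle_ridge_integral\<close>.\<close>
    have fF: "f \<phi> w = (relu_pow k (r w))\<^sup>2 * F (\<phi> + (\<psi> - \<alpha> / 2))" for \<phi>
    proof -
      have "cos \<phi> * (u \<bullet> w) - sin \<phi> * (v \<bullet> w) = r w * cos (\<phi> + \<psi>)"
        by (simp add: \<psi> cos_add algebra_simps)
      moreover have "cos \<alpha> * (cos \<phi> * (u \<bullet> w) - sin \<phi> * (v \<bullet> w))
        + sin \<alpha> * (cos \<phi> * (v \<bullet> w) + sin \<phi> * (u \<bullet> w)) = r w * cos (\<phi> + \<psi> - \<alpha>)"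
        by (simp add: \<psi> cos_add cos_diff sin_add algebra_simps)
      moreover have "\<phi> + (\<psi> - \<alpha> / 2) - \<alpha> / 2 = \<phi> + \<psi> - \<alpha>" "\<phi> + (\<psi> - \<alpha> / 2) + \<alpha> / 2 = \<phi> + \<psi>"
        by simp_all
      ultimately show ?thesis
        by (simp add: fexp F_def relu_pow_mult[OF r0] power2_eq_square)
    qed
    have "(LINT \<phi>|?I. f \<phi> w) = (relu_pow k (r w))\<^sup>2 * (LINT \<phi>|?I. F (\<phi> + (\<psi> - \<alpha> / 2)))"
      unfolding fF by simp
    also have "(LINT \<phi>|?I. F (\<phi> + (\<psi> - \<alpha> / 2))) = integral {- pi..pi} (\<lambda>\<phi>. F (\<phi> + (\<psi> - \<alpha> / 2)))"
      by (rule integral_restrict_lborel_Icc[where B=1]) (use F_meas F_bound in measurable)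
    also have "\<dots> = integral {- pi + (\<psi> - \<alpha> / 2)..pi + (\<psi> - \<alpha> / 2)} F"
      by (rule integral_shift_Icc)
    also have "\<dots> = integral {- pi..pi} F"
    proof -
      let ?c = "\<psi> - \<alpha> / 2"
      have I: "integral {c..c + 2 * pi} F = integral {a..a + 2 * pi} F"
        if "a \<le> c" "c \<le> a + 2 * pi" for a c
        by (rule integral_periodic_shift[OF F_int F_per that])
      show ?thesis
      proof (cases "0 \<le> ?c")
        case True
        then have "- pi \<le> - pi + ?c" "- pi + ?c \<le> - pi + 2 * pi" using \<psi>(2) \<alpha> by linarith+
        from I[OF this] show ?thesis by (simp add: algebra_simps)
      next
        case False
        then have "- pi + ?c \<le> - pi" "- pi \<le> - pi + ?c + 2 * pi" using \<psi>(1) \<alpha> by linarith+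
        from I[OF this] show ?thesis by (simp add: algebra_simps)
      qed
    qed
    also have "\<dots> = ridge_profile k (cos \<alpha>) / 2 ^ k"
      unfolding F_def by (rule circle_ridge_integral[OF \<alpha>])
    finally show ?thesis .
  qed
  have "2 * pi * ridge_kernel k u ?y = (LINT \<phi>|?I. LINT w|?S. f \<phi> w)"
    unfolding inner1 by (simp add: measure_restrict_space measure_lborel_Icc space_restrict_space)
  also have "\<dots> = (LINT w|?S. LINT \<phi>|?I. f \<phi> w)"
    by (rule P.Fubini_integral[OF integrable, symmetric])
  also have "\<dots> = (LINT w|?S. (relu_pow k (r w))\<^sup>2 * (ridge_profile k (cos \<alpha>) / 2 ^ k))"
    by (rule Bochner_Integration.integral_cong) (auto simp: space_sphere_measure inner2)
  finally show ?thesis by (simp add: r_def)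
qed

lemma unit_vector_decomposition:
  fixes x y :: "'a::euclidean_space"
  assumes D: "DIM('a) \<ge> 2" and x: "norm x = 1" and y: "norm y = 1"
  obtains v where "norm v = 1" "x \<bullet> v = 0"
    "y = cos (arccos (x \<bullet> y)) *\<^sub>R x + sin (arccos (x \<bullet> y)) *\<^sub>R v"
    "cos (arccos (x \<bullet> y)) = x \<bullet> y" "0 \<le> arccos (x \<bullet> y)" "arccos (x \<bullet> y) \<le> pi"
proof -
  define t where "t = x \<bullet> y"
  have t: "-1 \<le> t" "t \<le> 1"
    using Cauchy_Schwarz_ineq2[of x y] x y by (auto simp: t_def)
  obtain v where v: "norm v = 1" "x \<bullet> v = 0" "y = t *\<^sub>R x + sqrt (1 - t\<^sup>2) *\<^sub>R v"
  proof -
    let ?z = "y - t *\<^sub>R x"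
    have z: "(norm ?z)\<^sup>2 = 1 - t\<^sup>2"
      using x y unfolding power2_norm_eq_inner
      by (simp add: inner_diff_left inner_diff_right norm_eq_1 t_def inner_commute power2_eq_square)
    have xz: "x \<bullet> ?z = 0" using x by (simp add: inner_diff_right norm_eq_1 t_def)
    have nz: "norm ?z = sqrt (1 - t\<^sup>2)" using z by (metis norm_ge_zero real_sqrt_unique)
    show thesis
    proof (cases "?z = 0")
      \<comment> \<open>Here \<open>y\<close> is \<open>x\<close> or \<open>- x\<close>, so the sine
        vanishes and any unit vector orthogonal to \<open>x\<close> will do; its existence is where
        dimension at least two enters.\<close>
      case True
      obtain v0 where v0: "v0 \<noteq> 0" "x \<bullet> v0 = 0"
        using orthogonal_to_vector_exists[OF D, of x] unfolding Linear_Algebra.orthogonal_def by blast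
      then have "norm (sgn v0) = 1" "x \<bullet> sgn v0 = 0"
        by (auto simp: norm_sgn sgn_div_norm)
      moreover have "sqrt (1 - t\<^sup>2) = 0" using True nz by simp
      ultimately show thesis using that[of "sgn v0"] True by simp
    next
      case False
      then have "norm (sgn ?z) = 1" "x \<bullet> sgn ?z = 0" "norm ?z *\<^sub>R sgn ?z = ?z"
        using xz by (auto simp: norm_sgn sgn_div_norm)
      then show thesis using that[of "sgn ?z"] nz by (metis add.commute diff_add_cancel)
    qed
  qed
  have a: "0 \<le> arccos t" "arccos t \<le> pi" "cos (arccos t) = t" "sin (arccos t) = sqrt (1 - t\<^sup>2)"
    using t by (simp_all add: arccos_lbound arccos_ubound sin_arccos)
  show thesis using that[OF v(1,2)] v(3) a unfolding t_def[symmetric] by simp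
qed

text \<open>One \<open>v\<close> serves both for \<open>y\<close> and, at angle 0, for
  \<open>x\<close> itself, so the radial factor \<open>R\<close> is common to both and cancels. The
  equation is cross-multiplied because positivity of \<open>ridge_profile k 1\<close> is obtained
  only later.\<close>

lemma ridge_kernel_profile:
  fixes x y :: "'a::euclidean_space"
  assumes D: "DIM('a) \<ge> 2" and x: "norm x = 1" and y: "norm y = 1"
  shows "ridge_kernel k x y * ridge_profile k 1 = ridge_kernel k x x * ridge_profile k (x \<bullet> y)"
proof -
  obtain v where v: "norm v = 1" "x \<bullet> v = 0"
    "y = cos (arccos (x \<bullet> y)) *\<^sub>R x + sin (arccos (x \<bullet> y)) *\<^sub>R v"
    and a: "cos (arccos (x \<bullet> y)) = x \<bullet> y" "0 \<le> arccos (x \<bullet> y)" "arccos (x \<bullet> y) \<le> pi"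
    using unit_vector_decomposition[OF D x y] by blast
  define R where "R = (LINT w|sphere_measure. (relu_pow k (sqrt ((x \<bullet> w)\<^sup>2 + (v \<bullet> w)\<^sup>2)))\<^sup>2)"
  have "2 * pi * ridge_kernel k x y = R * (ridge_profile k (x \<bullet> y) / 2 ^ k)"
    using ridge_kernel_plane[OF x v(1,2) a(2,3), of k] unfolding v(3)[symmetric] unfolding a(1) R_def .
  moreover have "2 * pi * ridge_kernel k x x = R * (ridge_profile k 1 / 2 ^ k)"
    using ridge_kernel_plane[OF x v(1,2), of 0 k] by (simp add: R_def)
  ultimately have "2 * pi * ridge_kernel k x y * ridge_profile k 1 = 2 * pi * ridge_kernel k x x * ridge_profile k (x \<bullet> y)"
    by simp
  then show ?thesis by simp
qed

section \<open>Power series of the ridge profile\<close>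

text \<open>These are the central binomial coefficients \<open>(2 * j choose j) / 4 ^ j\<close>, the
  Taylor coefficients of \<open>1 / sqrt (1 - z)\<close>.\<close>

definition inv_sqrt_coeff :: "nat \<Rightarrow> real" where
  "inv_sqrt_coeff j = (- 1) ^ j * ((- 1 / 2) gchoose j)"

lemma inv_sqrt_coeff_Suc:
  "inv_sqrt_coeff (Suc j) = inv_sqrt_coeff j * ((real j + 1 / 2) / (real j + 1))"
proof -
  have "(- 1 / 2) * ((- 1 / 2 :: real) gchoose j) =
      real j * ((- 1 / 2) gchoose j) + real (Suc j) * ((- 1 / 2) gchoose Suc j)"
    by (rule gbinomial_mult_1)
  then have "((- 1 / 2 :: real) gchoose Suc j) = - ((real j + 1 / 2) / (real j + 1)) * ((- 1 / 2) gchoose j)"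
    by (simp add: field_simps)
  then show ?thesis by (simp add: inv_sqrt_coeff_def)
qed

lemma inv_sqrt_coeff_pos: "0 < inv_sqrt_coeff j"
proof (induction j)
  case (Suc j)
  then show ?case unfolding inv_sqrt_coeff_Suc by (intro mult_pos_pos divide_pos_pos) auto
qed (simp add: inv_sqrt_coeff_def)

text \<open>The products of \<open>j\<close> with the square of the \<open>j\<close>-th coefficient
  increase, because \<open>j * (j + 1)\<close> is at most the square of \<open>j + 1 / 2\<close>; at
  \<open>j = 1\<close> the product is \<open>1 / 4\<close>.\<close>

lemma inv_sqrt_coeff_ge:
  assumes "j \<ge> 1"
  shows "1 / (2 * sqrt (real j)) \<le> inv_sqrt_coeff j"
proof -
  have "1 \<le> (inv_sqrt_coeff j)\<^sup>2 * (4 * real j)"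
    using assms
  proof (induction j rule: dec_induct)
    case base
    have "inv_sqrt_coeff 1 = 1 / 2" using inv_sqrt_coeff_Suc[of 0] by (simp add: inv_sqrt_coeff_def)
    then show ?case by (simp only:) (simp add: power2_eq_square)
  next
    case (step j)
    have "real j * (real j + 1) \<le> (real j + 1 / 2)\<^sup>2" by (simp add: power2_eq_square algebra_simps)
    then have "real j \<le> (real j + 1 / 2)\<^sup>2 / (real j + 1)" by (simp add: pos_le_divide_eq)
    also have "\<dots> = ((real j + 1 / 2) / (real j + 1))\<^sup>2 * (real j + 1)"
      by (simp add: power2_eq_square)
    finally have "(inv_sqrt_coeff j)\<^sup>2 * (4 * real j)
        \<le> (inv_sqrt_coeff j)\<^sup>2 * (4 * (((real j + 1 / 2) / (real j + 1))\<^sup>2 * (real j + 1)))"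
      by (intro mult_left_mono) auto
    also have "\<dots> = (inv_sqrt_coeff (Suc j))\<^sup>2 * (4 * real (Suc j))"
      unfolding inv_sqrt_coeff_Suc power_mult_distrib by (simp add: add.commute mult_ac)
    finally show ?case using step by linarith
  qed
  then have "(1 / (2 * sqrt (real j)))\<^sup>2 \<le> (inv_sqrt_coeff j)\<^sup>2"
    using assms by (simp add: power_divide power_mult_distrib field_simps)
  then show ?thesis using inv_sqrt_coeff_pos[of j] by (simp add: power2_le_iff_abs_le)
qed

lemma inv_sqrt_sums:
  fixes z :: real
  assumes "\<bar>z\<bar> < 1"
  shows "(\<lambda>j. inv_sqrt_coeff j * z ^ j) sums (1 / sqrt (1 - z))"
proof -
  have "(\<lambda>j. ((- 1 / 2) gchoose j) * (- z) ^ j) sums (1 + - z) powr (- 1 / 2)"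
    by (rule gen_binomial_real) (use assms in simp)
  moreover have "(1 + - z) powr (- 1 / 2) = 1 / sqrt (1 - z)"
    using assms by (simp add: powr_minus powr_half_sqrt inverse_eq_divide flip: minus_divide_left)
  moreover have "((- 1 / 2) gchoose j) * (- z) ^ j = inv_sqrt_coeff j * z ^ j" for j
    by (simp add: inv_sqrt_coeff_def power_minus[of z])
  ultimately show ?thesis by simp
qed

lemma ridge_profile_substitution:
  assumes t: "\<bar>t\<bar> \<le> 1"
  shows "((\<lambda>y. t ^ (m + 1) * ((1 - y) ^ m / sqrt (1 - t\<^sup>2 * y\<^sup>2))) has_integral
    (ridge_profile m t - integral {- pi / 2..0} (\<lambda>v. (t - sin v) ^ m))) {0..1}"
proof -
  define f where "f v = (t - sin v) ^ m" for v
  define g where "g y = arcsin (t * y)" for y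
  define a where "a = arcsin t"
  have a: "- pi / 2 \<le> a" "a \<le> pi / 2" using t arcsin_lbound[of t] arcsin_ubound[of t] by (auto simp: a_def)
  have ty: "\<bar>t * y\<bar> \<le> 1" if "y \<in> {0..1}" for y
    using mult_mono[of "\<bar>t\<bar>" 1 "\<bar>y\<bar>" 1] t that by (simp add: abs_mult)
  have fc: "continuous_on S f" for S unfolding f_def[abs_def] by (intro continuous_intros)
  have fi: "f integrable_on {x..y}" for x y by (intro integrable_continuous_real fc)
  have "((\<lambda>y. (t / sqrt (1 - (t * y)\<^sup>2)) *\<^sub>R f (g y)) has_integral
      (integral {g 0..g 1} f - integral {g 1..g 0} f)) {0..1}"
  \<comment> \<open>The point 1 is excepted since for \<open>\<bar>t\<bar> = 1\<close> the
    derivative of \<open>arcsin (t * y)\<close> blows up there.\<close>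
  proof (rule has_integral_substitution_general[of "{1}"])
    show "g ` {0..1} \<subseteq> {- pi / 2..pi / 2}"
      using ty arcsin_lbound arcsin_ubound by (fastforce simp: g_def abs_le_iff)
    show "continuous_on {0..1} g"
      unfolding g_def[abs_def] using ty
      by (intro continuous_on_arcsin continuous_intros) (auto simp: abs_le_iff)
    fix y :: real assume y: "y \<in> {0..1} - {1}"
    have "\<bar>t * y\<bar> \<le> 1 * \<bar>y\<bar>" unfolding abs_mult by (intro mult_right_mono t) auto
    then have "\<bar>t * y\<bar> < 1" using y by auto
    then have "(g has_real_derivative inverse (sqrt (1 - (t * y)\<^sup>2)) * t) (at y)"
      unfolding g_def[abs_def] by (auto intro!: derivative_eq_intros simp: abs_less_iff)
    then show "(g has_real_derivative t / sqrt (1 - (t * y)\<^sup>2)) (at y within {0..1})"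
      by (simp add: field_simps has_field_derivative_at_within)
  qed (use fc in auto)
  moreover have "(t / sqrt (1 - (t * y)\<^sup>2)) *\<^sub>R f (g y)
      = t ^ (m + 1) * ((1 - y) ^ m / sqrt (1 - t\<^sup>2 * y\<^sup>2))" if "y \<in> {0..1}" for y
  proof -
    have "f (g y) = (t * (1 - y)) ^ m"
      using ty[OF that] by (simp add: f_def g_def abs_le_iff algebra_simps)
    then show ?thesis by (simp add: power_mult_distrib)
  qed
  ultimately have "((\<lambda>y. t ^ (m + 1) * ((1 - y) ^ m / sqrt (1 - t\<^sup>2 * y\<^sup>2))) has_integral
      (integral {g 0..g 1} f - integral {g 1..g 0} f)) {0..1}"
    by (subst has_integral_cong[symmetric]) auto
  \<comment> \<open>The difference is the oriented integral from 0 to \<open>arcsin t\<close>: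
    according to the sign of \<open>t\<close>, one of the two intervals is reversed and hence
    empty.\<close>
  moreover have "integral {g 0..g 1} f - integral {g 1..g 0} f = ridge_profile m t - integral {- pi / 2..0} f"
  proof (cases "0 \<le> a")
    case True
    have "integral {- pi / 2..0} f + integral {0..a} f = integral {- pi / 2..a} f"
      by (rule Henstock_Kurzweil_Integration.integral_combine) (use True fi in auto)
    then show ?thesis using True
      by (cases "a = 0") (auto simp: g_def ridge_profile_def f_def[abs_def] a_def)
  next
    case False
    have "integral {- pi / 2..a} f + integral {a..0} f = integral {- pi / 2..0} f"
      by (rule Henstock_Kurzweil_Integration.integral_combine) (use False fi a in auto)
    then show ?thesis using False
      by (auto simp: g_def ridge_profile_def f_def[abs_def] a_def)
  qed
  ultimately show ?thesis by (simp add: f_def[abs_def])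
qed

lemma has_integral_right_power:
  fixes r :: real
  assumes r: "0 \<le> r" "r \<le> 1"
  shows "((\<lambda>y. if y \<in> {1 - r..1} then C * (1 - y) ^ m else 0) has_integral C * (r ^ (m + 1) / (m + 1))) {0..1}"
proof -
  have "((\<lambda>y. - C * (1 - y) ^ Suc m / (m + 1)) has_real_derivative C * (1 - y) ^ m) (at y within A)" for y A
  proof -
    have "((\<lambda>y. (1 - y) ^ Suc m) has_real_derivative - (real m + 1) * (1 - y) ^ m) (at y within A)"
      by (rule derivative_eq_intros refl | simp add: algebra_simps del: power_Suc)+
    then have "((\<lambda>y. - C / (m + 1) * (1 - y) ^ Suc m) has_real_derivative
        - C / (m + 1) * (- (real m + 1) * (1 - y) ^ m)) (at y within A)"
      by (rule DERIV_cmult)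
    moreover have "- C / x * (- x * z) = C * z" if "x \<noteq> 0" for x z :: real
      using that by simp
    from this[of "real m + 1" "(1 - y) ^ m"]
    have "- C / (m + 1) * (- (real m + 1) * (1 - y) ^ m) = C * (1 - y) ^ m"
      by (simp add: add.commute)
    ultimately show ?thesis by (simp only: times_divide_eq_left)
  qed
  then have "((\<lambda>y. C * (1 - y) ^ m) has_integral
      (- C * (1 - 1) ^ Suc m / (m + 1) - (- C * (1 - (1 - r)) ^ Suc m / (m + 1)))) {1 - r..1}"
    by (intro fundamental_theorem_of_calculus)
      (use r in \<open>auto simp flip: has_real_derivative_iff_has_vector_derivative simp del: power_Suc\<close>)
  then have "((\<lambda>y. C * (1 - y) ^ m) has_integral C * (r ^ (m + 1) / (m + 1))) {1 - r..1}"
    by simp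
  with r show ?thesis
    by (intro has_integral_restrict[THEN iffD2]) auto
qed

text \<open>The entries \<open>t i j\<close> stay abstract: all that matters is that the forms of
  their powers are nonnegative, and at least \<open>c\<close> from exponent \<open>2 * N\<close> on.
  The bound consists of \<open>N\<close> terms of the binomial series, each of size
  \<open>1 / sqrt N\<close>, integrated against \<open>(1 - y) ^ m\<close> over an interval of
  length of order \<open>1 / N\<close> on which \<open>y ^ (4 * N)\<close> is bounded below.\<close>

lemma ridge_profile_form_ge:
  fixes t :: "nat \<Rightarrow> nat \<Rightarrow> real" and a :: "nat \<Rightarrow> real" and N m s :: nat
  assumes t: "\<And>i j. i < n \<Longrightarrow> j < n \<Longrightarrow> \<bar>t i j\<bar> \<le> 1"
    and Q: "\<And>l. 0 \<le> (\<Sum>i<n. \<Sum>j<n. a i * a j * t i j ^ l)"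
    and c: "\<And>l. 2 * N \<le> l \<Longrightarrow> c \<le> (\<Sum>i<n. \<Sum>j<n. a i * a j * t i j ^ l)"
    and N: "N \<ge> 1" and c0: "0 \<le> c"
  shows "c * (sqrt N / 8 * ((1 / (8 * N)) ^ (m + 1) / (m + 1)))
    \<le> (\<Sum>i<n. \<Sum>j<n. a i * a j * (t i j ^ s * ridge_profile m (t i j)))"
proof -
  define q where "q l = (\<Sum>i<n. \<Sum>j<n. a i * a j * t i j ^ l)" for l
  have q0: "0 \<le> q l" for l using Q by (simp add: q_def)
  \<comment> \<open>The part of the profile over negative \<open>v\<close>. There
    \<open>- sin v\<close> is nonnegative, so expanding the power gives a combination of powers of
    \<open>t i j\<close> with nonnegative weights, and this part may be dropped.\<close>
  define L where "L x = integral {- pi / 2..0} (\<lambda>v. (x - sin v) ^ m)" for x :: real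
  have left: "0 \<le> (\<Sum>i<n. \<Sum>j<n. a i * a j * (t i j ^ s * L (t i j)))"
  proof -
    define w where "w v = (\<Sum>i<n. \<Sum>j<n. a i * a j * (t i j ^ s * (t i j - sin v) ^ m))" for v
    have "(w has_integral (\<Sum>i<n. \<Sum>j<n. a i * a j * (t i j ^ s * L (t i j)))) {- pi / 2..0}"
      unfolding w_def[abs_def] L_def
      by (intro has_integral_sum has_integral_mult_right integrable_integral
          integrable_continuous_real continuous_intros) auto
    moreover have "0 \<le> w v" if "v \<in> {- pi / 2..0}" for v
    proof -
      have sv: "0 \<le> - sin v" using sin_ge_zero[of "- v"] that pi_gt_zero by (simp add: field_simps)
      have "w v = (\<Sum>i<n. \<Sum>j<n. \<Sum>p\<le>m. real (m choose p) * (- sin v) ^ (m - p) * (a i * a j * t i j ^ (s + p)))"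
        unfolding w_def
      proof (intro sum.cong refl)
        fix i j
        have "(t i j - sin v) ^ m = (\<Sum>p\<le>m. real (m choose p) * t i j ^ p * (- sin v) ^ (m - p))"
          using binomial_ring[of "t i j" "- sin v" m] by simp
        then show "a i * a j * (t i j ^ s * (t i j - sin v) ^ m)
            = (\<Sum>p\<le>m. real (m choose p) * (- sin v) ^ (m - p) * (a i * a j * t i j ^ (s + p)))"
          by (simp only: sum_distrib_left) (intro sum.cong refl, simp add: power_add mult_ac)
      qed
      also have "\<dots> = (\<Sum>i<n. \<Sum>p\<le>m. \<Sum>j<n. real (m choose p) * (- sin v) ^ (m - p) * (a i * a j * t i j ^ (s + p)))"
        by (intro sum.cong refl sum.swap)
      also have "\<dots> = (\<Sum>p\<le>m. \<Sum>i<n. \<Sum>j<n. real (m choose p) * (- sin v) ^ (m - p) * (a i * a j * t i j ^ (s + p)))"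
        by (rule sum.swap)
      also have "\<dots> = (\<Sum>p\<le>m. real (m choose p) * (- sin v) ^ (m - p) * q (s + p))"
        by (simp only: q_def sum_distrib_left)
      also have "\<dots> \<ge> 0" using sv q0 by (intro sum_nonneg mult_nonneg_nonneg zero_le_power) auto
      finally show ?thesis .
    qed
    ultimately show ?thesis by (rule has_integral_nonneg)
  qed
  define h where "h y = (\<Sum>i<n. \<Sum>j<n. a i * a j * (t i j ^ s *
      (t i j ^ (m + 1) * ((1 - y) ^ m / sqrt (1 - (t i j)\<^sup>2 * y\<^sup>2)))))" for y
  have hint: "(h has_integral (\<Sum>i<n. \<Sum>j<n. a i * a j * (t i j ^ s * (ridge_profile m (t i j) - L (t i j))))) {0..1}"
    unfolding h_def[abs_def] L_def
    by (intro has_integral_sum has_integral_mult_right ridge_profile_substitution) (use t in auto)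
  \<comment> \<open>With this length, Bernoulli's inequality gives
    \<open>y ^ (4 * N) \<ge> 1 - 4 * N * r = 1 / 2\<close> on the interval
    \<open>{1 - r..1}\<close>.\<close>
  define r where "r = 1 / (8 * real N)"
  have r: "0 \<le> r" "r \<le> 1" using N by (simp_all add: r_def)
  define l where "l y = (if y \<in> {1 - r..1} then (c * (sqrt N / 8)) * (1 - y) ^ m else 0)" for y
  have lint: "(l has_integral (c * (sqrt N / 8)) * (r ^ (m + 1) / (m + 1))) {0..1}"
    unfolding l_def[abs_def] by (rule has_integral_right_power[OF r])
  txt \<open>Only the terms of the binomial series with index between \<open>N\<close> and \<open>2 * N\<close> are kept.\<close>
  have lh: "l y \<le> h y" if y: "0 \<le> y" "y < 1" for y
  proof -
    have "(\<lambda>p. (1 - y) ^ m * (inv_sqrt_coeff p * y ^ (2 * p) * q (s + (m + 1) + 2 * p))) sums h y"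
    proof -
      have "(\<lambda>p. a i * a j * (t i j ^ s * (t i j ^ (m + 1) * ((1 - y) ^ m *
          (inv_sqrt_coeff p * ((t i j)\<^sup>2 * y\<^sup>2) ^ p)))))
        sums (a i * a j * (t i j ^ s * (t i j ^ (m + 1) * ((1 - y) ^ m * (1 / sqrt (1 - (t i j)\<^sup>2 * y\<^sup>2))))))"
        if "i \<in> {..<n}" "j \<in> {..<n}" for i j
      proof (intro sums_mult inv_sqrt_sums)
        have "(t i j)\<^sup>2 \<le> 1" using t[of i j] that by (simp add: abs_square_le_1)
        then have "(t i j)\<^sup>2 * y\<^sup>2 \<le> 1 * y\<^sup>2" by (intro mult_right_mono) auto
        also have "y\<^sup>2 < 1" using y by (simp add: abs_square_less_1)
        finally show "\<bar>(t i j)\<^sup>2 * y\<^sup>2\<bar> < 1" by simp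
      qed
      then have "(\<lambda>p. \<Sum>i<n. \<Sum>j<n. a i * a j * (t i j ^ s * (t i j ^ (m + 1) * ((1 - y) ^ m *
          (inv_sqrt_coeff p * ((t i j)\<^sup>2 * y\<^sup>2) ^ p)))))
        sums (\<Sum>i<n. \<Sum>j<n. a i * a j * (t i j ^ s * (t i j ^ (m + 1) * ((1 - y) ^ m * (1 / sqrt (1 - (t i j)\<^sup>2 * y\<^sup>2))))))"
        by (intro sums_sum)
      moreover have "(\<Sum>i<n. \<Sum>j<n. a i * a j * (t i j ^ s * (t i j ^ (m + 1) * ((1 - y) ^ m *
          (inv_sqrt_coeff p * ((t i j)\<^sup>2 * y\<^sup>2) ^ p)))))
        = (1 - y) ^ m * (inv_sqrt_coeff p * y ^ (2 * p) * q (s + (m + 1) + 2 * p))" for p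
        unfolding q_def sum_distrib_left
      proof (intro sum.cong refl)
        have "(x\<^sup>2) ^ p = x ^ (2 * p)" for x :: real by (simp add: power_mult)
        then show "a i * a j * (t i j ^ s * (t i j ^ (m + 1) * ((1 - y) ^ m *
            (inv_sqrt_coeff p * ((t i j)\<^sup>2 * y\<^sup>2) ^ p))))
          = (1 - y) ^ m * (inv_sqrt_coeff p * y ^ (2 * p) * (a i * a j * t i j ^ (s + (m + 1) + 2 * p)))" for i j
          by (simp only: power_add power_mult_distrib mult_ac)
      qed
      ultimately show ?thesis by (simp add: h_def)
    qed
    note hs = this
    have "(\<Sum>p\<in>{N..<2 * N}. (1 - y) ^ m * (inv_sqrt_coeff p * y ^ (2 * p) * q (s + (m + 1) + 2 * p))) \<le> h y"
      unfolding sums_unique[OF hs]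
      using y inv_sqrt_coeff_pos q0 sums_summable[OF hs]
      by (intro sum_le_suminf) (auto intro!: mult_nonneg_nonneg simp: less_imp_le)
    \<comment> \<open>Each factor is replaced by its minimum over the block of indices; the
      exponents \<open>s + (m + 1) + 2 * p\<close> all exceed \<open>2 * N\<close>, so
      \<open>c\<close> applies.\<close>
    moreover have "(\<Sum>p\<in>{N..<2 * N}. (1 - y) ^ m * (1 / (2 * sqrt (2 * N)) * y ^ (4 * N) * c))
      \<le> (\<Sum>p\<in>{N..<2 * N}. (1 - y) ^ m * (inv_sqrt_coeff p * y ^ (2 * p) * q (s + (m + 1) + 2 * p)))"
    proof (intro sum_mono mult_left_mono mult_mono)
      fix p assume p: "p \<in> {N..<2 * N}"
      have "1 / (2 * sqrt (2 * N)) \<le> 1 / (2 * sqrt p)"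
        using p N by (intro divide_left_mono mult_left_mono) auto
      also have "\<dots> \<le> inv_sqrt_coeff p" using p N by (intro inv_sqrt_coeff_ge) auto
      finally show "1 / (2 * sqrt (2 * N)) \<le> inv_sqrt_coeff p" by simp
      show "y ^ (4 * N) \<le> y ^ (2 * p)" using p y by (intro power_decreasing) auto
      show "c \<le> q (s + (m + 1) + 2 * p)" unfolding q_def using p by (intro c) auto
    qed (use y c0 less_imp_le[OF inv_sqrt_coeff_pos] in auto)
    moreover have "l y \<le> (\<Sum>p\<in>{N..<2 * N}. (1 - y) ^ m * (1 / (2 * sqrt (2 * N)) * y ^ (4 * N) * c))"
    proof (cases "y \<in> {1 - r..1}")
      case True
      have "1 + real (4 * N) * (y - 1) \<le> (1 + (y - 1)) ^ (4 * N)"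
        using y by (intro Bernoulli_inequality) auto
      moreover have "real (4 * N) * (1 - y) \<le> real (4 * N) * r" using True by (intro mult_left_mono) auto
      moreover have "real (4 * N) * r = 1 / 2" using N by (simp add: r_def)
      moreover have "real (4 * N) * (y - 1) = - (real (4 * N) * (1 - y))" by (simp add: algebra_simps)
      ultimately have yN: "1 / 2 \<le> y ^ (4 * N)" by simp
      have "sqrt N / 4 \<le> real N * (1 / (2 * sqrt (2 * N)))"
      proof -
        have "sqrt (2 * N) \<le> 2 * sqrt N"
          using real_sqrt_le_mono[of "2 * real N" "4 * real N"] by (simp add: real_sqrt_mult)
        then have "sqrt N * (2 * sqrt (2 * N)) \<le> sqrt N * (2 * (2 * sqrt N))" by (intro mult_left_mono) auto
        also have "\<dots> = 4 * real N" by simp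
        finally show ?thesis using N by (simp add: field_simps)
      qed
      then have "sqrt N / 4 * (1 / 2) \<le> real N * (1 / (2 * sqrt (2 * N))) * y ^ (4 * N)"
        by (intro mult_mono yN) auto
      then have "(1 - y) ^ m * c * (sqrt N / 4 * (1 / 2)) \<le> (1 - y) ^ m * c * (real N * (1 / (2 * sqrt (2 * N))) * y ^ (4 * N))"
        using y c0 by (intro mult_left_mono) auto
      then show ?thesis using True by (simp add: l_def mult_ac)
    next
      case False
      then show ?thesis using y c0 by (auto simp: l_def intro!: sum_nonneg mult_nonneg_nonneg)
    qed
    ultimately show ?thesis by linarith
  qed
  \<comment> \<open>The comparison is available only for \<open>y < 1\<close>: at 1 the series may
    diverge, and a division by zero would give the value 0. The value at this single point is
    replaced.\<close>
  have "((\<lambda>y. if y = 1 then l 1 else h y) has_integral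
      (\<Sum>i<n. \<Sum>j<n. a i * a j * (t i j ^ s * (ridge_profile m (t i j) - L (t i j))))) {0..1}"
    by (rule has_integral_spike_finite[OF _ _ hint, of "{1}"]) auto
  from has_integral_le[OF lint this]
  have "c * (sqrt N / 8) * (r ^ (m + 1) / (m + 1))
      \<le> (\<Sum>i<n. \<Sum>j<n. a i * a j * (t i j ^ s * (ridge_profile m (t i j) - L (t i j))))"
    using lh by force
  also have "\<dots> = (\<Sum>i<n. \<Sum>j<n. a i * a j * (t i j ^ s * ridge_profile m (t i j)))
      - (\<Sum>i<n. \<Sum>j<n. a i * a j * (t i j ^ s * L (t i j)))"
    by (simp only: sum_subtractf[symmetric] right_diff_distrib)
  finally show ?thesis using left by (simp add: r_def mult.assoc)
qed

section \<open>Derivative tensors of ridge functions\<close>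

text \<open>Words instead of multi-indices match the indexing of tensor entries and keep multinomial
  coefficients out of the expansion of a power of an inner product.\<close>

definition basis_words :: "nat \<Rightarrow> 'a::euclidean_space list set" where
  "basis_words s = {bs. set bs \<subseteq> Basis \<and> length bs = s}"

definition monomial :: "'a::euclidean_space list \<Rightarrow> 'a \<Rightarrow> real" where
  "monomial bs x = (\<Prod>b\<leftarrow>bs. x \<bullet> b)"

lemma finite_basis_words: "finite (basis_words s :: 'a::euclidean_space list set)"
  unfolding basis_words_def by (rule finite_lists_length_eq) simp

lemma card_basis_words: "card (basis_words s :: 'a::euclidean_space list set) = DIM('a) ^ s"
  unfolding basis_words_def by (rule card_lists_length_eq) simp

lemma basis_words_Suc:
  "basis_words (Suc s) = (\<lambda>(b, bs). b # bs) ` (Basis \<times> basis_words s)"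
  by (auto simp: basis_words_def length_Suc_conv image_iff)

lemma monomial_append: "monomial (bs @ cs) x = monomial bs x * monomial cs x"
  by (simp add: monomial_def)

text \<open>The tensor power as a feature map: it exhibits every matrix of powers as a Gram matrix
  and evaluates the inner product of derivative tensors.\<close>

lemma power_inner_eq_sum_monomial:
  fixes x y :: "'a::euclidean_space"
  shows "(x \<bullet> y) ^ s = (\<Sum>bs\<in>basis_words s. monomial bs x * monomial bs y)"
proof (induction s)
  case 0
  have "basis_words 0 = {[] :: 'a list}" by (auto simp: basis_words_def)
  then show ?case by (simp add: monomial_def)
next
  case (Suc s)
  have "(\<Sum>bs\<in>basis_words (Suc s). monomial bs x * monomial bs y)
      = (\<Sum>(b, bs)\<in>Basis \<times> basis_words s. ((x \<bullet> b) * (y \<bullet> b)) * (monomial bs x * monomial bs y))"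
    unfolding basis_words_Suc
    by (subst sum.reindex) (auto simp: inj_on_def monomial_def case_prod_beta mult_ac)
  also have "\<dots> = (\<Sum>b\<in>Basis. (x \<bullet> b) * (y \<bullet> b)) * (\<Sum>bs\<in>basis_words s. monomial bs x * monomial bs y)"
    by (simp add: sum_product sum.cartesian_product)
  also have "\<dots> = (x \<bullet> y) ^ Suc s"
    by (simp only: Suc.IH[symmetric] euclidean_inner[of x y] power_Suc)
  finally show ?case by simp
qed

text \<open>
  On the hyperplane \<open>x \<bullet> w = 0\<close> the value is unspecified, but it is still a function of \<open>x \<bullet> w\<close>
  alone; this is what makes the tensor entries measurable.
\<close>

lemma deriv_tensor_ridge:
  fixes x :: "'a::euclidean_space"
  assumes "length bs \<le> k"
  shows "\<exists>G. \<forall>w. deriv_tensor (\<lambda>w. relu_pow k (x \<bullet> w)) w bs = G (x \<bullet> w)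
    \<and> (x \<bullet> w \<noteq> 0 \<longrightarrow> G (x \<bullet> w) = fact k / fact (k - length bs) * relu_pow (k - length bs) (x \<bullet> w) * monomial bs x)"
  using assms
proof (induction bs)
  case Nil
  then show ?case
    by (intro exI[of _ "relu_pow k"]) (simp add: deriv_tensor_def monomial_def)
next
  case (Cons b bs)
  let ?f = "\<lambda>w. relu_pow k (x \<bullet> w)" and ?j = "k - length bs"
  obtain G where G: "\<And>w. deriv_tensor ?f w bs = G (x \<bullet> w)"
    and G0: "\<And>w. x \<bullet> w \<noteq> 0 \<Longrightarrow>
      G (x \<bullet> w) = fact k / fact ?j * relu_pow ?j (x \<bullet> w) * monomial bs x"
    using Cons by auto
  have Gf: "foldr partial_deriv bs ?f = (\<lambda>w. G (x \<bullet> w))"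
    using G by (auto simp: deriv_tensor_def fun_eq_iff)
  have D: "deriv_tensor ?f w (b # bs) = deriv (\<lambda>t. G (x \<bullet> w + t * (x \<bullet> b))) 0" for w
    unfolding deriv_tensor_def foldr_Cons o_apply Gf partial_deriv_def
    by (simp add: inner_add_right)
  show ?case
  proof (intro exI[of _ "\<lambda>y. deriv (\<lambda>t. G (y + t * (x \<bullet> b))) 0"] allI conjI impI)
    fix w
    show "deriv_tensor ?f w (b # bs) = deriv (\<lambda>t. G (x \<bullet> w + t * (x \<bullet> b))) 0" by (rule D)
    assume nz: "x \<bullet> w \<noteq> 0"
    define y where "y = x \<bullet> w"
    obtain j where j: "?j = Suc j" "k - length (b # bs) = j" using Cons.prems by (cases ?j) auto
    have xx: "x \<noteq> 0" using nz by auto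
    \<comment> \<open>Every real \<open>z\<close> is of the form \<open>x \<bullet> w\<close>, with
      \<open>w\<close> a multiple of \<open>x\<close>, so \<open>G\<close> is known on the whole
      punctured line.\<close>
    have Gy: "G z = fact k / fact ?j * relu_pow ?j z * monomial bs x" if "z \<noteq> 0" for z
      using G0[of "(z / (x \<bullet> x)) *\<^sub>R x"] that xx by simp
    \<comment> \<open>The open half-line containing \<open>y\<close>; on it \<open>G\<close> agrees
      with a smooth function, and \<open>deriv\<close> depends only on values near the
      point.\<close>
    define S where "S = (if y > 0 then {0<..} else {..<0::real})"
    have "((\<lambda>t. y + t * (x \<bullet> b)) \<longlongrightarrow> y + 0 * (x \<bullet> b)) (nhds 0)"
      by (intro tendsto_intros filterlim_ident)
    then have tend: "((\<lambda>t. y + t * (x \<bullet> b)) \<longlongrightarrow> y) (nhds 0)" by simp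
    have "open S" "y \<in> S" using nz by (auto simp: S_def y_def)
    from topological_tendstoD[OF tend this]
    have ev: "\<forall>\<^sub>F t in nhds 0. y + t * (x \<bullet> b) \<in> S" .
    let ?c = "fact k / fact (Suc j) * monomial bs x"
    have "deriv (\<lambda>t. G (y + t * (x \<bullet> b))) 0 = (x \<bullet> b) * real (Suc j) * ?c * relu_pow j y"
    proof (cases "y > 0")
      case True
      have "deriv (\<lambda>t. G (y + t * (x \<bullet> b))) 0 = deriv (\<lambda>t. ?c * (y + t * (x \<bullet> b)) ^ Suc j) 0"
        using ev by (intro deriv_cong_ev refl; eventually_elim) (use True in \<open>auto simp: S_def Gy j relu_pow_pos\<close>)
      also have "\<dots> = (x \<bullet> b) * real (Suc j) * ?c * y ^ j"
        by (rule DERIV_imp_deriv) (auto intro!: derivative_eq_intros simp del: power_Suc)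
      finally show ?thesis using True by (simp add: relu_pow_pos)
    next
      case False
      then have y: "y < 0" using nz by (simp add: y_def)
      have "deriv (\<lambda>t. G (y + t * (x \<bullet> b))) 0 = deriv (\<lambda>t. 0) 0"
        using ev by (intro deriv_cong_ev refl; eventually_elim) (use False in \<open>auto simp: S_def Gy relu_pow_nonpos\<close>)
      then show ?thesis using y by (simp add: relu_pow_nonpos)
    qed
    also have "\<dots> = fact k / fact j * relu_pow j y * monomial (b # bs) x"
      by (simp add: monomial_def fact_Suc del: of_nat_Suc)
    finally show "deriv (\<lambda>t. G (x \<bullet> w + t * (x \<bullet> b))) 0 =
        fact k / fact (k - length (b # bs)) * relu_pow (k - length (b # bs)) (x \<bullet> w) * monomial (b # bs) x"
      unfolding j(2) y_def .
  qed
qed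

lemma borel_measurable_eq_except_0:
  fixes G F :: "real \<Rightarrow> real"
  assumes "F \<in> borel_measurable borel" "\<And>y. y \<noteq> 0 \<Longrightarrow> G y = F y"
  shows "G \<in> borel_measurable borel"
proof -
  have "G = (\<lambda>y. if y = 0 then G 0 else F y)" using assms(2) by auto
  moreover have "(\<lambda>y. if y = 0 then G 0 else F y) \<in> borel_measurable borel"
    using assms(1) by measurable
  ultimately show ?thesis by simp
qed

text \<open>Off the great subspheres orthogonal to \<open>x\<close> and \<open>y\<close>, each
  tensor entry is a ridge function times a monomial in the direction; summing the products of
  monomials over all words restores \<open>(x \<bullet> y) ^ s\<close>.\<close>

lemma stiffness_entry:
  fixes x y :: "'a::euclidean_space"
  assumes s: "s \<le> k" and x: "norm x = 1" and y: "norm y = 1"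
  shows "(LINT w|sphere_measure. tensor_inner s
       (deriv_tensor (\<lambda>w. relu_pow k (x \<bullet> w)) w) (deriv_tensor (\<lambda>w. relu_pow k (y \<bullet> w)) w))
    = (fact k / fact (k - s))\<^sup>2 * ((x \<bullet> y) ^ s * ridge_kernel (k - s) x y)"
proof -
  let ?m = "k - s" and ?T = "\<lambda>x::'a. deriv_tensor (\<lambda>w. relu_pow k (x \<bullet> w))"
  let ?c = "fact k / fact ?m :: real"
  have repr: "\<exists>G. G \<in> borel_measurable borel \<and> (\<forall>w. ?T x w bs = G (x \<bullet> w))
      \<and> (\<forall>w. x \<bullet> w \<noteq> 0 \<longrightarrow> ?T x w bs = ?c * relu_pow ?m (x \<bullet> w) * monomial bs x)"
    if bs: "bs \<in> basis_words s" and x: "norm x = 1" for bs and x :: 'a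
  proof -
    have len: "length bs = s" "length bs \<le> k" using bs s by (auto simp: basis_words_def)
    obtain G where G: "\<And>w. ?T x w bs = G (x \<bullet> w)"
      and G0: "\<And>w. x \<bullet> w \<noteq> 0 \<Longrightarrow> G (x \<bullet> w) = ?c * relu_pow ?m (x \<bullet> w) * monomial bs x"
      using deriv_tensor_ridge[OF len(2), of x] unfolding len(1) by blast
    have "G z = ?c * relu_pow ?m z * monomial bs x" if "z \<noteq> 0" for z
    proof -
      have "x \<noteq> 0" "x \<bullet> x = 1" using x by (auto simp: norm_eq_1)
      then show ?thesis using G0[of "z *\<^sub>R x"] that by simp
    qed
    moreover have "(\<lambda>z. ?c * relu_pow ?m z * monomial bs x) \<in> borel_measurable borel" by measurable
    ultimately have "G \<in> borel_measurable borel" by (rule borel_measurable_eq_except_0[rotated])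
    then show ?thesis using G G0 by auto
  qed
  have meas: "(\<lambda>w. ?T x w bs) \<in> borel_measurable sphere_measure"
    if bs: "bs \<in> basis_words s" and x: "norm x = 1" for bs and x :: 'a
  proof -
    from repr[OF that] obtain G where G: "G \<in> borel_measurable borel" "\<forall>w. ?T x w bs = G (x \<bullet> w)"
      by (elim exE conjE)
    have "(\<lambda>w. ?T x w bs) = (\<lambda>w. G (x \<bullet> w))" using G(2) by (intro ext) (rule spec)
    moreover have "(\<lambda>w. G (x \<bullet> w)) \<in> borel_measurable borel" using G(1) by measurable
    ultimately show ?thesis by (simp only: measurable_sphere_measure)
  qed
  have val: "?T x w bs = ?c * relu_pow ?m (x \<bullet> w) * monomial bs x"
    if "bs \<in> basis_words s" "norm x = 1" "x \<bullet> w \<noteq> 0" for bs w and x :: 'a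
  proof -
    from repr[OF that(1,2)]
    have "\<forall>w. x \<bullet> w \<noteq> 0 \<longrightarrow> ?T x w bs = ?c * relu_pow ?m (x \<bullet> w) * monomial bs x"
      by (elim exE conjE)
    from this[rule_format, OF that(3)] show ?thesis .
  qed
  have "(LINT w|sphere_measure. tensor_inner s (?T x w) (?T y w))
      = (LINT w|sphere_measure. ?c\<^sup>2 * ((x \<bullet> y) ^ s * (relu_pow ?m (x \<bullet> w) * relu_pow ?m (y \<bullet> w))))"
  proof (rule integral_cong_AE)
    show "(\<lambda>w. tensor_inner s (?T x w) (?T y w)) \<in> borel_measurable sphere_measure"
      unfolding tensor_inner_def basis_words_def[symmetric]
      by (rule borel_measurable_sum, rule borel_measurable_times) (rule meas, assumption, rule x y)+
    show "(\<lambda>w. ?c\<^sup>2 * ((x \<bullet> y) ^ s * (relu_pow ?m (x \<bullet> w) * relu_pow ?m (y \<bullet> w)))) \<in> borel_measurable sphere_measure"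
      by (rule measurable_sphere_measure) measurable
    have "x \<noteq> 0" "y \<noteq> 0" using x y by auto
    from AE_sphere_measure_hyperplane[OF this(1)] AE_sphere_measure_hyperplane[OF this(2)]
    show "AE w in sphere_measure. tensor_inner s (?T x w) (?T y w)
        = ?c\<^sup>2 * ((x \<bullet> y) ^ s * (relu_pow ?m (x \<bullet> w) * relu_pow ?m (y \<bullet> w)))"
    proof eventually_elim
      case (elim w)
      have "tensor_inner s (?T x w) (?T y w)
          = (\<Sum>bs\<in>basis_words s. (?c * relu_pow ?m (x \<bullet> w) * monomial bs x) * (?c * relu_pow ?m (y \<bullet> w) * monomial bs y))"
        unfolding tensor_inner_def basis_words_def[symmetric]
      proof (rule sum.cong[OF refl])
        fix bs :: "'a list" assume bs: "bs \<in> basis_words s"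
        show "?T x w bs * ?T y w bs = (?c * relu_pow ?m (x \<bullet> w) * monomial bs x) * (?c * relu_pow ?m (y \<bullet> w) * monomial bs y)"
          by (simp only: val[OF bs x elim(1)] val[OF bs y elim(2)])
      qed
      also have "\<dots> = (\<Sum>bs\<in>basis_words s. (?c\<^sup>2 * (relu_pow ?m (x \<bullet> w) * relu_pow ?m (y \<bullet> w))) * (monomial bs x * monomial bs y))"
        by (intro sum.cong refl) (simp add: power2_eq_square)
      also have "\<dots> = ?c\<^sup>2 * (relu_pow ?m (x \<bullet> w) * relu_pow ?m (y \<bullet> w)) * (x \<bullet> y) ^ s"
        by (simp only: sum_distrib_left[symmetric] power_inner_eq_sum_monomial)
      finally show ?case by simp
    qed
  qed
  also have "\<dots> = ?c\<^sup>2 * ((x \<bullet> y) ^ s * ridge_kernel ?m x y)"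
    by (simp add: ridge_kernel_def)
  finally show ?thesis .
qed

section \<open>Packing and covering on the sphere\<close>

lemma fmeasurable_lborel_balls:
  fixes c :: "'a::euclidean_space"
  shows "ball c r \<in> fmeasurable lborel" "cball c r \<in> fmeasurable lborel"
  using emeasure_lborel_ball_finite[of c r] emeasure_lborel_cball_finite[of c r]
  by (auto intro!: fmeasurableI)

text \<open>Balls of radius \<open>x = e / 2\<close> around the points, together with the concentric
  ball of radius \<open>1 - x\<close>, are disjoint inside the ball of radius \<open>1 + x\<close>.
  The added central ball leaves only an annulus of volume of order \<open>e\<close>; cancelling one
  factor \<open>e\<close> gives the exponent \<open>d\<close> instead of
  \<open>d + 1\<close>.\<close>

lemma sphere_packing_card:
  fixes \<theta> :: "nat \<Rightarrow> 'a::euclidean_space"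
  assumes D: "DIM('a) = d + 1" and \<theta>: "\<And>j. j < n \<Longrightarrow> norm (\<theta> j) = 1"
    and sep: "\<And>i j. i < n \<Longrightarrow> j < n \<Longrightarrow> i \<noteq> j \<Longrightarrow> e \<le> dist (\<theta> i) (\<theta> j)"
    and e: "0 < e" "e \<le> 2"
  shows "real n * e ^ d \<le> (d + 1) * 4 ^ (d + 1)"
proof -
  define x where "x = e / 2"
  have x: "0 < x" "x \<le> 1" using e by (simp_all add: x_def)
  define V where "V = unit_ball_vol (real (d + 1))"
  have V: "V > 0" by (simp add: V_def)
  have vol: "measure lborel (ball c r) = V * r ^ (d + 1)" if "r \<ge> 0" for c :: 'a and r
    using content_ball[OF that, of c] D by (simp add: V_def)
  \<comment> \<open>The index \<open>n\<close> stands for the central ball.\<close>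
  define U where "U j = (if j < n then ball (\<theta> j) x else ball 0 (1 - x))" for j
  have disj: "disjoint_family_on U {..n}"
  proof (unfold disjoint_family_on_def, intro ballI impI)
    have far: "ball (\<theta> i) x \<inter> ball (\<theta> j) x = {}" if "i < n" "j < n" "i \<noteq> j" for i j
      using sep[OF that] by (intro disjoint_ballI) (simp add: x_def)
    have centre: "ball (\<theta> i) x \<inter> ball 0 (1 - x) = {}" if "i < n" for i
      using \<theta>[OF that] by (intro disjoint_ballI) simp
    fix i j assume ij: "i \<in> {..n}" "j \<in> {..n}" "i \<noteq> j"
    then consider "i < n" "j < n" | "i < n" "j = n" | "i = n" "j < n" by fastforce
    then show "U i \<inter> U j = {}"
      using ij far[of i j] centre[of i] centre[of j] by cases (auto simp: U_def)
  qed
  have "measure lborel (\<Union>j\<in>{..n}. U j) = (\<Sum>j\<in>{..n}. measure lborel (U j))"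
  proof (rule measure_finite_Union[OF _ _ disj])
    show "emeasure lborel (U i) \<noteq> \<infinity>" for i
      using emeasure_lborel_ball_finite[of "\<theta> i" x] emeasure_lborel_ball_finite[of "0 :: 'a" "1 - x"]
      by (simp add: U_def less_top)
  qed (auto simp: U_def)
  also have "\<dots> = real n * (V * x ^ (d + 1)) + V * (1 - x) ^ (d + 1)"
    using x by (simp add: U_def vol flip: lessThan_Suc_atMost)
  finally have eq: "measure lborel (\<Union>j\<in>{..n}. U j) = \<dots>" .
  have "(\<Union>j\<in>{..n}. U j) \<subseteq> ball 0 (1 + x)"
  proof
    fix y assume "y \<in> (\<Union>j\<in>{..n}. U j)"
    then obtain j where "y \<in> U j" by blast
    then show "y \<in> ball 0 (1 + x)"
      using \<theta>[of j] x norm_triangle_sub[of y "\<theta> j"]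
      by (auto simp: U_def dist_norm norm_minus_commute split: if_splits)
  qed
  then have "measure lborel (\<Union>j\<in>{..n}. U j) \<le> measure lborel (ball (0::'a) (1 + x))"
    by (intro measure_mono_fmeasurable fmeasurable_lborel_balls sets.finite_UN) (auto simp: U_def)
  also have "\<dots> = V * (1 + x) ^ (d + 1)" using x by (simp add: vol)
  finally have "V * (real n * x ^ (d + 1)) \<le> V * ((1 + x) ^ (d + 1) - (1 - x) ^ (d + 1))"
    unfolding eq by (simp add: algebra_simps)
  then have "real n * x ^ (d + 1) \<le> (1 + x) ^ (d + 1) - (1 - x) ^ (d + 1)"
    using V by simp
  \<comment> \<open>Factoring the difference of powers exposes the thickness
    \<open>2 * x = e\<close> of the annulus.\<close>
  also have "\<dots> = ((1 + x) - (1 - x)) * (\<Sum>i<Suc d. (1 + x) ^ i * (1 - x) ^ (d - i))"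
    unfolding Suc_eq_plus1[symmetric] by (rule diff_power_eq_sum)
  also have "\<dots> \<le> ((1 + x) - (1 - x)) * (\<Sum>i<Suc d. 2 ^ d)"
  proof (intro mult_left_mono sum_mono)
    fix i assume "i \<in> {..<Suc d}"
    then have "(1 + x) ^ i \<le> 2 ^ i" "(2::real) ^ i \<le> 2 ^ d" "(1 - x) ^ (d - i) \<le> 1" "0 \<le> (1 - x) ^ (d - i)"
      using x by (auto intro!: power_mono power_le_one power_increasing)
    then have "(1 + x) ^ i * (1 - x) ^ (d - i) \<le> 2 ^ d * 1"
      by (intro mult_mono[OF order_trans]) auto
    then show "(1 + x) ^ i * (1 - x) ^ (d - i) \<le> 2 ^ d" by simp
  qed (use x in simp)
  also have "\<dots> = e * ((d + 1) * 2 ^ d)" by (simp add: x_def algebra_simps)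
  finally have "e * (real n * e ^ d) \<le> e * ((d + 1) * 2 ^ d * 2 ^ (d + 1))"
    by (simp add: x_def power_divide field_simps)
  then have "real n * e ^ d \<le> (d + 1) * 2 ^ d * 2 ^ (d + 1)"
    using e by simp
  also have "\<dots> \<le> real (d + 1) * (2 ^ (d + 1) * 2 ^ (d + 1))"
  proof -
    have "real (d + 1) * (2 ^ d * 2 ^ (d + 1)) \<le> real (d + 1) * (2 ^ (d + 1) * 2 ^ (d + 1))"
      by (intro mult_left_mono mult_right_mono power_increasing) auto
    then show ?thesis by (simp only: of_nat_mult of_nat_power of_nat_numeral mult.assoc)
  qed
  also have "(2::real) ^ (d + 1) * 2 ^ (d + 1) = 4 ^ (d + 1)"
    by (simp only: flip: power_mult_distrib) simp
  finally show ?thesis by (simp add: algebra_simps)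
qed

text \<open>Radial projection moves a point of the annulus by less than \<open>r\<close>, so balls
  of radius \<open>2 * r\<close> around the points cover the annulus. Its volume is at least a
  multiple of \<open>r\<close>, and this factor cancels one power of \<open>r\<close>.\<close>

lemma sphere_covering_card:
  fixes \<theta> :: "nat \<Rightarrow> 'a::euclidean_space"
  assumes D: "DIM('a) = d + 1"
    and cover: "\<And>x. norm x = 1 \<Longrightarrow> \<exists>j<n. dist x (\<theta> j) \<le> r"
    and r: "0 < r" "r \<le> 1"
  shows "1 \<le> real n * 2 ^ (d + 1) * r ^ d"
proof -
  define V where "V = unit_ball_vol (real (d + 1))"
  have V: "V > 0" by (simp add: V_def)
  have vol: "measure lborel (ball c s) = V * s ^ (d + 1)" if "s \<ge> 0" for c :: 'a and s
    using content_ball[OF that, of c] D by (simp add: V_def)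
  have volc: "measure lborel (cball c s) = V * s ^ (d + 1)" if "s \<ge> 0" for c :: 'a and s
    using content_cball[OF that, of c] D by (simp add: V_def)
  have sub: "ball (0::'a) (1 + r) \<subseteq> cball 0 (1 - r) \<union> (\<Union>j<n. ball (\<theta> j) (2 * r))"
  proof
    fix x :: 'a assume x: "x \<in> ball 0 (1 + r)"
    show "x \<in> cball 0 (1 - r) \<union> (\<Union>j<n. ball (\<theta> j) (2 * r))"
    proof (cases "norm x \<le> 1 - r")
      case False
      then have nx: "norm x > 0" "\<bar>norm x - 1\<bar> < r" using x r by auto
      then have "norm (sgn x) = 1" by (simp add: norm_sgn)
      then obtain j where j: "j < n" "dist (sgn x) (\<theta> j) \<le> r" using cover by blast
      have "x - sgn x = (norm x - 1) *\<^sub>R sgn x"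
        using nx by (simp add: sgn_div_norm algebra_simps)
      then have "dist x (sgn x) < r" using nx by (simp add: dist_norm norm_sgn)
      then have "dist x (\<theta> j) < 2 * r" using j(2) dist_triangle[of x "\<theta> j" "sgn x"] by linarith
      then show ?thesis using j(1) by (auto simp: dist_commute)
    qed simp
  qed
  have "V * (1 + r) ^ (d + 1) = measure lborel (ball (0::'a) (1 + r))"
    using r by (simp add: vol)
  also have "\<dots> \<le> measure lborel (cball (0::'a) (1 - r) \<union> (\<Union>j<n. ball (\<theta> j) (2 * r)))"
  proof (intro measure_mono_fmeasurable fmeasurable.Un fmeasurable.finite_UN)
  qed (use sub fmeasurable_lborel_balls in auto)
  also have "\<dots> \<le> measure lborel (cball (0::'a) (1 - r)) + measure lborel (\<Union>j<n. ball (\<theta> j) (2 * r))"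
    by (intro measure_Un_le) auto
  also have "measure lborel (\<Union>j<n. ball (\<theta> j) (2 * r)) \<le> (\<Sum>j<n. measure lborel (ball (\<theta> j) (2 * r)))"
    by (intro measure_UNION_le) auto
  also have "\<dots> = real n * (V * (2 * r) ^ (d + 1))" using r by (simp add: vol)
  also have "measure lborel (cball (0::'a) (1 - r)) = V * (1 - r) ^ (d + 1)" using r by (simp add: volc)
  finally have "V * (1 + r) ^ (d + 1) \<le> V * ((1 - r) ^ (d + 1) + real n * (2 * r) ^ (d + 1))"
    by (simp add: algebra_simps)
  then have "(1 + r) ^ (d + 1) \<le> (1 - r) ^ (d + 1) + real n * (2 * r) ^ (d + 1)"
    using V by simp
  moreover have "1 + r \<le> (1 + r) ^ (d + 1)"
    using r by (intro self_le_power) auto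
  moreover have "(1 - r) ^ (d + 1) \<le> 1" using r by (intro power_le_one) auto
  ultimately have "r * 1 \<le> r * (real n * 2 ^ (d + 1) * r ^ d)"
    by (simp add: power_mult_distrib mult_ac)
  then show ?thesis using r by simp
qed

text \<open>The chord is \<open>2 * sin (g / 2)\<close>. With \<open>u = g / 2 \<le> 2\<close>, from
  \<open>pi < 4\<close>, the cubic Taylor bound gives
  \<open>sin u \<ge> u - u ^ 3 / 6 \<ge> u / 3\<close>, whence the constant 3.\<close>

lemma geodesic_dist_bounds:
  fixes x y :: "'a::euclidean_space"
  assumes "norm x = 1" "norm y = 1"
  shows "0 \<le> geodesic_dist x y" "geodesic_dist x y \<le> pi"
    and "cos (geodesic_dist x y) = x \<bullet> y"
    and "dist x y \<le> geodesic_dist x y" and "geodesic_dist x y \<le> 3 * dist x y"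
proof -
  define g where "g = geodesic_dist x y"
  have xy: "-1 \<le> x \<bullet> y" "x \<bullet> y \<le> 1"
    using Cauchy_Schwarz_ineq2[of x y] assms by auto
  show g: "0 \<le> geodesic_dist x y" "geodesic_dist x y \<le> pi"
    and cg: "cos (geodesic_dist x y) = x \<bullet> y"
    using xy by (simp_all add: geodesic_dist_def arccos_lbound arccos_ubound)
  have "(dist x y)\<^sup>2 = 2 - 2 * (x \<bullet> y)"
    using assms by (simp add: dist_norm power2_norm_eq_inner inner_diff inner_commute norm_eq_1)
  also have "\<dots> = (2 * sin (g / 2))\<^sup>2"
    using cos_double_sin[of "g / 2"] cg by (simp add: g_def power_mult_distrib)
  finally have d: "dist x y = 2 * sin (g / 2)"
    using g by (subst (asm) power2_eq_iff_nonneg) (auto simp: g_def intro!: sin_ge_zero)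
  show "dist x y \<le> geodesic_dist x y"
    using sin_x_le_x[of "g / 2"] g unfolding d by (simp add: g_def)
  have "\<bar>sin (g / 2) - g / 2\<bar> \<le> \<bar>g / 2\<bar> ^ 3 / 6"
    using Maclaurin_sin_bound[of "g / 2" 3]
    by (simp add: sin_coeff_def numeral_eq_Suc lessThan_Suc fact_numeral)
  moreover have "\<bar>g / 2\<bar> ^ 3 / 6 \<le> 4 * (g / 2) / 6"
  proof -
    have "(g / 2)\<^sup>2 \<le> 2\<^sup>2" using g pi_less_4 by (intro power_mono) (auto simp: g_def)
    then have "(g / 2)\<^sup>2 * (g / 2) \<le> 4 * (g / 2)"
      using g by (intro mult_right_mono) (auto simp: g_def)
    then show ?thesis using g by (simp add: g_def power2_eq_square power3_eq_cube)
  qed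
  ultimately show "geodesic_dist x y \<le> 3 * dist x y"
    unfolding d g_def[symmetric] by linarith
qed

context
  fixes \<theta> :: "nat \<Rightarrow> 'a::euclidean_space" and n :: nat
  assumes \<theta>: "\<And>j. j < n \<Longrightarrow> norm (\<theta> j) = 1" and n: "n \<ge> 2"
begin

lemma mesh_size_cover:
  assumes x: "norm x = 1"
  shows "\<exists>j<n. geodesic_dist x (\<theta> j) \<le> mesh_size n \<theta>"
proof -
  have bdd: "bdd_above ((\<lambda>x. MIN j\<in>{..<n}. geodesic_dist x (\<theta> j)) ` sphere 0 1)"
  proof (rule bdd_aboveI2[where M=pi])
    fix x :: 'a assume x: "x \<in> sphere 0 1"
    have "(MIN j\<in>{..<n}. geodesic_dist x (\<theta> j)) \<le> geodesic_dist x (\<theta> 0)"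
      using n by (intro Min_le) auto
    also have "\<dots> \<le> pi" using x \<theta>[of 0] n by (intro geodesic_dist_bounds) auto
    finally show "(MIN j\<in>{..<n}. geodesic_dist x (\<theta> j)) \<le> pi" .
  qed
  have "(MIN j\<in>{..<n}. geodesic_dist x (\<theta> j)) \<in> (\<lambda>j. geodesic_dist x (\<theta> j)) ` {..<n}"
    using n by (intro Min_in) (auto simp: lessThan_empty_iff)
  moreover have "(MIN j\<in>{..<n}. geodesic_dist x (\<theta> j)) \<le> mesh_size n \<theta>"
    unfolding mesh_size_def using x by (intro cSUP_upper bdd) auto
  ultimately show ?thesis by auto
qed

lemma antipodal_sep_bounds:
  shows "0 \<le> antipodal_sep n \<theta>" "antipodal_sep n \<theta> \<le> 4"
    and "i < n \<Longrightarrow> j < n \<Longrightarrow> i \<noteq> j \<Longrightarrow> antipodal_sep n \<theta> / 3 \<le> dist (\<theta> i) (\<theta> j)"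
    and "i < n \<Longrightarrow> j < n \<Longrightarrow> i \<noteq> j \<Longrightarrow> antipodal_sep n \<theta> / 3 \<le> dist (- \<theta> i) (\<theta> j)"
proof -
  let ?P = "{(i, j). i < n \<and> j < n \<and> i \<noteq> j}"
  let ?f = "\<lambda>(i, j). geodesic_dist (\<theta> i) (\<theta> j)" and ?g = "\<lambda>(i, j). geodesic_dist (- \<theta> i) (\<theta> j)"
  have fin: "finite ?P" by (rule finite_subset[of _ "{..<n} \<times> {..<n}"]) auto
  have ne: "(0, 1) \<in> ?P" using n by auto
  have a: "antipodal_sep n \<theta> = min (Min (?f ` ?P)) (Min (?g ` ?P))"
    by (simp add: antipodal_sep_def)
  have "Min (?f ` ?P) \<in> ?f ` ?P" "Min (?g ` ?P) \<in> ?g ` ?P"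
    using fin ne by (intro Min_in; blast)+
  then show "0 \<le> antipodal_sep n \<theta>"
    unfolding a min_def using \<theta>
    by (auto intro!: geodesic_dist_bounds(1))
  have le: "antipodal_sep n \<theta> \<le> geodesic_dist (\<theta> i) (\<theta> j)" "antipodal_sep n \<theta> \<le> geodesic_dist (- \<theta> i) (\<theta> j)"
    if "i < n" "j < n" "i \<noteq> j" for i j
  proof -
    have "?f (i, j) \<in> ?f ` ?P" "?g (i, j) \<in> ?g ` ?P"
      by (rule imageI, use that in simp)+
    then have "Min (?f ` ?P) \<le> ?f (i, j)" "Min (?g ` ?P) \<le> ?g (i, j)"
      using fin by (auto intro!: Min_le)
    then show "antipodal_sep n \<theta> \<le> geodesic_dist (\<theta> i) (\<theta> j)" "antipodal_sep n \<theta> \<le> geodesic_dist (- \<theta> i) (\<theta> j)"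
      unfolding a by auto
  qed
  show "antipodal_sep n \<theta> \<le> 4"
  proof -
    have "antipodal_sep n \<theta> \<le> geodesic_dist (\<theta> 0) (\<theta> 1)" using le(1)[of 0 1] n by simp
    also have "\<dots> \<le> pi" using \<theta> n by (intro geodesic_dist_bounds(2)) auto
    finally show ?thesis using pi_less_4 by linarith
  qed
  show "antipodal_sep n \<theta> / 3 \<le> dist (\<theta> i) (\<theta> j)" "antipodal_sep n \<theta> / 3 \<le> dist (- \<theta> i) (\<theta> j)"
    if ij: "i < n" "j < n" "i \<noteq> j"
  proof -
    have "geodesic_dist (\<theta> i) (\<theta> j) \<le> 3 * dist (\<theta> i) (\<theta> j)"
      "geodesic_dist (- \<theta> i) (\<theta> j) \<le> 3 * dist (- \<theta> i) (\<theta> j)"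
      using \<theta> ij by (simp_all add: geodesic_dist_bounds(5))
    then show "antipodal_sep n \<theta> / 3 \<le> dist (\<theta> i) (\<theta> j)" "antipodal_sep n \<theta> / 3 \<le> dist (- \<theta> i) (\<theta> j)"
      using le[OF ij] by linarith+
  qed
qed

lemma card_ge_mesh_size:
  assumes D: "DIM('a) = d + 1" and d: "d \<ge> 1"
  shows "0 < mesh_size n \<theta>" and "1 / mesh_size n \<theta> ^ d \<le> real n * 2 ^ (d + 1)"
proof -
  let ?h = "mesh_size n \<theta>"
  have cov: "1 \<le> real n * 2 ^ (d + 1) * r ^ d" if "0 < r" "r \<le> 1" "?h \<le> r" for r
  proof (rule sphere_covering_card[OF D _ that(1,2)])
    fix x :: 'a assume x: "norm x = 1"
    then obtain j where "j < n" "geodesic_dist x (\<theta> j) \<le> ?h" using mesh_size_cover by blast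
    then show "\<exists>j<n. dist x (\<theta> j) \<le> r"
      using geodesic_dist_bounds(4)[OF x \<theta>] that(3) by fastforce
  qed
  show h: "0 < ?h"
  proof (rule ccontr)
    assume "\<not> 0 < ?h"
    \<comment> \<open>If the mesh size were 0, the points would cover at every radius; at this one
      the covering estimate reads \<open>1 \<le> X / (X + 1)\<close> with
      \<open>X = n * 2 ^ (d + 1)\<close>.\<close>
    define r where "r = 1 / (real n * 2 ^ (d + 1) + 1)"
    have "real n * 2 ^ (d + 1) \<ge> 0" by simp
    then have "real n * 2 ^ (d + 1) + 1 > 0" by linarith
    then have r: "0 < r" "r \<le> 1"
      using \<open>real n * 2 ^ (d + 1) \<ge> 0\<close> unfolding r_def by (simp_all only: divide_le_eq_1_pos zero_less_divide_iff) auto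
    have "1 \<le> real n * 2 ^ (d + 1) * r ^ d"
      using \<open>\<not> 0 < ?h\<close> r by (intro cov) auto
    also have "\<dots> \<le> real n * 2 ^ (d + 1) * r ^ 1"
      using r d by (intro mult_left_mono power_decreasing) auto
    also have "\<dots> < 1"
    proof -
      have "real n * 2 ^ (d + 1) + 1 > 0" by (simp add: add_nonneg_pos)
      then show ?thesis by (simp add: r_def divide_simps)
    qed
    finally show False by simp
  qed
  show "1 / ?h ^ d \<le> real n * 2 ^ (d + 1)"
  proof (cases "?h \<le> 1")
    case True
    then show ?thesis using cov[of ?h] h by (simp add: field_simps)
  next
    case False
    then have "1 / ?h ^ d \<le> 1" by (simp add: one_le_power)
    moreover have "1 * 1 \<le> real n * 2 ^ (d + 1)"
      using n by (intro mult_mono one_le_power) auto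
    ultimately show ?thesis by linarith
  qed
qed

text \<open>The 12 is the 4 of the packing estimate times the 3 lost between geodesic and chordal
  distance.\<close>

lemma card_le_antipodal_sep:
  assumes D: "DIM('a) = d + 1" and pos: "0 < antipodal_sep n \<theta>"
  shows "real n * antipodal_sep n \<theta> ^ d \<le> (d + 1) * 12 ^ (d + 1)"
proof -
  let ?h = "antipodal_sep n \<theta>"
  have "real n * (?h / 3) ^ d \<le> (d + 1) * 4 ^ (d + 1)"
    using antipodal_sep_bounds pos by (intro sphere_packing_card[OF D \<theta>]) auto
  then have "real n * ?h ^ d \<le> (d + 1) * 4 ^ (d + 1) * 3 ^ d"
    by (simp add: power_divide field_simps)
  also have "\<dots> \<le> (d + 1) * 4 ^ (d + 1) * 3 ^ (d + 1)"
    by (intro of_nat_mono mult_left_mono power_increasing) auto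
  also have "(d + 1) * 4 ^ (d + 1) * 3 ^ (d + 1) = (d + 1) * 12 ^ (d + 1)"
    by (simp only: mult.assoc flip: power_mult_distrib) simp
  finally show ?thesis .
qed

end

section \<open>Diagonal dominance of the matrices of high powers\<close>

text \<open>A packing bound in the ambient space. The exponent \<open>DIM('a)\<close> is good enough
  here, since the count will be outweighed by exponential decay.\<close>

lemma card_separated_ball:
  fixes \<eta> :: "nat \<Rightarrow> 'a::euclidean_space"
  assumes e: "0 < e" and fin: "finite S" and R: "R \<ge> 0"
    and sep: "\<And>i j. i \<in> S \<Longrightarrow> j \<in> S \<Longrightarrow> i \<noteq> j \<Longrightarrow> e \<le> dist (\<eta> i) (\<eta> j)"
    and near: "\<And>j. j \<in> S \<Longrightarrow> dist (\<eta> j) c \<le> R"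
  shows "real (card S) * e ^ DIM('a) \<le> (2 * R + e) ^ DIM('a)"
proof -
  define V where "V = unit_ball_vol (real DIM('a))"
  have V: "V > 0" by (simp add: V_def)
  have vol: "measure lborel (ball c r) = V * r ^ DIM('a)" if "r \<ge> 0" for c :: 'a and r
    using content_ball[OF that, of c] by (simp add: V_def)
  have "measure lborel (\<Union>j\<in>S. ball (\<eta> j) (e / 2)) = (\<Sum>j\<in>S. measure lborel (ball (\<eta> j) (e / 2)))"
  proof (rule measure_finite_Union[OF fin])
    show "disjoint_family_on (\<lambda>j. ball (\<eta> j) (e / 2)) S"
      unfolding disjoint_family_on_def using sep by (auto intro!: disjoint_ballI)
    show "emeasure lborel (ball (\<eta> i) (e / 2)) \<noteq> \<infinity>" for i
      using emeasure_lborel_ball_finite[of "\<eta> i" "e / 2"] by (simp add: less_top)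
  qed auto
  also have "\<dots> = real (card S) * (V * (e / 2) ^ DIM('a))"
    using e by (simp add: vol)
  finally have eq: "measure lborel (\<Union>j\<in>S. ball (\<eta> j) (e / 2)) = \<dots>" .
  have "(\<Union>j\<in>S. ball (\<eta> j) (e / 2)) \<subseteq> ball c (R + e / 2)"
  proof
    fix y assume "y \<in> (\<Union>j\<in>S. ball (\<eta> j) (e / 2))"
    then obtain j where "j \<in> S" "dist (\<eta> j) y < e / 2" by auto
    then show "y \<in> ball c (R + e / 2)"
      using near[of j] dist_triangle[of c y "\<eta> j"] by (simp add: dist_commute)
  qed
  then have "measure lborel (\<Union>j\<in>S. ball (\<eta> j) (e / 2)) \<le> measure lborel (ball c (R + e / 2))"
    using fin by (intro measure_mono_fmeasurable fmeasurable_lborel_balls) auto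
  also have "\<dots> = V * (R + e / 2) ^ DIM('a)" using R e by (simp add: vol)
  finally have "V * (real (card S) * (e / 2) ^ DIM('a)) \<le> V * (R + e / 2) ^ DIM('a)"
    unfolding eq by (simp add: mult_ac)
  then have "real (card S) * (e / 2) ^ DIM('a) \<le> (R + e / 2) ^ DIM('a)" using V by simp
  then have "real (card S) * (e / 2) ^ DIM('a) * 2 ^ DIM('a) \<le> (R + e / 2) ^ DIM('a) * 2 ^ DIM('a)"
    by (rule mult_right_mono) simp
  then show ?thesis
    by (simp add: mult.assoc power_mult_distrib[symmetric]) (simp add: algebra_simps)
qed

lemma sum_quarter_powers: "(\<Sum>m\<in>{1..K}. (1/4) ^ m) = (1 - (1/4::real) ^ K) / 3"
proof (induction K)
  case (Suc K)
  have "(\<Sum>m\<in>{1..Suc K}. (1/4) ^ m) = (1 - (1/4::real) ^ K) / 3 + (1/4) ^ Suc K"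
    using Suc by simp
  also have "\<dots> = (1 - (1/4::real) ^ Suc K) / 3"
  proof -
    have "(1 - q) / 3 + 1 / 4 * q = (1 - 1 / 4 * q) / 3" for q :: real
      by (simp add: field_simps)
    then show ?thesis by (simp only: power_Suc)
  qed
  finally show ?case .
qed simp

text \<open>The points are sorted into shells by \<open>m j\<close>, their distance from
  \<open>\<theta> i\<close> in units of \<open>e\<close>. Since
  \<open>1 - z \<le> exp (- z)\<close>, a term in shell \<open>k\<close> is at most
  \<open>exp (- (5 * D + 2) * k)\<close> with \<open>D = DIM('a)\<close>. The shell has at most
  \<open>(5 * k) ^ D \<le> exp (5 * D * k)\<close> points, so its total is at most
  \<open>exp (- 2 * k) \<le> (1/4) ^ k\<close>; the geometric series sums to at most
  \<open>1 / 3\<close>.\<close>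

lemma sum_offdiag_powers_le:
  fixes \<theta> :: "nat \<Rightarrow> 'a::euclidean_space"
  assumes \<theta>: "\<And>j. j < n \<Longrightarrow> norm (\<theta> j) = 1"
    and e: "0 < e"
    and sep: "\<And>i j. i < n \<Longrightarrow> j < n \<Longrightarrow> i \<noteq> j \<Longrightarrow> e \<le> dist (\<theta> i) (\<theta> j)"
    and sep': "\<And>i j. i < n \<Longrightarrow> j < n \<Longrightarrow> i \<noteq> j \<Longrightarrow> e \<le> dist (- \<theta> i) (\<theta> j)"
    and l: "real (5 * DIM('a) + 2) \<le> real l * e\<^sup>2 / 2" and i: "i < n"
  shows "(\<Sum>j\<in>{..<n} - {i}. \<bar>\<theta> i \<bullet> \<theta> j\<bar> ^ l) \<le> 1 / 2"
proof -
  txt \<open>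
    Flipping signs makes all inner products with \<open>\<theta> i\<close> nonnegative and, by the antipodal
    separation, keeps the points separated.
  \<close>
  define \<eta> where "\<eta> j = (if \<theta> i \<bullet> \<theta> j \<ge> 0 then \<theta> j else - \<theta> j)" for j
  have \<eta>1: "norm (\<eta> j) = 1" if "j < n" for j using \<theta>[OF that] by (simp add: \<eta>_def)
  have \<eta>i: "\<eta> i = \<theta> i" by (simp add: \<eta>_def)
  have \<eta>t: "\<theta> i \<bullet> \<eta> j = \<bar>\<theta> i \<bullet> \<theta> j\<bar>" for j by (simp add: \<eta>_def)
  have \<eta>s: "e \<le> dist (\<eta> j) (\<eta> k)" if "j < n" "k < n" "j \<noteq> k" for j k
  proof -
    have "dist x (- y) = dist (- x) y" for x y :: 'a
      by (metis dist_minus minus_minus)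
    then show ?thesis using sep[OF that] sep'[OF that] by (auto simp: \<eta>_def dist_minus)
  qed
  define m where "m j = nat \<lfloor>dist (\<eta> j) (\<theta> i) / e\<rfloor>" for j
  let ?S = "{..<n} - {i}"
  have m1: "1 \<le> m j" if "j \<in> ?S" for j
  proof -
    have "1 \<le> dist (\<eta> j) (\<theta> i) / e" using \<eta>s[of j i] that i e \<eta>i by simp
    then show ?thesis unfolding m_def by linarith
  qed
  have mle: "m j * e \<le> dist (\<eta> j) (\<theta> i)" and mge: "dist (\<eta> j) (\<theta> i) \<le> (real (m j) + 1) * e" for j
  proof -
    have "0 \<le> dist (\<eta> j) (\<theta> i) / e" using e by simp
    then have "real (m j) \<le> dist (\<eta> j) (\<theta> i) / e" "dist (\<eta> j) (\<theta> i) / e \<le> real (m j) + 1"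
      unfolding m_def by linarith+
    then show "m j * e \<le> dist (\<eta> j) (\<theta> i)" "dist (\<eta> j) (\<theta> i) \<le> (real (m j) + 1) * e"
      using e by (simp_all add: field_simps)
  qed
  let ?D = "DIM('a)"
  have decay: "\<bar>\<theta> i \<bullet> \<theta> j\<bar> ^ l \<le> exp (- real (5 * ?D + 2) * m j)" if j: "j \<in> ?S" for j
  proof -
    let ?\<delta> = "dist (\<eta> j) (\<theta> i)"
    have "?\<delta>\<^sup>2 = 2 - 2 * \<bar>\<theta> i \<bullet> \<theta> j\<bar>"
      using \<theta>[OF i] \<eta>1[of j] j unfolding \<eta>t[symmetric]
      by (simp add: dist_norm power2_norm_eq_inner inner_diff inner_commute norm_eq_1)
    then have "\<bar>\<theta> i \<bullet> \<theta> j\<bar> = 1 + (- ?\<delta>\<^sup>2 / 2)" by linarith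
    also have "\<dots> \<le> exp (- ?\<delta>\<^sup>2 / 2)" by (rule exp_ge_add_one_self)
    finally have "\<bar>\<theta> i \<bullet> \<theta> j\<bar> ^ l \<le> exp (- ?\<delta>\<^sup>2 / 2) ^ l" by (intro power_mono) auto
    also have "\<dots> = exp (- (real l * ?\<delta>\<^sup>2 / 2))"
      by (simp only: exp_of_nat_mult[symmetric]) simp
    also have "\<dots> \<le> exp (- real (5 * ?D + 2) * m j)"
    proof -
      have "(m j * e)\<^sup>2 \<le> ?\<delta>\<^sup>2" using mle[of j] e by (intro power_mono) auto
      then have "real l * (m j * e)\<^sup>2 \<le> real l * ?\<delta>\<^sup>2" by (intro mult_left_mono) auto
      moreover have "real (5 * ?D + 2) * real (m j) \<le> real (5 * ?D + 2) * (real (m j))\<^sup>2"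
        using m1[OF j] by (intro mult_left_mono self_le_power) auto
      moreover have "real (5 * ?D + 2) * (real (m j))\<^sup>2 \<le> real l * e\<^sup>2 / 2 * (real (m j))\<^sup>2"
        using l by (intro mult_right_mono) auto
      moreover have "real l * e\<^sup>2 / 2 * (real (m j))\<^sup>2 = real l * (m j * e)\<^sup>2 / 2"
        by (simp add: power_mult_distrib)
      ultimately have "real (5 * ?D + 2) * real (m j) \<le> real l * ?\<delta>\<^sup>2 / 2" by linarith
      then have "- (real l * ?\<delta>\<^sup>2 / 2) \<le> - real (5 * ?D + 2) * m j" by linarith
      then show ?thesis by (simp only: exp_le_cancel_iff)
    qed
    finally show ?thesis .
  qed
  have shell: "(\<Sum>j\<in>{j \<in> ?S. m j = k}. \<bar>\<theta> i \<bullet> \<theta> j\<bar> ^ l) \<le> (1/4) ^ k" if k: "k \<ge> 1" for k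
  proof -
    let ?T = "{j \<in> ?S. m j = k}"
    have "real (card ?T) * e ^ ?D \<le> (2 * ((real k + 1) * e) + e) ^ ?D"
      using e mge \<eta>s by (intro card_separated_ball[where \<eta>=\<eta> and c="\<theta> i"]) auto
    \<comment> \<open>\<open>2 * k + 3 \<le> 5 * k\<close> for \<open>k \<ge> 1\<close>; shell 0 is
      empty by separation.\<close>
    also have "2 * ((real k + 1) * e) + e \<le> (5 * real k) * e"
      using k e by (auto simp: algebra_simps)
    then have "(2 * ((real k + 1) * e) + e) ^ ?D \<le> ((5 * real k) * e) ^ ?D"
      using e by (intro power_mono) auto
    finally have "real (card ?T) \<le> (5 * real k) ^ ?D" using e by (simp add: power_mult_distrib)
    also have "\<dots> \<le> exp (5 * real k) ^ ?D"
    proof (intro power_mono)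
      show "5 * real k \<le> exp (5 * real k)"
        using exp_ge_add_one_self[of "5 * real k"] by linarith
    qed simp
    also have "\<dots> = exp (real (5 * ?D) * k)"
      by (simp only: exp_of_nat_mult[symmetric]) (simp add: mult_ac)
    finally have card: "real (card ?T) \<le> exp (real (5 * ?D) * k)" .
    have "(\<Sum>j\<in>?T. \<bar>\<theta> i \<bullet> \<theta> j\<bar> ^ l) \<le> (\<Sum>j\<in>?T. exp (- real (5 * ?D + 2) * k))"
      using decay by (intro sum_mono) auto
    also have "\<dots> = real (card ?T) * exp (- real (5 * ?D + 2) * k)" by simp
    also have "\<dots> \<le> exp (real (5 * ?D) * k) * exp (- real (5 * ?D + 2) * k)"
      by (intro mult_right_mono card) auto
    also have "\<dots> = exp (- 2) ^ k"
      by (simp only: exp_add[symmetric] exp_of_nat_mult[symmetric]) (simp add: algebra_simps)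
    also have "\<dots> \<le> (1/4) ^ k"
    proof (intro power_mono)
      have "2 \<le> exp (1::real)" using exp_ge_add_one_self[of 1] by simp
      then have "2 * 2 \<le> exp (1::real) * exp 1" by (intro mult_mono) auto
      then have "4 \<le> exp (2::real)" by (simp only: exp_add[symmetric]) simp
      then show "exp (- 2) \<le> (1 / 4 :: real)" by (simp add: exp_minus field_simps)
    qed auto
    finally show ?thesis .
  qed
  have "(\<Sum>j\<in>?S. \<bar>\<theta> i \<bullet> \<theta> j\<bar> ^ l) = (\<Sum>k\<in>m ` ?S. \<Sum>j\<in>{j \<in> ?S. m j = k}. \<bar>\<theta> i \<bullet> \<theta> j\<bar> ^ l)"
    by (rule sum.image_gen) simp
  also have "\<dots> \<le> (\<Sum>k\<in>m ` ?S. (1/4) ^ k)"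
    using m1 by (intro sum_mono shell) auto
  also have "\<dots> \<le> (\<Sum>k\<in>{1..Max (m ` ?S)}. (1/4) ^ k)"
  proof (intro sum_mono2)
    show "m ` ?S \<subseteq> {1..Max (m ` ?S)}"
    proof
      fix k assume "k \<in> m ` ?S"
      then show "k \<in> {1..Max (m ` ?S)}" using m1 by (auto simp del: One_nat_def intro!: Max_ge)
    qed
  qed auto
  also have "\<dots> \<le> 1 / 2"
  proof -
    have "(1 - q) / 3 \<le> 1 / 2" if "q \<ge> 0" for q :: real using that by simp
    moreover have "(1/4::real) ^ Max (m ` ?S) \<ge> 0" by (rule zero_le_power) simp
    ultimately show ?thesis unfolding sum_quarter_powers by blast
  qed
  finally show ?thesis .
qed

text \<open>Gershgorin's argument for the quadratic form: the diagonal is 1, and the off-diagonal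
  absolute row sums are at most \<open>1 / 2\<close>. The mixed products are split by
  \<open>\<bar>x * y\<bar> \<le> (x^2 + y^2) / 2\<close>.\<close>

lemma power_form_ge:
  fixes \<theta> :: "nat \<Rightarrow> 'a::euclidean_space"
  assumes \<theta>: "\<And>j. j < n \<Longrightarrow> norm (\<theta> j) = 1"
    and e: "0 < e"
    and sep: "\<And>i j. i < n \<Longrightarrow> j < n \<Longrightarrow> i \<noteq> j \<Longrightarrow> e \<le> dist (\<theta> i) (\<theta> j)"
    and sep': "\<And>i j. i < n \<Longrightarrow> j < n \<Longrightarrow> i \<noteq> j \<Longrightarrow> e \<le> dist (- \<theta> i) (\<theta> j)"
    and l: "real (5 * DIM('a) + 2) \<le> real l * e\<^sup>2 / 2"
  shows "(\<Sum>i<n. (a i)\<^sup>2) / 2 \<le> (\<Sum>i<n. \<Sum>j<n. a i * a j * (\<theta> i \<bullet> \<theta> j) ^ l)"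
proof -
  let ?t = "\<lambda>i j. \<bar>\<theta> i \<bullet> \<theta> j\<bar> ^ l"
  have off: "(\<Sum>j\<in>{..<n} - {i}. ?t i j) \<le> 1 / 2" if "i < n" for i
    using sum_offdiag_powers_le[OF \<theta> e sep sep' l that] by simp
  \<comment> \<open>Symmetry of the matrix turns column sums into row sums, so one row bound covers
    both squares.\<close>
  have *: "(\<Sum>i<n. \<Sum>j\<in>{..<n} - {i}. (a j)\<^sup>2 * ?t i j) = (\<Sum>i<n. \<Sum>j\<in>{..<n} - {i}. (a i)\<^sup>2 * ?t i j)"
  proof -
    have "(\<Sum>i<n. \<Sum>j\<in>{..<n} - {i}. (a j)\<^sup>2 * ?t i j)
        = (\<Sum>i<n. \<Sum>j<n. if i \<noteq> j then (a j)\<^sup>2 * ?t i j else 0)"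
      by (intro sum.cong refl sum.mono_neutral_cong_left) auto
    also have "\<dots> = (\<Sum>j<n. \<Sum>i<n. if i \<noteq> j then (a j)\<^sup>2 * ?t i j else 0)" by (rule sum.swap)
    also have "\<dots> = (\<Sum>i<n. \<Sum>j\<in>{..<n} - {i}. (a i)\<^sup>2 * ?t i j)"
      by (intro sum.cong refl sum.mono_neutral_cong_right) (auto simp: inner_commute)
    finally show ?thesis .
  qed
  have "(\<Sum>i<n. \<Sum>j\<in>{..<n} - {i}. (a i)\<^sup>2 * ?t i j) = (\<Sum>i<n. (a i)\<^sup>2 * (\<Sum>j\<in>{..<n} - {i}. ?t i j))"
    by (simp add: sum_distrib_left)
  also have "\<dots> \<le> (\<Sum>i<n. (a i)\<^sup>2 * (1 / 2))"
    using off by (intro sum_mono mult_left_mono) auto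
  finally have half: "(\<Sum>i<n. \<Sum>j\<in>{..<n} - {i}. (a i)\<^sup>2 * ?t i j) \<le> (\<Sum>i<n. (a i)\<^sup>2) / 2"
    by (simp add: sum_divide_distrib)
  have "(\<Sum>i<n. (a i)\<^sup>2) - (\<Sum>i<n. \<Sum>j\<in>{..<n} - {i}. ((a i)\<^sup>2 + (a j)\<^sup>2) / 2 * ?t i j)
      \<le> (\<Sum>i<n. \<Sum>j<n. a i * a j * (\<theta> i \<bullet> \<theta> j) ^ l)"
    unfolding sum_subtractf[symmetric]
  proof (rule sum_mono)
    fix i assume i: "i \<in> {..<n}"
    have "- (\<Sum>j\<in>{..<n} - {i}. ((a i)\<^sup>2 + (a j)\<^sup>2) / 2 * ?t i j)
        \<le> (\<Sum>j\<in>{..<n} - {i}. a i * a j * (\<theta> i \<bullet> \<theta> j) ^ l)"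
      unfolding sum_negf[symmetric]
    proof (rule sum_mono)
      fix j
      have "\<bar>a i * a j\<bar> \<le> ((a i)\<^sup>2 + (a j)\<^sup>2) / 2"
        using sum_squares_bound[of "\<bar>a i\<bar>" "\<bar>a j\<bar>"] by (simp add: abs_mult)
      then have "\<bar>a i * a j\<bar> * ?t i j \<le> ((a i)\<^sup>2 + (a j)\<^sup>2) / 2 * ?t i j"
        by (intro mult_right_mono) auto
      then have "\<bar>a i * a j * (\<theta> i \<bullet> \<theta> j) ^ l\<bar> \<le> ((a i)\<^sup>2 + (a j)\<^sup>2) / 2 * ?t i j"
        by (simp add: abs_mult power_abs)
      then show "- (((a i)\<^sup>2 + (a j)\<^sup>2) / 2 * ?t i j) \<le> a i * a j * (\<theta> i \<bullet> \<theta> j) ^ l"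
        by linarith
    qed
    moreover have "(\<Sum>j<n. a i * a j * (\<theta> i \<bullet> \<theta> j) ^ l)
        = (a i)\<^sup>2 + (\<Sum>j\<in>{..<n} - {i}. a i * a j * (\<theta> i \<bullet> \<theta> j) ^ l)"
      using i \<theta>[of i] by (subst sum.remove[of _ i]) (auto simp: power2_eq_square norm_eq_1)
    ultimately show "(a i)\<^sup>2 - (\<Sum>j\<in>{..<n} - {i}. ((a i)\<^sup>2 + (a j)\<^sup>2) / 2 * ?t i j)
        \<le> (\<Sum>j<n. a i * a j * (\<theta> i \<bullet> \<theta> j) ^ l)" by linarith
  qed
  moreover have "(\<Sum>i<n. \<Sum>j\<in>{..<n} - {i}. ((a i)\<^sup>2 + (a j)\<^sup>2) / 2 * ?t i j)
      = ((\<Sum>i<n. \<Sum>j\<in>{..<n} - {i}. (a i)\<^sup>2 * ?t i j) + (\<Sum>i<n. \<Sum>j\<in>{..<n} - {i}. (a j)\<^sup>2 * ?t i j)) / 2"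
    by (simp add: sum.distrib[symmetric] sum_divide_distrib add_divide_distrib algebra_simps)
  moreover have "A / 2 \<le> Q" if "A - S \<le> Q" "S = (S1 + S2) / 2" "S2 = S1" "S1 \<le> A / 2"
    for A Q S S1 S2 :: real
    using that by (simp add: field_simps)
  ultimately show ?thesis using half * by blast
qed

section \<open>Quadratic forms of tensor ridge kernels\<close>

lemma relu_pow_inner_meas:
  "(\<lambda>w. relu_pow k (x \<bullet> w)) \<in> borel_measurable (sphere_measure :: 'a::euclidean_space measure)"
  by (rule measurable_sphere_measure) measurable

lemma relu_pow_inner_bound:
  fixes x w :: "'a::euclidean_space"
  assumes "norm x = 1" "norm w = 1"
  shows "\<bar>relu_pow k (x \<bullet> w)\<bar> \<le> 1"
  using Cauchy_Schwarz_ineq2[of x w] assms by (simp add: relu_pow_nonneg relu_pow_le_1)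

lemma integrable_sphere_bounded:
  fixes f :: "'a::euclidean_space \<Rightarrow> real"
  assumes "f \<in> borel_measurable sphere_measure" "\<And>w. norm w = 1 \<Longrightarrow> \<bar>f w\<bar> \<le> B"
  shows "integrable sphere_measure f"
proof -
  interpret finite_measure "sphere_measure :: 'a measure" by (rule finite_measure_sphere_measure)
  show ?thesis
    using assms by (intro integrable_const_bound[where B=B]) (auto simp: space_sphere_measure)
qed

lemma measure_space_sphere_measure: "measure sphere_measure (sphere 0 1 :: 'a::euclidean_space set) = 1"
  by (simp add: measure_def emeasure_sphere_measure_sphere)

lemma integral_sphere_const [simp]: "(LINT w|(sphere_measure :: 'a::euclidean_space measure). c) = (c::real)"
  by (simp add: space_sphere_measure measure_space_sphere_measure)

lemma integral_sphere_le:
  fixes f :: "'a::euclidean_space \<Rightarrow> real"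
  assumes "f \<in> borel_measurable sphere_measure" "\<And>w. norm w = 1 \<Longrightarrow> \<bar>f w\<bar> \<le> B"
  shows "(LINT w|sphere_measure. f w) \<le> B"
proof -
  have "(LINT w|sphere_measure. f w) \<le> (LINT w|(sphere_measure :: 'a measure). B)"
  proof (rule integral_mono)
    show "integrable sphere_measure (\<lambda>_::'a. B)"
      by (rule integrable_sphere_bounded[where B="\<bar>B\<bar>"]) auto
    show "f w \<le> B" if "w \<in> space sphere_measure" for w
      using assms(2)[of w] that by (simp add: space_sphere_measure abs_le_iff)
  qed (rule integrable_sphere_bounded[OF assms])
  then show ?thesis by (simp only: integral_sphere_const)
qed

text \<open>The rotation in the plane of \<open>x\<close> and \<open>y\<close> by the angle between
  them carries \<open>x\<close> to \<open>y\<close> and preserves the measure. Bounds that depend on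
  the moment are thereby uniform in the points.\<close>

lemma relu_moment_const:
  fixes x y :: "'a::euclidean_space"
  assumes D: "DIM('a) \<ge> 2" and x: "norm x = 1" and y: "norm y = 1"
  shows "(LINT w|sphere_measure. relu_pow k (x \<bullet> w)) = (LINT w|sphere_measure. relu_pow k (y \<bullet> w))"
proof -
  obtain v where v: "norm v = 1" "x \<bullet> v = 0"
    "y = cos (arccos (x \<bullet> y)) *\<^sub>R x + sin (arccos (x \<bullet> y)) *\<^sub>R v"
    using unit_vector_decomposition[OF D x y] by metis
  let ?f = "plane_rotation x v (arccos (x \<bullet> y))"
  have f: "orthogonal_transformation ?f" by (rule orthogonal_plane_rotation[OF x v(1,2)])
  have "?f x = y"
    using x v(2) by (subst v(3)) (simp add: plane_rotation_def norm_eq_1 inner_commute algebra_simps)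
  then have "y \<bullet> ?f w = x \<bullet> w" for w
    using f unfolding orthogonal_transformation_def by metis
  then show ?thesis
    using integral_sphere_measure_orthogonal[OF f, of "\<lambda>w. relu_pow k (y \<bullet> w)"] by simp
qed

text \<open>If the moment vanished it would vanish for \<open>- x\<close> as well, forcing
  \<open>x \<bullet> w = 0\<close> almost everywhere, although this set is null.\<close>

lemma relu_moment_pos:
  fixes x :: "'a::euclidean_space"
  assumes D: "DIM('a) \<ge> 2" and x: "norm x = 1"
  shows "0 < (LINT w|sphere_measure. relu_pow k (x \<bullet> w))"
proof (rule ccontr)
  assume neg: "\<not> ?thesis"
  have int: "integrable sphere_measure (\<lambda>w. relu_pow k (y \<bullet> w))" if "norm y = 1" for y :: 'a
    by (rule integrable_sphere_bounded[OF relu_pow_inner_meas relu_pow_inner_bound[OF that]])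
  have z: "AE w in sphere_measure. relu_pow k (y \<bullet> w) = 0" if y: "norm y = 1" for y :: 'a
  proof -
    have "(LINT w|sphere_measure. relu_pow k (y \<bullet> w)) \<le> 0"
      using neg relu_moment_const[OF D x y, of k] by simp
    moreover have "0 \<le> (LINT w|sphere_measure. relu_pow k (y \<bullet> w))"
      by (intro Bochner_Integration.integral_nonneg) (simp add: relu_pow_nonneg)
    ultimately have "(LINT w|sphere_measure. relu_pow k (y \<bullet> w)) = 0" by simp
    then show ?thesis
      using integral_nonneg_eq_0_iff_AE[OF int[OF y]] relu_pow_nonneg by auto
  qed
  have mx: "norm (- x) = 1" "x \<noteq> 0" using x by auto
  from z[OF x] z[OF mx(1)] AE_sphere_measure_hyperplane[OF mx(2)]
  have "AE w in (sphere_measure :: 'a measure). False"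
  proof eventually_elim
    case (elim w)
    consider "0 < x \<bullet> w" | "0 < - x \<bullet> w" using elim(3) by fastforce
    then show ?case using elim(1,2) relu_pow_pos[of _ k] by cases force+
  qed
  then have "emeasure (sphere_measure :: 'a measure) (space sphere_measure) = 0"
    unfolding trivial_limit_def[symmetric] by (simp add: ae_filter_eq_bot_iff)
  then show False by (simp add: space_sphere_measure emeasure_sphere_measure_sphere)
qed

lemma ridge_kernel_self: "ridge_kernel k x x = (LINT w|sphere_measure. relu_pow (k + k) (x \<bullet> w))"
  by (simp add: ridge_kernel_def relu_pow_mult_self)

text \<open>Common shape of both matrices: \<open>s = 0\<close>, \<open>m = k\<close> for the mass
  matrix and, up to a constant factor, \<open>m = k - s\<close> for the stiffness matrix.\<close>

definition tensor_kernel :: "nat \<Rightarrow> nat \<Rightarrow> 'a::euclidean_space \<Rightarrow> 'a \<Rightarrow> real" where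
  "tensor_kernel s m x y = (x \<bullet> y) ^ s * ridge_kernel m x y"

lemma tensor_kernel_commute: "tensor_kernel s m x y = tensor_kernel s m y x"
  by (simp add: tensor_kernel_def ridge_kernel_def inner_commute mult.commute)

lemma abs_tensor_kernel_le:
  fixes x y :: "'a::euclidean_space"
  assumes x: "norm x = 1" and y: "norm y = 1"
  shows "\<bar>tensor_kernel s m x y\<bar> \<le> 1"
proof -
  have "\<bar>relu_pow m (x \<bullet> w) * relu_pow m (y \<bullet> w)\<bar> \<le> 1" if "norm w = 1" for w
    using mult_mono[OF relu_pow_inner_bound[OF x that] relu_pow_inner_bound[OF y that], of m m]
    by (simp add: abs_mult)
  then have "ridge_kernel m x y \<le> 1"
    unfolding ridge_kernel_def
    by (intro integral_sphere_le borel_measurable_times relu_pow_inner_meas)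
  moreover have "0 \<le> ridge_kernel m x y"
    unfolding ridge_kernel_def by (intro Bochner_Integration.integral_nonneg) (simp add: relu_pow_nonneg)
  moreover have "\<bar>x \<bullet> y\<bar> ^ s \<le> 1"
    using Cauchy_Schwarz_ineq2[of x y] x y by (intro power_le_one) auto
  ultimately have "\<bar>x \<bullet> y\<bar> ^ s * ridge_kernel m x y \<le> 1 * 1" by (intro mult_mono) auto
  then show ?thesis using \<open>0 \<le> ridge_kernel m x y\<close> by (simp add: tensor_kernel_def abs_mult power_abs)
qed

lemma ridge_kernel_form:
  fixes \<theta> :: "nat \<Rightarrow> 'a::euclidean_space"
  assumes \<theta>: "\<And>j. j < n \<Longrightarrow> norm (\<theta> j) = 1"
  shows "(\<Sum>i<n. \<Sum>j<n. c i * c j * ridge_kernel m (\<theta> i) (\<theta> j))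
    = (LINT w|sphere_measure. (\<Sum>j<n. c j * relu_pow m (\<theta> j \<bullet> w))\<^sup>2)"
proof -
  have int: "integrable sphere_measure (\<lambda>w. c i * c j * (relu_pow m (\<theta> i \<bullet> w) * relu_pow m (\<theta> j \<bullet> w)))"
    if "i < n" "j < n" for i j
  proof (intro integrable_mult_right integrable_sphere_bounded[where B=1])
    show "\<bar>relu_pow m (\<theta> i \<bullet> w) * relu_pow m (\<theta> j \<bullet> w)\<bar> \<le> 1" if w: "norm w = 1" for w
      using mult_mono[OF relu_pow_inner_bound[OF \<theta> w] relu_pow_inner_bound[OF \<theta> w], of i j m m]
        \<open>i < n\<close> \<open>j < n\<close> by (simp add: abs_mult)
  qed (intro borel_measurable_times relu_pow_inner_meas)
  have "(LINT w|sphere_measure. (\<Sum>j<n. c j * relu_pow m (\<theta> j \<bullet> w))\<^sup>2)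
      = (LINT w|sphere_measure. (\<Sum>i<n. \<Sum>j<n. c i * c j * (relu_pow m (\<theta> i \<bullet> w) * relu_pow m (\<theta> j \<bullet> w))))"
    by (simp add: power2_eq_square sum_product mult_ac)
  also have "\<dots> = (\<Sum>i<n. \<Sum>j<n. (LINT w|sphere_measure. c i * c j * (relu_pow m (\<theta> i \<bullet> w) * relu_pow m (\<theta> j \<bullet> w))))"
    using int by (subst Bochner_Integration.integral_sum;
      (intro integrable_sum sum.cong refl Bochner_Integration.integral_sum)?) auto
  also have "\<dots> = (\<Sum>i<n. \<Sum>j<n. c i * c j * ridge_kernel m (\<theta> i) (\<theta> j))"
    by (simp add: ridge_kernel_def)
  finally show ?thesis ..
qed

text \<open>Expanding \<open>(x \<bullet> y) ^ s\<close> over words writes the form as a sum of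
  squared norms of ridge combinations, one for each tensor entry.\<close>

lemma tensor_kernel_form:
  fixes \<theta> :: "nat \<Rightarrow> 'a::euclidean_space"
  assumes \<theta>: "\<And>j. j < n \<Longrightarrow> norm (\<theta> j) = 1"
  shows "(\<Sum>i<n. \<Sum>j<n. a i * a j * tensor_kernel s m (\<theta> i) (\<theta> j))
    = (\<Sum>bs\<in>basis_words s. LINT w|sphere_measure. (\<Sum>j<n. a j * monomial bs (\<theta> j) * relu_pow m (\<theta> j \<bullet> w))\<^sup>2)"
proof -
  have "(\<Sum>i<n. \<Sum>j<n. a i * a j * tensor_kernel s m (\<theta> i) (\<theta> j))
      = (\<Sum>i<n. \<Sum>j<n. \<Sum>bs\<in>basis_words s. (a i * monomial bs (\<theta> i)) * (a j * monomial bs (\<theta> j)) * ridge_kernel m (\<theta> i) (\<theta> j))"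
    unfolding tensor_kernel_def power_inner_eq_sum_monomial
    by (intro sum.cong refl) (simp add: sum_distrib_left sum_distrib_right mult_ac)
  also have "\<dots> = (\<Sum>i<n. \<Sum>bs\<in>basis_words s. \<Sum>j<n. (a i * monomial bs (\<theta> i)) * (a j * monomial bs (\<theta> j)) * ridge_kernel m (\<theta> i) (\<theta> j))"
    by (intro sum.cong refl sum.swap)
  also have "\<dots> = (\<Sum>bs\<in>basis_words s. \<Sum>i<n. \<Sum>j<n. (a i * monomial bs (\<theta> i)) * (a j * monomial bs (\<theta> j)) * ridge_kernel m (\<theta> i) (\<theta> j))"
    by (rule sum.swap)
  also have "\<dots> = (\<Sum>bs\<in>basis_words s. LINT w|sphere_measure. (\<Sum>j<n. a j * monomial bs (\<theta> j) * relu_pow m (\<theta> j \<bullet> w))\<^sup>2)"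
    by (intro sum.cong refl ridge_kernel_form \<theta>)
  finally show ?thesis .
qed

lemma abs_monomial_le:
  fixes x :: "'a::euclidean_space"
  assumes "bs \<in> basis_words s" "norm x = 1"
  shows "\<bar>monomial bs x\<bar> \<le> 1"
proof -
  have "set bs \<subseteq> Basis \<Longrightarrow> \<bar>monomial bs x\<bar> \<le> 1"
  proof (induction bs)
    case (Cons b bs)
    have "\<bar>x \<bullet> b\<bar> \<le> 1" using Basis_le_norm[of b x] Cons.prems assms(2) by simp
    then have "\<bar>x \<bullet> b\<bar> * \<bar>monomial bs x\<bar> \<le> 1 * 1" using Cons by (intro mult_mono) auto
    then show ?case by (simp add: monomial_def abs_mult)
  qed (simp add: monomial_def)
  then show ?thesis using assms(1) by (simp add: basis_words_def)
qed

lemma square_integral_sphere_le: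
  fixes f :: "'a::euclidean_space \<Rightarrow> real"
  assumes f: "f \<in> borel_measurable sphere_measure" and B: "\<And>w. norm w = 1 \<Longrightarrow> \<bar>f w\<bar> \<le> B"
  shows "(LINT w|sphere_measure. f w)\<^sup>2 \<le> (LINT w|sphere_measure. (f w)\<^sup>2)"
proof -
  define c where "c = (LINT w|sphere_measure. f w)"
  have i1: "integrable sphere_measure f" by (rule integrable_sphere_bounded[OF f B])
  have i2: "integrable sphere_measure (\<lambda>w. (f w)\<^sup>2)"
  proof (rule integrable_sphere_bounded[where B="B\<^sup>2"])
    show "\<bar>(f w)\<^sup>2\<bar> \<le> B\<^sup>2" if "norm w = 1" for w
      using power_mono[OF B[OF that], of 2] by simp
  qed (use f in measurable)
  have i3: "integrable (sphere_measure :: 'a measure) (\<lambda>_. c\<^sup>2)"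
    by (rule integrable_sphere_bounded[where B="c\<^sup>2"]) auto
  have "0 \<le> (LINT w|sphere_measure. (f w - c)\<^sup>2)" by (intro Bochner_Integration.integral_nonneg) simp
  also have "\<dots> = (LINT w|sphere_measure. (f w)\<^sup>2 - (2 * c) * f w + c\<^sup>2)"
    by (simp add: power2_diff algebra_simps)
  also have "\<dots> = (LINT w|sphere_measure. (f w)\<^sup>2) - (2 * c) * c + c\<^sup>2"
    using i1 i2 i3 by (simp add: c_def space_sphere_measure measure_space_sphere_measure)
  finally show ?thesis by (simp add: c_def power2_eq_square)
qed

text \<open>For odd \<open>s\<close> kernel values can be negative, so the sum cannot be bounded
  term by term. Instead the tensor-valued sum is paired with the tensor power of \<open>w\<close>,
  which has norm 1: Cauchy-Schwarz bounds its square from below by that of a sum of nonnegative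
  ridge functions of degree \<open>m + s\<close>, whose mean is \<open>n * p\<close>.\<close>

lemma tensor_kernel_sum_ge:
  fixes \<theta> :: "nat \<Rightarrow> 'a::euclidean_space"
  assumes \<theta>: "\<And>j. j < n \<Longrightarrow> norm (\<theta> j) = 1"
    and p: "\<And>j. j < n \<Longrightarrow> (LINT w|sphere_measure. relu_pow (m + s) (\<theta> j \<bullet> w)) = p"
  shows "(real n * p)\<^sup>2 \<le> (\<Sum>i<n. \<Sum>j<n. tensor_kernel s m (\<theta> i) (\<theta> j))"
proof -
  let ?g = "\<lambda>bs w. \<Sum>j<n. 1 * monomial bs (\<theta> j) * relu_pow m (\<theta> j \<bullet> w)"
  let ?f = "\<lambda>w. \<Sum>j<n. relu_pow (m + s) (\<theta> j \<bullet> w)"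
  have g_meas: "?g bs \<in> borel_measurable sphere_measure" for bs
    by (intro borel_measurable_sum borel_measurable_times borel_measurable_const relu_pow_inner_meas)
  have g_bound: "\<bar>?g bs w\<bar> \<le> n" if "bs \<in> basis_words s" "norm w = 1" for bs w
  proof -
    have "\<bar>?g bs w\<bar> \<le> (\<Sum>j<n. \<bar>1 * monomial bs (\<theta> j) * relu_pow m (\<theta> j \<bullet> w)\<bar>)" by (rule sum_abs)
    also have "\<dots> \<le> (\<Sum>j<n. 1)"
    proof (rule sum_mono)
      fix j assume "j \<in> {..<n}"
      then have j: "norm (\<theta> j) = 1" using \<theta> by simp
      show "\<bar>1 * monomial bs (\<theta> j) * relu_pow m (\<theta> j \<bullet> w)\<bar> \<le> 1"
        using mult_mono[OF abs_monomial_le[OF that(1) j] relu_pow_inner_bound[OF j that(2)], of m]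
        by (simp add: abs_mult)
    qed
    finally show ?thesis by simp
  qed
  have g_int: "integrable sphere_measure (\<lambda>w. (?g bs w)\<^sup>2)" if "bs \<in> basis_words s" for bs
  proof (rule integrable_sphere_bounded[where B="(real n)\<^sup>2"])
    show "\<bar>(?g bs w)\<^sup>2\<bar> \<le> (real n)\<^sup>2" if "norm w = 1" for w
      using power_mono[OF g_bound[OF \<open>bs \<in> basis_words s\<close> that], of 2] by simp
    show "(\<lambda>w. (?g bs w)\<^sup>2) \<in> borel_measurable sphere_measure"
      by (intro borel_measurable_power g_meas)
  qed
  have f_meas: "?f \<in> borel_measurable sphere_measure"
    by (intro borel_measurable_sum relu_pow_inner_meas)
  have f_bound: "\<bar>?f w\<bar> \<le> n" if "norm w = 1" for w
  proof -
    have "\<bar>?f w\<bar> \<le> (\<Sum>j<n. \<bar>relu_pow (m + s) (\<theta> j \<bullet> w)\<bar>)" by (rule sum_abs)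
    also have "\<dots> \<le> (\<Sum>j<n. 1)" using relu_pow_inner_bound[OF \<theta> that] by (intro sum_mono) auto
    finally show ?thesis by simp
  qed
  have f_int: "integrable sphere_measure (\<lambda>w. (?f w)\<^sup>2)"
  proof (rule integrable_sphere_bounded[where B="(real n)\<^sup>2"])
    show "\<bar>(?f w)\<^sup>2\<bar> \<le> (real n)\<^sup>2" if "norm w = 1" for w
      using power_mono[OF f_bound[OF that], of 2] by simp
    show "(\<lambda>w. (?f w)\<^sup>2) \<in> borel_measurable sphere_measure"
      by (intro borel_measurable_power f_meas)
  qed
  have pt: "(?f w)\<^sup>2 \<le> (\<Sum>bs\<in>basis_words s. (?g bs w)\<^sup>2)" if w: "norm w = 1" for w
  proof -
    have "?f w = (\<Sum>j<n. \<Sum>bs\<in>basis_words s. monomial bs w * (1 * monomial bs (\<theta> j) * relu_pow m (\<theta> j \<bullet> w)))"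
    proof (rule sum.cong[OF refl])
      fix j
      have "relu_pow (m + s) (\<theta> j \<bullet> w) = relu_pow m (\<theta> j \<bullet> w) * (\<Sum>bs\<in>basis_words s. monomial bs (\<theta> j) * monomial bs w)"
        by (simp only: relu_pow_times_power[symmetric] power_inner_eq_sum_monomial)
      then show "relu_pow (m + s) (\<theta> j \<bullet> w) = (\<Sum>bs\<in>basis_words s. monomial bs w * (1 * monomial bs (\<theta> j) * relu_pow m (\<theta> j \<bullet> w)))"
        by (simp add: sum_distrib_left mult_ac)
    qed
    also have "\<dots> = (\<Sum>bs\<in>basis_words s. \<Sum>j<n. monomial bs w * (1 * monomial bs (\<theta> j) * relu_pow m (\<theta> j \<bullet> w)))"
      by (rule sum.swap)
    also have "\<dots> = (\<Sum>bs\<in>basis_words s. monomial bs w * ?g bs w)"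
      by (simp only: sum_distrib_left)
    finally have "(?f w)\<^sup>2 = (\<Sum>bs\<in>basis_words s. monomial bs w * ?g bs w)\<^sup>2" by simp
    also have "\<dots> \<le> (\<Sum>bs\<in>basis_words s. (monomial bs w)\<^sup>2) * (\<Sum>bs\<in>basis_words s. (?g bs w)\<^sup>2)"
      by (rule Cauchy_Schwarz_ineq_sum)
    also have "(\<Sum>bs\<in>basis_words s. (monomial bs w)\<^sup>2) = 1"
      using power_inner_eq_sum_monomial[of w w s] w by (simp add: power2_eq_square norm_eq_1)
    finally show ?thesis by simp
  qed
  have "(LINT w|sphere_measure. ?f w) = (\<Sum>j<n. LINT w|sphere_measure. relu_pow (m + s) (\<theta> j \<bullet> w))"
    by (intro Bochner_Integration.integral_sum integrable_sphere_bounded[where B=1] relu_pow_inner_meas relu_pow_inner_bound \<theta>) auto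
  also have "\<dots> = (\<Sum>j<n. p)" by (intro sum.cong refl p) simp
  finally have "(real n * p)\<^sup>2 = (LINT w|sphere_measure. ?f w)\<^sup>2" by simp
  also have "\<dots> \<le> (LINT w|sphere_measure. (?f w)\<^sup>2)"
    by (rule square_integral_sphere_le[OF f_meas f_bound])
  also have "\<dots> \<le> (LINT w|sphere_measure. (\<Sum>bs\<in>basis_words s. (?g bs w)\<^sup>2))"
    using f_int g_int by (intro integral_mono pt integrable_sum) (auto simp: space_sphere_measure)
  also have "\<dots> = (\<Sum>bs\<in>basis_words s. LINT w|sphere_measure. (?g bs w)\<^sup>2)"
    by (intro Bochner_Integration.integral_sum g_int)
  also have "\<dots> = (\<Sum>i<n. \<Sum>j<n. 1 * 1 * tensor_kernel s m (\<theta> i) (\<theta> j))"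
    by (rule tensor_kernel_form[OF \<theta>, symmetric])
  finally show ?thesis by simp
qed

section \<open>Test vectors with small quadratic form\<close>

lemma underdetermined_system:
  fixes c :: "'k \<Rightarrow> 'i \<Rightarrow> real"
  assumes "finite K" "finite I" "card K < card I"
  shows "\<exists>b. (\<exists>i\<in>I. b i \<noteq> 0) \<and> (\<forall>k\<in>K. (\<Sum>i\<in>I. b i * c k i) = 0)"
  using assms
proof (induction K arbitrary: I c rule: finite_induct)
  case empty
  then have "I \<noteq> {}" by auto
  then show ?case by (intro exI[of _ "\<lambda>_. 1"]) auto
next
  case (insert k K)
  show ?case
  proof (cases "\<forall>i\<in>I. c k i = 0")
    case True
    obtain b where "\<exists>i\<in>I. b i \<noteq> 0" "\<forall>k\<in>K. (\<Sum>i\<in>I. b i * c k i) = 0"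
      using insert.IH[of I c] insert.prems insert.hyps by auto
    then show ?thesis using True by auto
  next
    case False
    then obtain i0 where i0: "i0 \<in> I" "c k i0 \<noteq> 0" by blast
    let ?J = "I - {i0}"
    have J: "finite ?J" "card K < card ?J"
      using insert i0(1) by (auto simp: card_Diff_singleton)
    \<comment> \<open>Equation \<open>k\<close> is solved for the unknown \<open>i0\<close> and
      substituted into the others.\<close>
    obtain b where b: "\<exists>i\<in>?J. b i \<noteq> 0"
      and b0: "\<And>k'. k' \<in> K \<Longrightarrow> (\<Sum>i\<in>?J. b i * (c k' i - c k' i0 * c k i / c k i0)) = 0"
      using insert.IH[of ?J "\<lambda>k' i. c k' i - c k' i0 * c k i / c k i0"] J by blast
    define S where "S = (\<Sum>i\<in>?J. b i * c k i)"
    define b' where "b' = b(i0 := - S / c k i0)"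
    have split: "(\<Sum>i\<in>I. b' i * c k' i) = - S / c k i0 * c k' i0 + (\<Sum>i\<in>?J. b i * c k' i)" for k'
      using i0(1) insert.prems(1) by (subst sum.remove[of _ i0]) (auto simp: b'_def intro!: sum.cong)
    have "(\<Sum>i\<in>I. b' i * c k i) = 0" unfolding split using i0(2) by (simp add: S_def)
    moreover have "(\<Sum>i\<in>I. b' i * c k' i) = 0" if "k' \<in> K" for k'
    proof -
      have "0 = (\<Sum>i\<in>?J. b i * c k' i - (c k' i0 / c k i0) * (b i * c k i))"
        using b0[OF that] by (simp add: algebra_simps)
      also have "\<dots> = (\<Sum>i\<in>?J. b i * c k' i) - (c k' i0 / c k i0) * S"
        by (simp only: sum_subtractf S_def sum_distrib_left)
      finally show ?thesis unfolding split by (simp add: field_simps)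
    qed
    moreover have "\<exists>i\<in>I. b' i \<noteq> 0" using b by (auto simp: b'_def)
    ultimately show ?thesis by (intro exI[of _ b']) auto
  qed
qed

text \<open>After rotating \<open>x\<close> to a basis vector \<open>e\<close>, the cone over the
  strip lies in a box whose side in direction \<open>e\<close> is \<open>2 * \<delta>\<close> and
  whose other sides are 2, because \<open>\<bar>e \<bullet> w\<bar> = norm w * \<bar>e \<bullet> sgn
  w\<bar>\<close>.\<close>

lemma measure_sphere_strip_le:
  fixes x :: "'a::euclidean_space"
  assumes D: "DIM('a) = d + 1" "d \<ge> 1" and x: "norm x = 1" and \<delta>: "0 \<le> \<delta>"
  shows "measure sphere_measure {w \<in> sphere 0 1. \<bar>x \<bullet> w\<bar> \<le> \<delta>}
    \<le> 2 ^ (d + 1) / measure lborel (ball (0::'a) 1) * \<delta>"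
proof -
  obtain e :: 'a where e: "e \<in> Basis" using nonempty_Basis by blast
  have D2: "DIM('a) \<ge> 2" using D by simp
  obtain v where v: "norm v = 1" "x \<bullet> v = 0"
    "e = cos (arccos (x \<bullet> e)) *\<^sub>R x + sin (arccos (x \<bullet> e)) *\<^sub>R v"
    using unit_vector_decomposition[OF D2 x norm_Basis[OF e]] by metis
  let ?f = "plane_rotation x v (arccos (x \<bullet> e))"
  have f: "orthogonal_transformation ?f" by (rule orthogonal_plane_rotation[OF x v(1,2)])
  have "?f x = e"
    using x v(2) by (subst v(3)) (simp add: plane_rotation_def norm_eq_1 inner_commute algebra_simps)
  then have fe: "e \<bullet> ?f w = x \<bullet> w" for w
    using f unfolding orthogonal_transformation_def by metis
  have nf: "norm (?f w) = norm w" for w using orthogonal_transformation_norm[OF f] .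
  let ?A = "{w \<in> sphere 0 1. \<bar>e \<bullet> w\<bar> \<le> \<delta>}"
  have A: "?A \<in> sets borel" "?A \<subseteq> sphere 0 1" by measurable auto
  have "?f -` ?A = {w \<in> sphere 0 1. \<bar>x \<bullet> w\<bar> \<le> \<delta>}" by (auto simp: fe nf)
  then have "emeasure sphere_measure {w \<in> sphere 0 1. \<bar>x \<bullet> w\<bar> \<le> \<delta>} = emeasure sphere_measure ?A"
    using emeasure_sphere_measure_orthogonal[OF f A] by simp
  then have "measure sphere_measure {w \<in> sphere 0 1. \<bar>x \<bullet> w\<bar> \<le> \<delta>}
      = measure lborel {w \<in> ball 0 1. sgn w \<in> ?A} / measure lborel (ball (0::'a) 1)"
  proof -
    have "emeasure lborel {w \<in> ball 0 1. sgn w \<in> ?A} \<le> emeasure lborel (ball (0::'a) 1)"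
      by (intro emeasure_mono) auto
    then have fin: "emeasure lborel {w \<in> ball 0 1. sgn w \<in> ?A} \<noteq> \<infinity>"
      using emeasure_unit_ball(2)[where 'a='a] by (auto simp: top_unique)
    have pos: "0 < measure lborel (ball (0::'a) 1)" by (rule content_ball_pos) simp
    have "emeasure sphere_measure ?A
        = ennreal (measure lborel {w \<in> ball 0 1. sgn w \<in> ?A}) / ennreal (measure lborel (ball (0::'a) 1))"
      using emeasure_sphere_measure[OF A] fin emeasure_unit_ball(2)[where 'a='a]
      by (simp add: emeasure_eq_ennreal_measure)
    also have "\<dots> = ennreal (measure lborel {w \<in> ball 0 1. sgn w \<in> ?A} / measure lborel (ball (0::'a) 1))"
      using pos by (intro divide_ennreal) auto
    finally show ?thesis
      using \<open>emeasure sphere_measure _ = emeasure sphere_measure ?A\<close> pos by (simp add: measure_def)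
  qed
  also have "measure lborel {w \<in> ball 0 1. sgn w \<in> ?A} \<le> 2 ^ (d + 1) * \<delta>"
  proof -
    define B where "B = (\<Sum>b\<in>Basis. (if b = e then \<delta> else 1) *\<^sub>R b :: 'a)"
    have Bb: "B \<bullet> b = (if b = e then \<delta> else 1)" if "b \<in> Basis" for b
      using that unfolding B_def by simp
    have "{w \<in> ball 0 1. sgn w \<in> ?A} \<subseteq> cbox (- B) B"
    proof
      fix w assume "w \<in> {w \<in> ball 0 1. sgn w \<in> ?A}"
      then have w: "norm w < 1" "w \<noteq> 0" "\<bar>e \<bullet> sgn w\<bar> \<le> \<delta>" by (auto simp: norm_sgn split: if_splits)
      have "\<bar>e \<bullet> w\<bar> = norm w * \<bar>e \<bullet> sgn w\<bar>" using w(2) by (simp add: sgn_div_norm abs_mult)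
      also have "\<dots> \<le> 1 * \<delta>" using w by (intro mult_mono) auto
      finally have ew: "\<bar>w \<bullet> e\<bar> \<le> \<delta>" by (simp add: inner_commute)
      have "\<bar>w \<bullet> b\<bar> \<le> 1" if "b \<in> Basis" for b using Basis_le_norm[OF that, of w] w(1) by simp
      then show "w \<in> cbox (- B) B" using ew by (auto simp: mem_box Bb abs_le_iff)
    qed
    then have "measure lborel {w \<in> ball 0 1. sgn w \<in> ?A} \<le> measure lborel (cbox (- B) B)"
    proof (rule measure_mono_fmeasurable)
      have "ball 0 1 \<inter> sgn -` ?A \<in> sets lborel"
        using measurable_sets[OF borel_measurable_sgn_vec A(1)] by auto
      then show "{w \<in> ball 0 1. sgn w \<in> ?A} \<in> sets lborel"
        by (simp add: vimage_def Int_def)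
      show "cbox (- B) B \<in> fmeasurable lborel"
        by (rule fmeasurable_cbox)
    qed
    also have "\<dots> = (\<Prod>b\<in>Basis. 2 * (if b = e then \<delta> else 1))"
      using \<delta> by (subst content_cbox) (auto simp: Bb intro!: prod.cong)
    also have "\<dots> = 2 ^ (d + 1) * \<delta>"
      using e D(1) by (simp add: prod.distrib prod.delta)
    finally show ?thesis .
  qed
  finally show ?thesis
    by (simp add: divide_right_mono)
qed

lemma abs_relu_pow_le_power: "x \<le> B \<Longrightarrow> 0 \<le> B \<Longrightarrow> \<bar>relu_pow m x\<bar> \<le> B ^ m"
  by (cases "x > 0") (auto simp: relu_pow_pos relu_pow_nonpos intro: power_mono)

text \<open>The sum is nonzero only when \<open>w\<close> separates the points, with some inner
  products positive and some not. Since all points are within \<open>\<delta>\<close> of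
  \<open>y\<close>, this forces \<open>\<bar>y \<bullet> w\<bar> \<le> \<delta>\<close> and every
  \<open>x i \<bullet> w\<close> to be at most \<open>2 * \<delta>\<close>.\<close>

lemma annihilating_ridge_integral_le:
  fixes x :: "nat \<Rightarrow> 'a::euclidean_space" and y :: 'a
  assumes D: "DIM('a) = d + 1" "d \<ge> 1"
    and x: "\<And>i. i < N \<Longrightarrow> norm (x i) = 1" and y: "norm y = 1"
    and near: "\<And>i. i < N \<Longrightarrow> dist (x i) y \<le> \<delta>"
    and c: "\<And>i. i < N \<Longrightarrow> \<bar>c i\<bar> \<le> 1"
    and annih: "\<And>cs. cs \<in> basis_words m \<Longrightarrow> (\<Sum>i<N. c i * monomial cs (x i)) = 0"
    and \<delta>: "0 \<le> \<delta>"
  shows "(LINT w|sphere_measure. (\<Sum>i<N. c i * relu_pow m (x i \<bullet> w))\<^sup>2)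
    \<le> (real N * (2 * \<delta>) ^ m)\<^sup>2 * (2 ^ (d + 1) / measure lborel (ball (0::'a) 1) * \<delta>)"
proof -
  let ?f = "\<lambda>w. \<Sum>i<N. c i * relu_pow m (x i \<bullet> w)"
  let ?S = "{w \<in> sphere 0 1. \<bar>y \<bullet> w\<bar> \<le> \<delta>}"
  let ?B = "real N * (2 * \<delta>) ^ m"
  have close: "\<bar>x i \<bullet> w - y \<bullet> w\<bar> \<le> \<delta>" if "i < N" "norm w = 1" for i w
  proof -
    have "\<bar>(x i - y) \<bullet> w\<bar> \<le> norm (x i - y) * norm w" by (rule Cauchy_Schwarz_ineq2)
    also have "\<dots> \<le> \<delta>" using near[OF that(1)] that(2) by (simp add: dist_norm)
    finally show ?thesis by (simp add: inner_diff_left)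
  qed
  txt \<open>If all inner products are positive, the sum is a polynomial in \<open>w\<close> that vanishes by \<open>annih\<close>.\<close>
  have pt: "(?f w)\<^sup>2 \<le> indicator ?S w * ?B\<^sup>2" if w: "norm w = 1" for w
  proof -
    consider "\<forall>i<N. 0 < x i \<bullet> w" | "\<forall>i<N. x i \<bullet> w \<le> 0"
      | i j where "i < N" "j < N" "0 < x i \<bullet> w" "x j \<bullet> w \<le> 0" by (meson not_less)
    then show ?thesis
    proof cases
      case 1
      have "?f w = (\<Sum>i<N. \<Sum>cs\<in>basis_words m. monomial cs w * (c i * monomial cs (x i)))"
        using 1 by (intro sum.cong refl)
          (simp add: relu_pow_pos power_inner_eq_sum_monomial sum_distrib_left mult_ac)
      also have "\<dots> = (\<Sum>cs\<in>basis_words m. \<Sum>i<N. monomial cs w * (c i * monomial cs (x i)))"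
        by (rule sum.swap)
      also have "\<dots> = 0" using annih by (simp add: sum_distrib_left[symmetric])
      finally show ?thesis by simp
    next
      case 2
      then have "?f w = 0" by (intro sum.neutral) (simp add: relu_pow_nonpos)
      then show ?thesis by simp
    next
      case 3
      have yw: "\<bar>y \<bullet> w\<bar> \<le> \<delta>"
        using close[OF 3(1) w] close[OF 3(2) w] 3(3,4) unfolding abs_le_iff by linarith
      then have wS: "w \<in> ?S" using w by simp
      have "\<bar>?f w\<bar> \<le> (\<Sum>i<N. \<bar>c i * relu_pow m (x i \<bullet> w)\<bar>)" by (rule sum_abs)
      also have "\<dots> \<le> (\<Sum>i<N. 1 * (2 * \<delta>) ^ m)"
      proof (rule sum_mono)
        fix i assume i: "i \<in> {..<N}"
        have "x i \<bullet> w \<le> 2 * \<delta>" using close[of i w] i w yw unfolding abs_le_iff by simp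
        then have "\<bar>relu_pow m (x i \<bullet> w)\<bar> \<le> (2 * \<delta>) ^ m"
          using \<delta> by (intro abs_relu_pow_le_power) auto
        then have "\<bar>c i\<bar> * \<bar>relu_pow m (x i \<bullet> w)\<bar> \<le> 1 * (2 * \<delta>) ^ m"
          using c i by (intro mult_mono) auto
        then show "\<bar>c i * relu_pow m (x i \<bullet> w)\<bar> \<le> 1 * (2 * \<delta>) ^ m"
          by (simp add: abs_mult)
      qed
      finally have "\<bar>?f w\<bar> \<le> ?B" by simp
      then have "\<bar>?f w\<bar>\<^sup>2 \<le> ?B\<^sup>2" by (intro power_mono) auto
      then show ?thesis using wS by simp
    qed
  qed
  have f_meas: "(\<lambda>w. (?f w)\<^sup>2) \<in> borel_measurable sphere_measure"
    by (intro borel_measurable_power borel_measurable_sum borel_measurable_times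
        borel_measurable_const relu_pow_inner_meas)
  have S: "?S \<in> sets sphere_measure"
  proof -
    have "?S \<in> sets borel" by measurable
    then show ?thesis
      by (auto simp: sets_sphere_measure sets_restrict_space intro!: image_eqI[of _ _ ?S])
  qed
  have S_meas: "(\<lambda>w. indicator ?S w * ?B\<^sup>2) \<in> borel_measurable sphere_measure"
    using S by (intro borel_measurable_times borel_measurable_indicator borel_measurable_const)
  have "(LINT w|sphere_measure. (?f w)\<^sup>2) \<le> (LINT w|sphere_measure. indicator ?S w * ?B\<^sup>2)"
  proof (rule integral_mono)
    show "integrable sphere_measure (\<lambda>w. indicator ?S w * ?B\<^sup>2)"
      by (rule integrable_sphere_bounded[OF S_meas, of "?B\<^sup>2"]) (auto simp: indicator_def)
    have "\<bar>(?f w)\<^sup>2\<bar> \<le> ?B\<^sup>2" if "norm w = 1" for w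
    proof -
      have "(?f w)\<^sup>2 \<le> indicator ?S w * ?B\<^sup>2" by (rule pt[OF that])
      also have "\<dots> \<le> 1 * ?B\<^sup>2" by (intro mult_right_mono) (auto simp: indicator_def)
      finally show ?thesis by simp
    qed
    then show "integrable sphere_measure (\<lambda>w. (?f w)\<^sup>2)"
      by (rule integrable_sphere_bounded[OF f_meas])
  qed (use pt in \<open>simp add: space_sphere_measure\<close>)
  also have "\<dots> = measure sphere_measure ?S * ?B\<^sup>2"
    using S by (simp add: space_sphere_measure Int_absorb2 subset_eq)
  also have "\<dots> \<le> (2 ^ (d + 1) / measure lborel (ball (0::'a) 1) * \<delta>) * ?B\<^sup>2"
    by (intro mult_right_mono measure_sphere_strip_le[OF D y \<delta>]) auto
  finally show ?thesis by (simp add: mult.commute)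
qed

definition tensor_form :: "nat \<Rightarrow> nat \<Rightarrow> nat \<Rightarrow> (nat \<Rightarrow> 'a::euclidean_space) \<Rightarrow> (nat \<Rightarrow> real) \<Rightarrow> real" where
  "tensor_form s m n \<theta> a = (\<Sum>i<n. \<Sum>j<n. a i * a j * tensor_kernel s m (\<theta> i) (\<theta> j))"

lemma circle_points:
  fixes u v :: "'a::euclidean_space"
  assumes u: "norm u = 1" and v: "norm v = 1" "u \<bullet> v = 0"
  defines "y \<equiv> \<lambda>\<phi>. cos \<phi> *\<^sub>R u + sin \<phi> *\<^sub>R v"
  shows "norm (y \<phi>) = 1" and "\<bar>\<phi> - \<psi>\<bar> \<le> pi \<Longrightarrow> geodesic_dist (y \<phi>) (y \<psi>) = \<bar>\<phi> - \<psi>\<bar>"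
proof -
  have "u \<bullet> u = 1" "v \<bullet> v = 1" "v \<bullet> u = 0" using u v by (simp_all add: norm_eq_1 inner_commute)
  then have ip: "y \<phi> \<bullet> y \<psi> = cos (\<phi> - \<psi>)" for \<phi> \<psi>
    using v(2) by (simp add: y_def inner_add_left inner_add_right cos_diff)
  then show "norm (y \<phi>) = 1" by (simp add: norm_eq_1)
  show "geodesic_dist (y \<phi>) (y \<psi>) = \<bar>\<phi> - \<psi>\<bar>" if "\<bar>\<phi> - \<psi>\<bar> \<le> pi"
  proof -
    have "cos (\<phi> - \<psi>) = cos \<bar>\<phi> - \<psi>\<bar>" by (simp add: abs_if cos_minus[of "\<phi> - \<psi>", symmetric])
    then show ?thesis using arccos_cos[of "\<bar>\<phi> - \<psi>\<bar>"] that by (simp add: geodesic_dist_def ip)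
  qed
qed

text \<open>\<open>N\<close> is one more than the number of words of length \<open>s + m\<close>, so
  suitable weights on \<open>N\<close> points annihilate all these monomials. Two base points
  sharing a neighbour would have chord at most \<open>2 * h\<close> and arc at most
  \<open>6 * h\<close>, below the step \<open>9 * h\<close>. The bound \<open>3 < pi\<close> keeps
  all base points on a half circle, where arcs are differences of angles; \<open>R * h\<close> adds
  the last \<open>h\<close> from a base point to its neighbour.\<close>

lemma tensor_form_small:
  fixes \<theta> :: "nat \<Rightarrow> 'a::euclidean_space"
  assumes D: "DIM('a) = d + 1" "d \<ge> 1" and \<theta>: "\<And>j. j < n \<Longrightarrow> norm (\<theta> j) = 1" and n: "n \<ge> 2"
    and N: "N = (d + 1) ^ (s + m) + 1" and R: "R = 9 * real N + 1"
    and h: "h = mesh_size n \<theta>" "9 * real N * h \<le> 3"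
  shows "\<exists>a. (\<Sum>j<n. (a j)\<^sup>2) = 1 \<and> tensor_form s m n \<theta> a \<le>
    real ((d + 1) ^ s) * ((real N * (2 * (R * h)) ^ m)\<^sup>2 * (2 ^ (d + 1) / measure lborel (ball (0::'a) 1) * (R * h)))"
proof -
  have hpos: "0 < h" unfolding h(1) by (rule card_ge_mesh_size(1)[OF \<theta> n D])
  have D2: "DIM('a) \<ge> 2" using D by simp
  obtain u :: 'a where "u \<in> Basis" using nonempty_Basis by blast
  then have u: "norm u = 1" by simp
  obtain v where v: "norm v = 1" "u \<bullet> v = 0"
    using unit_vector_decomposition[OF D2 u u] by metis
  txt \<open>
    Nearest neighbours of equidistant points on a great circle; the spacing \<open>9 * h\<close> makes them distinct.
  \<close>
  define y where "y \<phi> = cos \<phi> *\<^sub>R u + sin \<phi> *\<^sub>R v" for \<phi>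
  note y = circle_points[OF u v, folded y_def]
  define \<phi> where "\<phi> i = 9 * real i * h" for i :: nat
  have "\<exists>j<n. geodesic_dist (y (\<phi> i)) (\<theta> j) \<le> h" for i
    unfolding h(1) by (rule mesh_size_cover[OF \<theta> n y(1)])
  then obtain J where J: "\<And>i. J i < n" "\<And>i. geodesic_dist (y (\<phi> i)) (\<theta> (J i)) \<le> h"
    by metis
  have Jd: "dist (y (\<phi> i)) (\<theta> (J i)) \<le> h" for i
    using geodesic_dist_bounds(4)[OF y(1) \<theta>[OF J(1)]] J(2)[of i] by (rule order_trans)
  have range: "\<bar>\<phi> i - \<phi> i'\<bar> \<le> pi" "\<bar>\<phi> i - \<phi> i'\<bar> = 9 * h * \<bar>real i - real i'\<bar>" if "i < N" "i' < N" for i i'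
  proof -
    have "\<phi> i - \<phi> i' = 9 * h * (real i - real i')" by (simp add: \<phi>_def algebra_simps)
    then show eq: "\<bar>\<phi> i - \<phi> i'\<bar> = 9 * h * \<bar>real i - real i'\<bar>" using hpos by (simp add: abs_mult)
    have "9 * h * \<bar>real i - real i'\<bar> \<le> 9 * h * real N" using that hpos by (intro mult_left_mono) auto
    then show "\<bar>\<phi> i - \<phi> i'\<bar> \<le> pi" using eq h(2) pi_gt3 by (simp add: mult_ac)
  qed
  have inj: "i = i'" if ii: "i < N" "i' < N" "J i = J i'" for i i'
  proof (rule ccontr)
    assume ne: "i \<noteq> i'"
    have "9 * h * 1 \<le> 9 * h * \<bar>real i - real i'\<bar>" using ne hpos by (intro mult_left_mono) auto
    also have "\<dots> = geodesic_dist (y (\<phi> i)) (y (\<phi> i'))"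
      using y(2)[OF range(1)] range(2) ii by simp
    also have "\<dots> \<le> 3 * dist (y (\<phi> i)) (y (\<phi> i'))" by (intro geodesic_dist_bounds y)
    also have "dist (y (\<phi> i)) (y (\<phi> i')) \<le> h + h"
      using dist_triangle2[of "y (\<phi> i)" "y (\<phi> i')" "\<theta> (J i)"] Jd[of i] Jd[of i'] ii(3) by simp
    finally show False using hpos by simp
  qed
  have near: "dist (\<theta> (J i)) (y (\<phi> 0)) \<le> R * h" if i: "i < N" for i
  proof -
    have N0: "0 < N" by (simp add: N)
    have "dist (y (\<phi> i)) (y (\<phi> 0)) \<le> geodesic_dist (y (\<phi> i)) (y (\<phi> 0))" by (intro geodesic_dist_bounds y)
    also have "\<dots> = 9 * h * real i" using y(2)[OF range(1)[OF i N0]] range(2)[OF i N0] by simp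
    also have "\<dots> \<le> 9 * h * real N" using i hpos by (intro mult_left_mono) auto
    finally show ?thesis
      using dist_triangle3[of "\<theta> (J i)" "y (\<phi> 0)" "y (\<phi> i)"] Jd[of i] by (simp add: R algebra_simps)
  qed
  obtain b where b: "\<exists>i\<in>{..<N}. b i \<noteq> (0::real)"
    and b0: "\<And>cs. cs \<in> basis_words (s + m) \<Longrightarrow> (\<Sum>i<N. b i * monomial cs (\<theta> (J i))) = 0"
    using underdetermined_system[of "basis_words (s + m) :: 'a list set" "{..<N}" "\<lambda>cs i. monomial cs (\<theta> (J i))"]
      finite_basis_words card_basis_words[where 'a='a, of "s + m"] by (auto simp: D(1) N)
  define S where "S = (\<Sum>i<N. (b i)\<^sup>2)"
  have S: "0 < S" unfolding S_def using b by (auto intro: sum_pos2)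
  define \<beta> where "\<beta> i = b i / sqrt S" for i
  have \<beta>1: "(\<Sum>i<N. (\<beta> i)\<^sup>2) = 1"
    using S by (simp add: \<beta>_def power_divide S_def flip: sum_divide_distrib)
  have \<beta>_le: "\<bar>\<beta> i\<bar> \<le> 1" if "i < N" for i
    using member_le_sum[of i "{..<N}" "\<lambda>i. (\<beta> i)\<^sup>2"] that \<beta>1 by (simp add: abs_square_le_1)
  have \<beta>0: "(\<Sum>i<N. \<beta> i * monomial cs (\<theta> (J i))) = 0" if "cs \<in> basis_words (s + m)" for cs
    using b0[OF that] by (simp add: \<beta>_def flip: sum_divide_distrib)
  \<comment> \<open>The weights carried to the original indices; injectivity of \<open>J\<close> on
    \<open>{..<N}\<close> preserves their norm.\<close>
  define a where "a j = (\<Sum>i<N. if J i = j then \<beta> i else 0)" for j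
  have a_sum: "(\<Sum>j<n. a j * G j) = (\<Sum>i<N. \<beta> i * G (J i))" for G
  proof -
    have "(\<Sum>j<n. a j * G j) = (\<Sum>j<n. \<Sum>i<N. if J i = j then \<beta> i * G j else 0)"
      by (simp add: a_def sum_distrib_right if_distrib[of "\<lambda>z. z * _"] cong: if_cong)
    also have "\<dots> = (\<Sum>i<N. \<Sum>j<n. if J i = j then \<beta> i * G j else 0)" by (rule sum.swap)
    also have "\<dots> = (\<Sum>i<N. \<beta> i * G (J i))" using J(1) by (simp add: sum.delta')
    finally show ?thesis .
  qed
  have a_J: "a (J i) = \<beta> i" if i: "i < N" for i
  proof -
    have "a (J i) = (\<Sum>i'<N. if i' = i then \<beta> i' else 0)"
      unfolding a_def using inj i by (intro sum.cong refl) auto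
    then show ?thesis using i by simp
  qed
  have a1: "(\<Sum>j<n. (a j)\<^sup>2) = 1"
    using a_sum[of a] a_J \<beta>1 by (simp add: power2_eq_square)
  let ?K = "(real N * (2 * (R * h)) ^ m)\<^sup>2 * (2 ^ (d + 1) / measure lborel (ball (0::'a) 1) * (R * h))"
  have "tensor_form s m n \<theta> a
      = (\<Sum>bs\<in>basis_words s. LINT w|sphere_measure. (\<Sum>i<N. \<beta> i * monomial bs (\<theta> (J i)) * relu_pow m (\<theta> (J i) \<bullet> w))\<^sup>2)"
  proof -
    have "tensor_form s m n \<theta> a
        = (\<Sum>bs\<in>basis_words s. LINT w|sphere_measure. (\<Sum>j<n. a j * monomial bs (\<theta> j) * relu_pow m (\<theta> j \<bullet> w))\<^sup>2)"
      unfolding tensor_form_def by (rule tensor_kernel_form[OF \<theta>])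
    moreover have "(\<Sum>j<n. a j * monomial bs (\<theta> j) * relu_pow m (\<theta> j \<bullet> w))
        = (\<Sum>i<N. \<beta> i * monomial bs (\<theta> (J i)) * relu_pow m (\<theta> (J i) \<bullet> w))" for bs w
      unfolding mult.assoc by (rule a_sum)
    ultimately show ?thesis by (simp only:)
  qed
  also have "\<dots> \<le> (\<Sum>bs\<in>(basis_words s :: 'a list set). ?K)"
  proof (rule sum_mono)
    fix bs :: "'a list" assume bs: "bs \<in> basis_words s"
    show "(LINT w|sphere_measure. (\<Sum>i<N. \<beta> i * monomial bs (\<theta> (J i)) * relu_pow m (\<theta> (J i) \<bullet> w))\<^sup>2) \<le> ?K"
    proof (rule annihilating_ridge_integral_le[OF D _ y(1) near])
      show "norm (\<theta> (J i)) = 1" for i by (rule \<theta>[OF J(1)])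
      show "\<bar>\<beta> i * monomial bs (\<theta> (J i))\<bar> \<le> 1" if "i < N" for i
        using mult_mono[OF \<beta>_le[OF that] abs_monomial_le[OF bs \<theta>[OF J(1)]]] by (simp add: abs_mult)
      show "0 \<le> R * h" using hpos by (simp add: R)
      show "(\<Sum>i<N. \<beta> i * monomial bs (\<theta> (J i)) * monomial cs (\<theta> (J i))) = 0" if "cs \<in> basis_words m" for cs
      proof -
        \<comment> \<open>Annihilating the words of length \<open>s + m\<close> serves all tensor
          entries \<open>bs\<close> at once: the \<open>s\<close> letters of \<open>bs\<close> and
          the \<open>m\<close> letters of \<open>cs\<close> together form such a word.\<close>
        have "bs @ cs \<in> basis_words (s + m)" using bs that by (auto simp: basis_words_def)
        from \<beta>0[OF this] show ?thesis by (simp add: monomial_append mult.assoc)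
      qed
    qed
  qed
  also have "\<dots> = real ((d + 1) ^ s) * ?K" by (simp add: card_basis_words D(1))
  finally show ?thesis using a1 by blast
qed

lemma tensor_form_min_le:
  assumes D: "DIM('a::euclidean_space) = d + 1" "d \<ge> 1"
  shows "\<exists>C>0. \<forall>n\<ge>2. \<forall>\<theta> :: nat \<Rightarrow> 'a. (\<forall>j<n. norm (\<theta> j) = 1) \<longrightarrow>
    (\<exists>a. (\<Sum>j<n. (a j)\<^sup>2) = 1 \<and> tensor_form s m n \<theta> a \<le> C * mesh_size n \<theta> ^ (2 * m + 1))"
proof -
  define N where "N = (d + 1) ^ (s + m) + 1"
  define R where "R = 9 * real N + 1"
  define V where "V = measure lborel (ball (0::'a) 1)"
  have V: "0 < V" unfolding V_def by (rule content_ball_pos) simp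
  define C1 where "C1 = real ((d + 1) ^ s) * ((real N * (2 * R) ^ m)\<^sup>2 * (2 ^ (d + 1) / V * R))"
  define C2 where "C2 = (3 * real N) ^ (2 * m + 1)"
  have pos: "0 < R" "0 \<le> C1" "0 < C2"
    using V by (simp_all add: R_def C1_def C2_def N_def add_nonneg_pos)
  show ?thesis
  proof (intro exI[of _ "C1 + C2"] conjI allI impI)
    show "0 < C1 + C2" using pos by simp
    fix n :: nat and \<theta> :: "nat \<Rightarrow> 'a"
    assume n: "2 \<le> n" and "\<forall>j<n. norm (\<theta> j) = 1"
    then have \<theta>: "\<And>j. j < n \<Longrightarrow> norm (\<theta> j) = 1" by blast
    define h where "h = mesh_size n \<theta>"
    have h: "0 < h" unfolding h_def by (rule card_ge_mesh_size(1)[OF \<theta> n D])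
    show "\<exists>a. (\<Sum>j<n. (a j)\<^sup>2) = 1 \<and> tensor_form s m n \<theta> a \<le> (C1 + C2) * mesh_size n \<theta> ^ (2 * m + 1)"
    proof (cases "9 * real N * h \<le> 3")
      case True
      from tensor_form_small[OF D \<theta> n N_def R_def h_def True]
      obtain a where a: "(\<Sum>j<n. (a j)\<^sup>2) = 1" and le: "tensor_form s m n \<theta> a \<le>
          real ((d + 1) ^ s) * ((real N * (2 * (R * h)) ^ m)\<^sup>2 * (2 ^ (d + 1) / V * (R * h)))"
        unfolding V_def by blast
      have "real ((d + 1) ^ s) * ((real N * (2 * (R * h)) ^ m)\<^sup>2 * (2 ^ (d + 1) / V * (R * h))) = C1 * h ^ (2 * m + 1)"
      proof -
        have "h ^ (2 * m + 1) = h ^ m * h ^ m * h" by (simp add: power_add mult_2)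
        then show ?thesis unfolding C1_def by (simp only: power_mult_distrib power2_eq_square mult_ac)
      qed
      with le have "tensor_form s m n \<theta> a \<le> C1 * h ^ (2 * m + 1)" by simp
      also have "\<dots> \<le> (C1 + C2) * h ^ (2 * m + 1)" using pos h by (intro mult_right_mono) auto
      finally show ?thesis using a by (auto simp: h_def)
    next
      \<comment> \<open>Now \<open>h > 1 / (3 * N)\<close>, so a bound by a constant suffices, and a
        coordinate vector provides it.\<close>
      case False
      define a where "a j = (if j = 0 then 1 else 0 :: real)" for j :: nat
      have a: "(\<Sum>j<n. (a j)\<^sup>2) = 1"
        using n by (simp add: a_def if_distrib[of "\<lambda>z. z\<^sup>2"] cong: if_cong)
      have delta: "(\<Sum>i<n. a i * G i) = G 0" for G :: "nat \<Rightarrow> real"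
      proof -
        have "(\<Sum>i<n. a i * G i) = (\<Sum>i<n. if i = 0 then G i else 0)"
          by (intro sum.cong refl) (simp add: a_def)
        then show ?thesis using n by simp
      qed
      have "tensor_form s m n \<theta> a = (\<Sum>i<n. a i * (\<Sum>j<n. a j * tensor_kernel s m (\<theta> i) (\<theta> j)))"
        by (simp add: tensor_form_def sum_distrib_left mult.assoc)
      also have "\<dots> = tensor_kernel s m (\<theta> 0) (\<theta> 0)" by (simp only: delta)
      also have "\<dots> \<le> 1" using abs_tensor_kernel_le[OF \<theta> \<theta>, of 0 0 s m] n by simp
      also have "1 \<le> (3 * real N * h) ^ (2 * m + 1)"
      proof (rule one_le_power)
        show "1 \<le> 3 * real N * h" using False by linarith
      qed
      also have "\<dots> = C2 * h ^ (2 * m + 1)" by (simp only: C2_def power_mult_distrib)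
      also have "\<dots> \<le> (C1 + C2) * h ^ (2 * m + 1)" using pos h by (intro mult_right_mono) auto
      finally show ?thesis using a by (auto simp: h_def)
    qed
  qed
qed

section \<open>Lower bound for the quadratic form\<close>

lemma tensor_form_nonneg:
  fixes \<theta> :: "nat \<Rightarrow> 'a::euclidean_space"
  assumes \<theta>: "\<And>j. j < n \<Longrightarrow> norm (\<theta> j) = 1"
  shows "0 \<le> tensor_form s m n \<theta> a"
proof -
  have "tensor_form s m n \<theta> a
      = (\<Sum>bs\<in>basis_words s. LINT w|sphere_measure. (\<Sum>j<n. a j * monomial bs (\<theta> j) * relu_pow m (\<theta> j \<bullet> w))\<^sup>2)"
    unfolding tensor_form_def by (rule tensor_kernel_form[OF \<theta>])
  also have "\<dots> \<ge> 0" by (intro sum_nonneg Bochner_Integration.integral_nonneg) simp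
  finally show ?thesis .
qed

lemma power_form_nonneg:
  fixes \<theta> :: "nat \<Rightarrow> 'a::euclidean_space"
  shows "0 \<le> (\<Sum>i<n. \<Sum>j<n. a i * a j * (\<theta> i \<bullet> \<theta> j) ^ l)"
proof -
  have "(\<Sum>i<n. \<Sum>j<n. a i * a j * (\<theta> i \<bullet> \<theta> j) ^ l)
      = (\<Sum>i<n. \<Sum>j<n. \<Sum>bs\<in>basis_words l. (a i * monomial bs (\<theta> i)) * (a j * monomial bs (\<theta> j)))"
    unfolding power_inner_eq_sum_monomial
    by (intro sum.cong refl) (simp add: sum_distrib_left mult_ac)
  also have "\<dots> = (\<Sum>i<n. \<Sum>bs\<in>basis_words l. \<Sum>j<n. (a i * monomial bs (\<theta> i)) * (a j * monomial bs (\<theta> j)))"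
    by (intro sum.cong refl sum.swap)
  also have "\<dots> = (\<Sum>bs\<in>basis_words l. \<Sum>i<n. \<Sum>j<n. (a i * monomial bs (\<theta> i)) * (a j * monomial bs (\<theta> j)))"
    by (rule sum.swap)
  also have "\<dots> = (\<Sum>bs\<in>basis_words l. (\<Sum>j<n. a j * monomial bs (\<theta> j))\<^sup>2)"
    by (simp add: power2_eq_square sum_product)
  also have "\<dots> \<ge> 0" by (intro sum_nonneg) simp
  finally show ?thesis .
qed

text \<open>The \<open>1 \<times> 1\<close> instance of \<open>ridge_profile_form_ge\<close>, with
  entry 1.\<close>

lemma ridge_profile_1_pos: "0 < ridge_profile m 1"
proof -
  have "1 / 8 * ((1 / 8) ^ (m + 1) / real (m + 1)) \<le> ridge_profile m 1"
    using ridge_profile_form_ge[of 1 "\<lambda>_ _. 1" "\<lambda>_. 1" 1 1 m 0] by simp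
  moreover have "0 < 1 / 8 * ((1 / 8) ^ (m + 1) / real (m + 1) :: real)" by simp
  ultimately show ?thesis by linarith
qed

text \<open>Up to constants the right-hand side is \<open>N\<close> to the power
  \<open>- m - 1 / 2\<close>; it decreases in \<open>N\<close>, so the upper bound
  \<open>B / e^2\<close> on \<open>N\<close> may be inserted.\<close>

lemma inverse_scale_bound:
  fixes e B :: real and N m :: nat
  assumes "N \<ge> 1" "0 < e" "0 < B" and N: "real N \<le> B / e\<^sup>2"
  shows "e ^ (2 * m + 1) / (8 ^ (m + 2) * (m + 1) * B ^ m * sqrt B)
    \<le> sqrt N / 8 * ((1 / real (8 * N)) ^ (m + 1) / (m + 1))"
proof -
  have "e\<^sup>2 / B \<le> 1 / real N" using assms by (simp add: field_simps)
  then have "(e\<^sup>2 / B) ^ m \<le> (1 / real N) ^ m" using assms by (intro power_mono) auto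
  moreover have "e / sqrt B \<le> 1 / sqrt N"
  proof -
    have "sqrt N \<le> sqrt (B / e\<^sup>2)" using N by (rule real_sqrt_le_mono)
    also have "\<dots> = sqrt B / e" using assms by (simp add: real_sqrt_divide)
    finally show ?thesis using assms by (simp add: field_simps)
  qed
  ultimately have "(e\<^sup>2 / B) ^ m * (e / sqrt B) \<le> (1 / real N) ^ m * (1 / sqrt N)"
    using assms by (intro mult_mono) auto
  then have "(e\<^sup>2 / B) ^ m * (e / sqrt B) / (8 ^ (m + 2) * (m + 1))
      \<le> (1 / real N) ^ m * (1 / sqrt N) / (8 ^ (m + 2) * (m + 1))"
    by (intro divide_right_mono) auto
  also have "(1 / real N) ^ m * (1 / sqrt N) / (8 ^ (m + 2) * (m + 1))
      = sqrt N / 8 * ((1 / real (8 * N)) ^ (m + 1) / (m + 1))"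
  proof -
    have "1 / sqrt N = sqrt N / real N" using assms(1) by (simp add: field_simps)
    then show ?thesis by (simp add: power_divide power_mult_distrib power_add field_simps)
  qed
  also have "(e\<^sup>2 / B) ^ m * (e / sqrt B) / (8 ^ (m + 2) * (m + 1))
      = e ^ (2 * m + 1) / (8 ^ (m + 2) * (m + 1) * B ^ m * sqrt B)"
  proof -
    have "(e\<^sup>2) ^ m * e = e ^ (2 * m + 1)" by (simp add: power_mult)
    then have "(e\<^sup>2 / B) ^ m * (e / sqrt B) = e ^ (2 * m + 1) / (B ^ m * sqrt B)"
      by (simp only: power_divide times_divide_times_eq)
    then show ?thesis by (simp only: divide_divide_eq_left mult_ac)
  qed
  finally show ?thesis .
qed

lemma tensor_form_ge:
  assumes D: "DIM('a::euclidean_space) = d + 1" "d \<ge> 1"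
  shows "\<exists>c>0. \<forall>n\<ge>2. \<forall>\<theta> :: nat \<Rightarrow> 'a. (\<forall>j<n. norm (\<theta> j) = 1) \<longrightarrow>
    (\<forall>a. c * antipodal_sep n \<theta> ^ (2 * m + 1) * (\<Sum>j<n. (a j)\<^sup>2) \<le> tensor_form s m n \<theta> a)"
proof -
  have D2: "DIM('a) \<ge> 2" using D by simp
  obtain u :: 'a where "u \<in> Basis" using nonempty_Basis by blast
  then have u: "norm u = 1" by simp
  define p where "p = ridge_kernel m u u"
  have p: "0 < p" unfolding p_def ridge_kernel_self by (rule relu_moment_pos[OF D2 u])
  have kern: "ridge_kernel m x y = p / ridge_profile m 1 * ridge_profile m (x \<bullet> y)"
    if "norm x = 1" "norm y = 1" for x y :: 'a
  proof -
    have "ridge_kernel m x x = p"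
      unfolding p_def ridge_kernel_self by (rule relu_moment_const[OF D2 that(1) u])
    then show ?thesis
      using ridge_kernel_profile[OF D2 that, of m] ridge_profile_1_pos[of m] by (simp add: field_simps)
  qed
  \<comment> \<open>\<open>5 * DIM('a) + 2\<close> comes from diagonal dominance; the extra 2 pays
    for rounding \<open>N\<close> up, as \<open>1 \<le> 2 / e^2\<close> for
    \<open>e \<le> 4 / 3\<close>.\<close>
  define B where "B = real (5 * DIM('a) + 4)"
  have B: "0 < B" by (simp add: B_def)
  define c0 where "c0 = 1 / (8 ^ (m + 2) * (m + 1) * B ^ m * sqrt B)"
  have c0: "0 < c0" unfolding c0_def using B by (auto intro!: divide_pos_pos mult_pos_pos add_pos_nonneg)
  \<comment> \<open>The quotient scales the profile to the kernel, the 2 comes from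
    \<open>power_form_ge\<close>, and the power of 3 from \<open>e = h / 3\<close>.\<close>
  define c where "c = p / ridge_profile m 1 * (c0 / 2 / 3 ^ (2 * m + 1))"
  show ?thesis
  proof (intro exI[of _ c] conjI allI impI)
    show "0 < c" using p c0 ridge_profile_1_pos[of m] by (simp add: c_def)
    fix n :: nat and \<theta> :: "nat \<Rightarrow> 'a" and a :: "nat \<Rightarrow> real"
    assume n: "2 \<le> n" and "\<forall>j<n. norm (\<theta> j) = 1"
    then have \<theta>: "\<And>j. j < n \<Longrightarrow> norm (\<theta> j) = 1" by blast
    define h where "h = antipodal_sep n \<theta>"
    have sep: "0 \<le> h" "h \<le> 4"
      "\<And>i j. i < n \<Longrightarrow> j < n \<Longrightarrow> i \<noteq> j \<Longrightarrow> h / 3 \<le> dist (\<theta> i) (\<theta> j)"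
      "\<And>i j. i < n \<Longrightarrow> j < n \<Longrightarrow> i \<noteq> j \<Longrightarrow> h / 3 \<le> dist (- \<theta> i) (\<theta> j)"
      using antipodal_sep_bounds[of n \<theta>] \<theta> n unfolding h_def by blast+
    show "c * antipodal_sep n \<theta> ^ (2 * m + 1) * (\<Sum>j<n. (a j)\<^sup>2) \<le> tensor_form s m n \<theta> a"
    proof (cases "h = 0")
      case True
      then show ?thesis using tensor_form_nonneg[OF \<theta>] by (simp add: h_def)
    next
      case False
      define e where "e = h / 3"
      have e: "0 < e" "e \<le> 4 / 3" using False sep(1,2) by (simp_all add: e_def)
      \<comment> \<open>Chosen so that \<open>l \<ge> 2 * N\<close> gives
        \<open>l * e^2 / 2 \<ge> 5 * DIM('a) + 2\<close>, the hypothesis of diagonal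
        dominance.\<close>
      define N where "N = nat \<lceil>real (5 * DIM('a) + 2) / e\<^sup>2\<rceil>"
      have q: "0 < real (5 * DIM('a) + 2) / e\<^sup>2" using e by simp
      then have N1: "1 \<le> N" unfolding N_def by linarith
      have Nge: "real (5 * DIM('a) + 2) / e\<^sup>2 \<le> real N" unfolding N_def by linarith
      have "real N \<le> real (5 * DIM('a) + 2) / e\<^sup>2 + 1" using q unfolding N_def by linarith
      also have "1 \<le> 2 / e\<^sup>2"
      proof -
        have "e\<^sup>2 \<le> (4 / 3)\<^sup>2" using e by (intro power_mono) auto
        then show ?thesis using e by (simp add: power2_eq_square field_simps)
      qed
      also have "real (5 * DIM('a) + 2) / e\<^sup>2 + 2 / e\<^sup>2 = B / e\<^sup>2"
        by (simp add: B_def add_divide_distrib)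
      finally have NB: "real N \<le> B / e\<^sup>2" by simp
      let ?S = "\<Sum>j<n. (a j)\<^sup>2"
      have Q: "?S / 2 \<le> (\<Sum>i<n. \<Sum>j<n. a i * a j * (\<theta> i \<bullet> \<theta> j) ^ l)" if l: "2 * N \<le> l" for l
      proof (rule power_form_ge[OF \<theta> e(1)])
        show "e \<le> dist (\<theta> i) (\<theta> j)" "e \<le> dist (- \<theta> i) (\<theta> j)" if "i < n" "j < n" "i \<noteq> j" for i j
          using sep(3,4)[OF that] by (simp_all add: e_def)
        have "real (5 * DIM('a) + 2) \<le> real N * e\<^sup>2" using Nge e by (simp add: field_simps)
        also have "\<dots> \<le> real l / 2 * e\<^sup>2" using l by (intro mult_right_mono) auto
        finally show "real (5 * DIM('a) + 2) \<le> real l * e\<^sup>2 / 2" by simp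
      qed
      have "e ^ (2 * m + 1) * c0 * (?S / 2)
          \<le> (sqrt N / 8 * ((1 / real (8 * N)) ^ (m + 1) / real (m + 1))) * (?S / 2)"
        using inverse_scale_bound[OF N1 e(1) B NB, of m]
        by (intro mult_right_mono) (auto simp: c0_def sum_nonneg)
      also have "\<dots> = ?S / 2 * (sqrt N / 8 * ((1 / real (8 * N)) ^ (m + 1) / real (m + 1)))"
        by (rule mult.commute)
      also have "\<dots> \<le> (\<Sum>i<n. \<Sum>j<n. a i * a j * ((\<theta> i \<bullet> \<theta> j) ^ s * ridge_profile m (\<theta> i \<bullet> \<theta> j)))"
      proof (rule ridge_profile_form_ge[OF _ power_form_nonneg Q N1])
        show "\<bar>\<theta> i \<bullet> \<theta> j\<bar> \<le> 1" if "i < n" "j < n" for i j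
          using Cauchy_Schwarz_ineq2[of "\<theta> i" "\<theta> j"] \<theta> that by simp
      qed (auto simp: sum_nonneg)
      finally have main: "e ^ (2 * m + 1) * c0 * (?S / 2)
        \<le> (\<Sum>i<n. \<Sum>j<n. a i * a j * ((\<theta> i \<bullet> \<theta> j) ^ s * ridge_profile m (\<theta> i \<bullet> \<theta> j)))" .
      have "tensor_form s m n \<theta> a
          = p / ridge_profile m 1 * (\<Sum>i<n. \<Sum>j<n. a i * a j * ((\<theta> i \<bullet> \<theta> j) ^ s * ridge_profile m (\<theta> i \<bullet> \<theta> j)))"
        unfolding tensor_form_def tensor_kernel_def sum_distrib_left
        by (intro sum.cong refl) (simp add: kern[OF \<theta> \<theta>])
      moreover have "p / ridge_profile m 1 * (e ^ (2 * m + 1) * c0 * (?S / 2)) = c * h ^ (2 * m + 1) * ?S"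
        by (simp add: c_def e_def power_divide)
      moreover have "p / ridge_profile m 1 * (e ^ (2 * m + 1) * c0 * (?S / 2)) \<le> p / ridge_profile m 1 *
          (\<Sum>i<n. \<Sum>j<n. a i * a j * ((\<theta> i \<bullet> \<theta> j) ^ s * ridge_profile m (\<theta> i \<bullet> \<theta> j)))"
        using p ridge_profile_1_pos[of m] by (intro mult_left_mono main) auto
      ultimately show ?thesis by (simp add: h_def)
    qed
  qed
qed

section \<open>Eigenvalues and condition numbers of symmetric matrices\<close>

lemma quadratic_form_add:
  fixes A :: "nat \<Rightarrow> nat \<Rightarrow> real"
  assumes sym: "\<And>i j. i < n \<Longrightarrow> j < n \<Longrightarrow> A i j = A j i"
  shows "(\<Sum>i<n. \<Sum>j<n. (v i + t * w i) * (v j + t * w j) * A i j) =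
    (\<Sum>i<n. \<Sum>j<n. v i * v j * A i j) + 2 * t * (\<Sum>i<n. w i * (\<Sum>j<n. A i j * v j))
     + t\<^sup>2 * (\<Sum>i<n. \<Sum>j<n. w i * w j * A i j)"
proof -
  have "(\<Sum>i<n. \<Sum>j<n. v i * w j * A i j) = (\<Sum>j<n. \<Sum>i<n. v i * w j * A i j)"
    by (rule sum.swap)
  also have "\<dots> = (\<Sum>i<n. \<Sum>j<n. w i * v j * A i j)"
    by (intro sum.cong refl) (use sym in \<open>auto simp: mult_ac\<close>)
  finally have sw: "(\<Sum>i<n. \<Sum>j<n. v i * w j * A i j) = (\<Sum>i<n. \<Sum>j<n. w i * v j * A i j)" .
  have "(\<Sum>i<n. \<Sum>j<n. (v i + t * w i) * (v j + t * w j) * A i j) =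
    (\<Sum>i<n. \<Sum>j<n. v i * v j * A i j) + t * (\<Sum>i<n. \<Sum>j<n. v i * w j * A i j)
    + t * (\<Sum>i<n. \<Sum>j<n. w i * v j * A i j) + t\<^sup>2 * (\<Sum>i<n. \<Sum>j<n. w i * w j * A i j)"
    by (simp add: sum_distrib_left flip: sum.distrib)
      (intro sum.cong refl, simp add: algebra_simps power2_eq_square)
  also have "(\<Sum>i<n. \<Sum>j<n. w i * v j * A i j) = (\<Sum>i<n. w i * (\<Sum>j<n. A i j * v j))"
    by (simp add: sum_distrib_left mult_ac)
  finally show ?thesis using sw \<open>_ = (\<Sum>i<n. w i * (\<Sum>j<n. A i j * v j))\<close>
    by (simp add: algebra_simps)
qed

lemma linear_le_quadratic_imp_zero:
  fixes S D :: real
  assumes "\<And>t. 0 \<le> 2 * t * S + t\<^sup>2 * D" and "S \<ge> 0"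
  shows "S = 0"
proof (rule ccontr)
  assume "S \<noteq> 0"
  then have S: "S > 0" using assms(2) by simp
  define t where "t = - S / (1 + \<bar>D\<bar>)"
  have t: "t < 0" using S by (simp add: t_def)
  have "\<bar>t * D\<bar> \<le> S" using S
    by (simp add: t_def abs_mult divide_simps)
  then have "2 * S + t * D > 0" using S by linarith
  then have "t * (2 * S + t * D) < 0" using t by (simp add: mult_neg_pos)
  then show False using assms(1)[of t] by (simp add: algebra_simps power2_eq_square)
qed

text \<open>A minimiser of the form on the unit sphere is an eigenvector. Only the extreme
  eigenvalues are estimated, so this replaces a full diagonalisation; applied to the negated matrix
  it also yields the maximum.\<close>

lemma rayleigh_minimizer:
  fixes A :: "nat \<Rightarrow> nat \<Rightarrow> real"
  assumes n: "n \<ge> 1" and sym: "\<And>i j. i < n \<Longrightarrow> j < n \<Longrightarrow> A i j = A j i"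
  obtains v l where "(\<Sum>i<n. (v i)\<^sup>2) = 1"
    and "\<And>i. i < n \<Longrightarrow> (\<Sum>j<n. A i j * v j) = l * v i"
    and "\<And>a. l * (\<Sum>i<n. (a i)\<^sup>2) \<le> (\<Sum>i<n. \<Sum>j<n. a i * a j * A i j)"
proof -
  define q where "q a = (\<Sum>i<n. \<Sum>j<n. a i * a j * A i j)" for a :: "nat \<Rightarrow> real"
  \<comment> \<open>Vectors are functions on all of \<open>nat\<close>; fixing the coordinates
    beyond \<open>n\<close> to 0 makes this box compact by Tychonoff's theorem.\<close>
  define P where "P = PiE UNIV (\<lambda>i::nat. if i < n then {-1..1} else {0::real})"
  define S where "S = P \<inter> {a. (\<Sum>i<n. (a i)\<^sup>2) = 1}"
  have "compactin (product_topology (\<lambda>i::nat. euclidean) UNIV) P"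
    unfolding P_def by (subst compactin_PiE) auto
  then have "compact P"
    by (simp add: euclidean_product_topology)
  moreover have "closed {a. (\<Sum>i<n. (a i :: real)\<^sup>2) = 1}"
    by (intro closed_Collect_eq continuous_intros continuous_on_product_coordinates)
  ultimately have "compact S"
    unfolding S_def by (rule compact_Int_closed)
  moreover have "(\<lambda>i. if i = 0 then 1 else 0) \<in> S"
    using n by (auto simp: S_def P_def power2_eq_square sum.delta if_distrib cong: if_cong)
  then have "S \<noteq> {}" by blast
  moreover have "continuous_on S q"
    unfolding q_def
    by (intro continuous_intros continuous_on_product_coordinates[THEN continuous_on_subset]) auto
  ultimately obtain v where v: "v \<in> S" and vmin: "\<And>a. a \<in> S \<Longrightarrow> q v \<le> q a"
    using continuous_attains_inf by metis
  define l where "l = q v"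
  have v1: "(\<Sum>i<n. (v i)\<^sup>2) = 1" using v by (simp add: S_def)
  have lb: "l * (\<Sum>i<n. (a i)\<^sup>2) \<le> q a" for a
  proof (cases "(\<Sum>i<n. (a i)\<^sup>2) = 0")
    case True
    then have "\<forall>i<n. a i = 0" by (subst (asm) sum_nonneg_eq_0_iff) auto
    then have "q a = 0" by (simp add: q_def)
    with True show ?thesis by simp
  next
    case False
    define N where "N = (\<Sum>i<n. (a i)\<^sup>2)"
    have N: "N > 0" using False unfolding N_def by (simp add: sum_nonneg order_less_le)
    define b where "b i = (if i < n then a i / sqrt N else 0)" for i
    have b1: "(\<Sum>i<n. (b i)\<^sup>2) = 1"
      using N by (simp add: b_def power_divide N_def flip: sum_divide_distrib)
    have "(b i)\<^sup>2 \<le> 1" if "i < n" for i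
      using member_le_sum[of i "{..<n}" "\<lambda>i. (b i)\<^sup>2"] that b1 by simp
    then have "b i \<in> {-1..1}" if "i < n" for i
      using that by (metis abs_le_iff abs_square_le_1 atLeastAtMost_iff minus_le_iff)
    then have "b \<in> S" using b1 by (auto simp: S_def P_def b_def)
    then have "l \<le> q b" unfolding l_def by (rule vmin)
    also have "q b = (\<Sum>i<n. \<Sum>j<n. a i * a j * A i j / N)"
      unfolding q_def b_def using N by (intro sum.cong refl) (simp add: field_simps)
    also have "\<dots> = q a / N"
      by (simp add: q_def flip: sum_divide_distrib)
    finally show ?thesis using N unfolding N_def[symmetric] by (simp add: field_simps)
  qed
  define r where "r i = (\<Sum>j<n. A i j * v j) - l * v i" for i
  \<comment> \<open>Perturbing the minimiser along its residual \<open>r\<close>: the terms in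
    \<open>v i * r i\<close> cancel between the form and \<open>l\<close> times the squared norm,
    and the first-order term that remains is the squared norm of \<open>r\<close>.\<close>
  have "0 \<le> 2 * t * (\<Sum>i<n. (r i)\<^sup>2) + t\<^sup>2 * (q r - l * (\<Sum>i<n. (r i)\<^sup>2))" for t
  proof -
    have "(\<Sum>i<n. (v i + t * r i)\<^sup>2) = 1 + 2 * t * (\<Sum>i<n. v i * r i) + t\<^sup>2 * (\<Sum>i<n. (r i)\<^sup>2)"
      by (simp add: power2_sum sum.distrib v1 sum_distrib_left power_mult_distrib mult_ac)
    moreover have "q (\<lambda>i. v i + t * r i) = l + 2 * t * (\<Sum>i<n. r i * (\<Sum>j<n. A i j * v j)) + t\<^sup>2 * q r"
      unfolding q_def l_def by (subst quadratic_form_add[OF sym]) (auto simp: q_def)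
    moreover have "(\<Sum>i<n. r i * (\<Sum>j<n. A i j * v j)) = (\<Sum>i<n. (r i)\<^sup>2) + l * (\<Sum>i<n. v i * r i)"
    proof -
      have "(\<Sum>i<n. r i * (\<Sum>j<n. A i j * v j)) = (\<Sum>i<n. (r i)\<^sup>2 + l * (v i * r i))"
        by (intro sum.cong refl) (simp add: r_def power2_eq_square algebra_simps)
      then show ?thesis by (simp add: sum.distrib sum_distrib_left)
    qed
    ultimately show ?thesis
      using lb[of "\<lambda>i. v i + t * r i"] by (simp add: algebra_simps)
  qed
  then have "(\<Sum>i<n. (r i)\<^sup>2) = 0"
    by (rule linear_le_quadratic_imp_zero) (simp add: sum_nonneg)
  then have "\<forall>i<n. r i = 0" by (subst (asm) sum_nonneg_eq_0_iff) auto
  then have "(\<Sum>j<n. A i j * v j) = l * v i" if "i < n" for i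
    using that by (simp add: r_def)
  then show thesis using that v1 lb unfolding q_def by blast
qed

text \<open>\<open>eigval_desc\<close> reads off the list of real roots, so its entries 1 and
  \<open>n\<close> make sense only once there are \<open>n\<close> real roots. Reality follows from
  the Hermitian form of a complex eigenvector.\<close>

lemma symmetric_char_poly_splits:
  fixes A :: "real mat"
  assumes A: "A \<in> carrier_mat n n" and sym: "\<And>i j. i < n \<Longrightarrow> j < n \<Longrightarrow> A $$ (i, j) = A $$ (j, i)"
  obtains rs where "char_poly A = (\<Prod>r\<leftarrow>rs. [:- r, 1:])" "length rs = n"
proof -
  define B where "B = map_mat complex_of_real A"
  have B: "B \<in> carrier_mat n n" using A by (simp add: B_def)
  obtain as where as: "char_poly B = (\<Prod>a\<leftarrow>as. [:- a, 1:])" "length as = n"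
    using char_poly_factorized[OF B] by blast
  have real: "a \<in> \<real>" if "a \<in> set as" for a
  proof -
    have "poly (char_poly B) a = 0" using that as(1)
      by (auto simp: poly_prod_list prod_list_zero_iff)
    then obtain v where "eigenvector B v a"
      using eigenvalue_root_char_poly[OF B] by (auto simp: eigenvalue_def)
    then have v: "v \<in> carrier_vec n" "v \<noteq> 0\<^sub>v n" "B *\<^sub>v v = a \<cdot>\<^sub>v v"
      using B by (auto simp: eigenvector_def)
    have Bv: "(\<Sum>j<n. of_real (A $$ (i, j)) * v $ j) = a * v $ i" if "i < n" for i
    proof -
      have "(B *\<^sub>v v) $ i = (a \<cdot>\<^sub>v v) $ i" using v by simp
      then show ?thesis using that A v
        by (simp add: B_def scalar_prod_def lessThan_atLeast0)
    qed
    \<comment> \<open>Symmetry makes \<open>q\<close> real, and the eigenvector equation makes it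
      \<open>a\<close> times the positive number \<open>N\<close>.\<close>
    define q where "q = (\<Sum>i<n. \<Sum>j<n. cnj (v $ i) * of_real (A $$ (i, j)) * v $ j)"
    define N where "N = (\<Sum>i<n. (cmod (v $ i))\<^sup>2)"
    have "q = (\<Sum>i<n. cnj (v $ i) * (\<Sum>j<n. of_real (A $$ (i, j)) * v $ j))"
      unfolding q_def by (simp add: sum_distrib_left mult_ac)
    also have "\<dots> = (\<Sum>i<n. a * of_real ((cmod (v $ i))\<^sup>2))"
      by (intro sum.cong refl) (simp add: Bv complex_norm_square del: of_real_power)
    finally have q: "q = a * of_real N"
      by (simp add: N_def sum_distrib_left)
    have "cnj q = (\<Sum>i<n. \<Sum>j<n. v $ i * of_real (A $$ (i, j)) * cnj (v $ j))"
      by (simp add: q_def)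
    also have "\<dots> = (\<Sum>j<n. \<Sum>i<n. v $ i * of_real (A $$ (i, j)) * cnj (v $ j))"
      by (rule sum.swap)
    also have "\<dots> = q" unfolding q_def
      by (intro sum.cong refl) (use sym in \<open>auto simp: mult_ac\<close>)
    finally have "q \<in> \<real>" using Reals_cnj_iff by blast
    moreover have "N \<noteq> 0"
    proof
      assume "N = 0"
      then have "\<forall>i<n. v $ i = 0" unfolding N_def by (subst (asm) sum_nonneg_eq_0_iff) auto
      then show False using v by auto
    qed
    moreover have "a = q / of_real N" using q \<open>N \<noteq> 0\<close> by simp
    ultimately show "a \<in> \<real>" by (metis Reals_divide Reals_of_real)
  qed
  interpret mp: map_poly_comm_ring_hom complex_of_real ..
  define rs where "rs = map Re as"
  have as_rs: "as = map complex_of_real rs"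
    unfolding rs_def using real by (auto simp: list_eq_iff_nth_eq)
  have "map_poly complex_of_real (char_poly A) = char_poly B"
    unfolding B_def by (rule of_real_hom.char_poly_hom[OF A, symmetric])
  also have "\<dots> = map_poly complex_of_real (\<Prod>r\<leftarrow>rs. [:- r, 1:])"
    unfolding as as_rs
  proof (induction rs)
    case (Cons r rs)
    have "map_poly complex_of_real ([:- r, 1:] * p)
        = [:- complex_of_real r, 1:] * map_poly complex_of_real p" for p
      by (simp only: mp.hom_mult) simp
    with Cons show ?case by (simp del: mult_pCons_left)
  qed simp
  finally have "char_poly A = (\<Prod>r\<leftarrow>rs. [:- r, 1:])"
    by (simp add: poly_eq_iff coeff_map_poly)
  moreover have "length rs = n" using as(2) by (simp add: rs_def)
  ultimately show thesis using that by blast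
qed

lemma sorted_rev_roots:
  fixes A :: "real mat"
  assumes A: "A \<in> carrier_mat n n" and sym: "\<And>i j. i < n \<Longrightarrow> j < n \<Longrightarrow> A $$ (i, j) = A $$ (j, i)"
    and n: "n \<ge> 1"
  shows "eigval_desc A n \<in> {x. eigenvalue A x}" "eigval_desc A 1 \<in> {x. eigenvalue A x}"
    and "eigenvalue A x \<Longrightarrow> eigval_desc A n \<le> x \<and> x \<le> eigval_desc A 1"
proof -
  obtain rs where rs: "char_poly A = (\<Prod>r\<leftarrow>rs. [:- r, 1:])" "length rs = n"
    using symmetric_char_poly_splits[OF A sym] by blast
  define L where "L = sorted_list_of_multiset (proots (char_poly A))"
  have "proots (char_poly A) = mset rs"
    unfolding rs(1)
  proof (induction rs)
    case (Cons r rs)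
    have "(\<Prod>r\<leftarrow>rs. [:- r, 1:]) \<noteq> 0" by (auto simp: prod_list_zero_iff)
    then show ?case using Cons by (simp add: proots_mult del: mult_pCons_left)
  qed simp
  then have mL: "mset L = mset rs" by (simp add: L_def)
  then have len: "length L = n" using rs(2) mset_eq_length by blast
  have setL: "set L = {x. eigenvalue A x}"
  proof -
    have "eigenvalue A x \<longleftrightarrow> x \<in> set rs" for x
      unfolding eigenvalue_root_char_poly[OF A] rs(1)
      by (simp add: poly_prod_list prod_list_zero_iff o_def) force
    then show ?thesis using mset_eq_setD[OF mL] by blast
  qed
  have sorted: "sorted L" by (simp add: L_def)
  \<comment> \<open>\<open>eigval_desc\<close> counts from 1 in the reversed list, so
    \<open>n\<close> picks the first entry of the ascending list and 1 the last.\<close>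
  have en: "eigval_desc A n = L ! 0" and e1: "eigval_desc A 1 = L ! (n - 1)"
    using n len by (simp_all add: eigval_desc_def rev_nth L_def[symmetric])
  have "L ! 0 \<in> set L" "L ! (n - 1) \<in> set L" using n len by (auto intro!: nth_mem)
  then show "eigval_desc A n \<in> {x. eigenvalue A x}" "eigval_desc A 1 \<in> {x. eigenvalue A x}"
    unfolding en e1 setL by blast+
  show "eigval_desc A n \<le> x \<and> x \<le> eigval_desc A 1" if "eigenvalue A x"
  proof -
    have "x \<in> set L" using that setL by blast
    then obtain i where "i < n" "x = L ! i" using len by (auto simp: in_set_conv_nth)
    then show ?thesis unfolding en e1 using sorted_nth_mono[OF sorted] len
      by (simp add: less_Suc_eq_le flip: Suc_le_eq)
  qed
qed

definition mat_form :: "real mat \<Rightarrow> nat \<Rightarrow> (nat \<Rightarrow> real) \<Rightarrow> real" where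
  "mat_form A n a = (\<Sum>i<n. \<Sum>j<n. a i * a j * A $$ (i, j))"

context
  fixes A :: "real mat" and n :: nat
  assumes A: "A \<in> carrier_mat n n"
    and sym: "\<And>i j. i < n \<Longrightarrow> j < n \<Longrightarrow> A $$ (i, j) = A $$ (j, i)"
    and n: "n \<ge> 1"
begin

lemma eigenvalueI:
  assumes "(\<Sum>i<n. (v i)\<^sup>2) = 1" "\<And>i. i < n \<Longrightarrow> (\<Sum>j<n. A $$ (i, j) * v j) = l * v i"
  shows "eigenvalue A l"
proof -
  have "Matrix.vec n v \<noteq> 0\<^sub>v n"
  proof
    assume *: "Matrix.vec n v = 0\<^sub>v n"
    have "v i = 0" if "i < n" for i
      using arg_cong[OF *, of "\<lambda>w. w $ i"] that by simp
    then show False using assms(1) by simp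
  qed
  moreover have "A *\<^sub>v Matrix.vec n v = l \<cdot>\<^sub>v Matrix.vec n v"
    using A assms(2) by (intro eq_vecI) (auto simp: scalar_prod_def lessThan_atLeast0)
  ultimately show ?thesis using A unfolding eigenvalue_def eigenvector_def
    by (intro exI[of _ "Matrix.vec n v"]) simp
qed

lemma eigenvalueD:
  assumes "eigenvalue A l"
  obtains v where "(\<Sum>i<n. (v i)\<^sup>2) > 0" "mat_form A n v = l * (\<Sum>i<n. (v i)\<^sup>2)"
proof -
  obtain w where w: "w \<in> carrier_vec n" "w \<noteq> 0\<^sub>v n" "A *\<^sub>v w = l \<cdot>\<^sub>v w"
    using assms A by (auto simp: eigenvalue_def eigenvector_def)
  define v where "v i = w $ i" for i
  have Av: "(\<Sum>j<n. A $$ (i, j) * v j) = l * v i" if "i < n" for i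
    using arg_cong[OF w(3), of "\<lambda>u. u $ i"] that A w(1)
    by (simp add: scalar_prod_def lessThan_atLeast0 v_def)
  have "(\<Sum>i<n. (v i)\<^sup>2) \<noteq> 0"
  proof
    assume "(\<Sum>i<n. (v i)\<^sup>2) = 0"
    then have "\<forall>i<n. w $ i = 0" unfolding v_def by (subst (asm) sum_nonneg_eq_0_iff) auto
    then show False using w by auto
  qed
  then have "(\<Sum>i<n. (v i)\<^sup>2) > 0" by (simp add: sum_nonneg order_less_le)
  have "mat_form A n v = (\<Sum>i<n. v i * (\<Sum>j<n. A $$ (i, j) * v j))"
    by (simp add: mat_form_def sum_distrib_left mult_ac)
  also have "\<dots> = (\<Sum>i<n. l * (v i)\<^sup>2)"
    by (intro sum.cong refl) (simp add: Av power2_eq_square)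
  also have "\<dots> = l * (\<Sum>i<n. (v i)\<^sup>2)"
    by (simp add: sum_distrib_left)
  finally have "mat_form A n v = l * (\<Sum>i<n. (v i)\<^sup>2)" .
  with \<open>_ > 0\<close> show thesis using that by blast
qed

lemma eigval_desc_last_ge:
  assumes "\<And>a. c * (\<Sum>i<n. (a i)\<^sup>2) \<le> mat_form A n a"
  shows "c \<le> eigval_desc A n"
proof -
  have "eigenvalue A (eigval_desc A n)"
    using sorted_rev_roots(1)[OF A sym n] by simp
  then obtain v where v: "(\<Sum>i<n. (v i)\<^sup>2) > 0"
      "mat_form A n v = eigval_desc A n * (\<Sum>i<n. (v i)\<^sup>2)"
    by (rule eigenvalueD)
  then have "c * (\<Sum>i<n. (v i)\<^sup>2) \<le> eigval_desc A n * (\<Sum>i<n. (v i)\<^sup>2)"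
    using assms[of v] by linarith
  with v(1) show ?thesis by (rule mult_right_le_imp_le[rotated])
qed

lemma eigval_desc_first_le:
  assumes "\<And>a. mat_form A n a \<le> c * (\<Sum>i<n. (a i)\<^sup>2)"
  shows "eigval_desc A 1 \<le> c"
proof -
  have "eigenvalue A (eigval_desc A 1)"
    using sorted_rev_roots(2)[OF A sym n] by simp
  then obtain v where v: "(\<Sum>i<n. (v i)\<^sup>2) > 0"
      "mat_form A n v = eigval_desc A 1 * (\<Sum>i<n. (v i)\<^sup>2)"
    by (rule eigenvalueD)
  then have "eigval_desc A 1 * (\<Sum>i<n. (v i)\<^sup>2) \<le> c * (\<Sum>i<n. (v i)\<^sup>2)"
    using assms[of v] by linarith
  with v(1) show ?thesis by (rule mult_right_le_imp_le[rotated])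
qed

text \<open>The Rayleigh minimum is itself an eigenvalue, hence at least the last one in descending
  order.\<close>

lemma eigval_desc_last_le: "eigval_desc A n * (\<Sum>i<n. (a i)\<^sup>2) \<le> mat_form A n a"
proof -
  obtain v l where "(\<Sum>i<n. (v i)\<^sup>2) = 1" "\<And>i. i < n \<Longrightarrow> (\<Sum>j<n. A $$ (i, j) * v j) = l * v i"
    and l: "\<And>a. l * (\<Sum>i<n. (a i)\<^sup>2) \<le> mat_form A n a"
    unfolding mat_form_def
    by (rule rayleigh_minimizer[OF n, of "\<lambda>i j. A $$ (i, j)"]) (use sym in blast, use that in blast)
  then have "eigval_desc A n \<le> l"
    using eigenvalueI sorted_rev_roots(3)[OF A sym n] by blast
  then have "eigval_desc A n * (\<Sum>i<n. (a i)\<^sup>2) \<le> l * (\<Sum>i<n. (a i)\<^sup>2)"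
    by (intro mult_right_mono sum_nonneg) auto
  then show ?thesis using l[of a] by linarith
qed

lemma eigval_desc_first_ge: "mat_form A n a \<le> eigval_desc A 1 * (\<Sum>i<n. (a i)\<^sup>2)"
proof -
  obtain v l where v: "(\<Sum>i<n. (v i)\<^sup>2) = 1" "\<And>i. i < n \<Longrightarrow> (\<Sum>j<n. - A $$ (i, j) * v j) = l * v i"
    and l: "\<And>a. l * (\<Sum>i<n. (a i)\<^sup>2) \<le> (\<Sum>i<n. \<Sum>j<n. a i * a j * - A $$ (i, j))"
    by (rule rayleigh_minimizer[OF n, of "\<lambda>i j. - A $$ (i, j)"]) (use sym in simp, use that in blast)
  have "(\<Sum>j<n. A $$ (i, j) * v j) = - l * v i" if "i < n" for i
    using v(2)[OF that] by (simp add: sum_negf)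
  then have "- l \<le> eigval_desc A 1"
    using eigenvalueI[OF v(1)] sorted_rev_roots(3)[OF A sym n] by blast
  then have "- l * (\<Sum>i<n. (a i)\<^sup>2) \<le> eigval_desc A 1 * (\<Sum>i<n. (a i)\<^sup>2)"
    by (intro mult_right_mono sum_nonneg) auto
  moreover have "mat_form A n a \<le> - l * (\<Sum>i<n. (a i)\<^sup>2)"
    using l[of a] by (simp add: mat_form_def sum_negf)
  ultimately show ?thesis by linarith
qed

end

section \<open>Spectral norms and the condition number\<close>

lemma euclidean_norm_vec_sum:
  assumes "v \<in> carrier_vec n"
  shows "euclidean_norm_vec v = sqrt (\<Sum>i<n. (v $ i)\<^sup>2)"
  using assms by (simp add: euclidean_norm_vec_def scalar_prod_def lessThan_atLeast0 power2_eq_square)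

text \<open>The a priori bound \<open>c\<close> is what makes the real-valued \<open>SUP\<close> a
  genuine supremum.\<close>

lemma spectral_norm_bounds:
  assumes A: "A \<in> carrier_mat n n" and n: "n \<ge> 1"
    and c: "\<And>v. v \<in> carrier_vec n \<Longrightarrow> euclidean_norm_vec v = 1 \<Longrightarrow> euclidean_norm_vec (A *\<^sub>v v) \<le> c"
  shows "spectral_norm A \<le> c"
    and "v \<in> carrier_vec n \<Longrightarrow> euclidean_norm_vec v = 1 \<Longrightarrow> euclidean_norm_vec (A *\<^sub>v v) \<le> spectral_norm A"
proof -
  let ?S = "{v \<in> carrier_vec (dim_col A). euclidean_norm_vec v = 1}"
  have "(\<Sum>i<n. (unit_vec n 0 $ i :: real)\<^sup>2) = (\<Sum>i<n. if i = 0 then 1 else 0)"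
    by (intro sum.cong) auto
  then have "unit_vec n 0 \<in> ?S"
    using A n by (auto simp: euclidean_norm_vec_sum[of _ n])
  then have "?S \<noteq> {}" by blast
  then show "spectral_norm A \<le> c"
    unfolding spectral_norm_def using A c by (intro cSUP_least) simp_all
  show "v \<in> carrier_vec n \<Longrightarrow> euclidean_norm_vec v = 1 \<Longrightarrow> euclidean_norm_vec (A *\<^sub>v v) \<le> spectral_norm A"
    unfolding spectral_norm_def using A c by (intro cSUP_upper bdd_aboveI2[where M=c]) auto
qed

text \<open>Bounds the two norms directly, without singular values. From above: entries at most
  \<open>E\<close> give \<open>E * n\<close> for \<open>A\<close>, and coercivity gives
  \<open>1 / \<alpha>\<close> for the inverse. From below: \<open>b\<close> tests \<open>A\<close>
  and \<open>a\<close> tests the inverse.\<close>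

lemma cond_number_bounds:
  fixes A :: "real mat"
  assumes A: "A \<in> carrier_mat n n"
    and sym: "\<And>i j. i < n \<Longrightarrow> j < n \<Longrightarrow> A $$ (i, j) = A $$ (j, i)"
    and n: "n \<ge> 1" and \<alpha>: "\<alpha> > 0"
    and lower: "\<And>a. \<alpha> * (\<Sum>i<n. (a i)\<^sup>2) \<le> mat_form A n a"
    and entries: "\<And>i j. i < n \<Longrightarrow> j < n \<Longrightarrow> \<bar>A $$ (i, j)\<bar> \<le> E"
    and a: "(\<Sum>i<n. (a i)\<^sup>2) = 1" and b: "(\<Sum>i<n. (b i)\<^sup>2) = 1"
  shows "invertible_mat A" and "cond_number A \<le> E * n / \<alpha>"
    and "mat_form A n b / mat_form A n a \<le> cond_number A"
proof -
  have form: "mat_form A n (($) v) = (\<Sum>i<n. v $ i * (A *\<^sub>v v) $ i)" if "v \<in> carrier_vec n" for v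
    using that A by (simp add: mat_form_def scalar_prod_def lessThan_atLeast0 sum_distrib_left mult_ac)
  have "\<bar>A $$ (0, 0)\<bar> \<le> E" using entries n by simp
  then have E: "E \<ge> 0" by linarith
  have "det A \<noteq> 0"
  proof
    assume "det A = 0"
    then obtain v where v: "v \<in> carrier_vec n" "v \<noteq> 0\<^sub>v n" "A *\<^sub>v v = 0\<^sub>v n"
      using det_0_iff_vec_prod_zero_field[OF A] by blast
    have "\<alpha> * (\<Sum>i<n. (v $ i)\<^sup>2) \<le> 0"
      using lower[of "($) v"] form[OF v(1)] v(3) by simp
    then have "(\<Sum>i<n. (v $ i)\<^sup>2) \<le> 0" using \<alpha> by (simp add: mult_le_0_iff)
    then have "(\<Sum>i<n. (v $ i)\<^sup>2) = 0" by (simp add: order_antisym sum_nonneg)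
    then have "\<forall>i<n. v $ i = 0" by (subst (asm) sum_nonneg_eq_0_iff) auto
    then show False using v by auto
  qed
  \<comment> \<open>A nonzero determinant ensures that \<open>the (mat_inverse A)\<close> in
    \<open>cond_number\<close> is the actual inverse.\<close>
  then have "mat_inverse A \<noteq> None"
    using det_non_zero_imp_unit[OF A, where b="()"] mat_inverse(1)[OF A, where b="()"] by blast
  then obtain B where B: "mat_inverse A = Some B" by blast
  have AB: "A * B = 1\<^sub>m n" "B * A = 1\<^sub>m n" and Bc: "B \<in> carrier_mat n n"
    using mat_inverse(2)[OF A B] by auto
  show "invertible_mat A"
    unfolding invertible_mat_def inverts_mat_def using A AB Bc by auto
  have inv: "A *\<^sub>v (B *\<^sub>v v) = v" if "v \<in> carrier_vec n" for v
    using that AB A Bc by (metis assoc_mult_mat_vec one_mult_mat_vec)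
  have upA: "euclidean_norm_vec (A *\<^sub>v v) \<le> E * n" if v: "v \<in> carrier_vec n" "euclidean_norm_vec v = 1" for v
  proof -
    have v1: "(\<Sum>i<n. (v $ i)\<^sup>2) = 1" using v euclidean_norm_vec_sum[of v n] by simp
    have "((A *\<^sub>v v) $ i)\<^sup>2 \<le> n * E\<^sup>2" if i: "i < n" for i
    proof -
      have "((A *\<^sub>v v) $ i)\<^sup>2 = (\<Sum>j<n. A $$ (i, j) * v $ j)\<^sup>2"
        using A v i by (simp add: scalar_prod_def lessThan_atLeast0)
      also have "\<dots> \<le> (\<Sum>j<n. (A $$ (i, j))\<^sup>2) * (\<Sum>j<n. (v $ j)\<^sup>2)"
        by (rule Cauchy_Schwarz_ineq_sum)
      also have "\<dots> \<le> (\<Sum>j<n. E\<^sup>2)" unfolding v1 mult_1_right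
        using entries[OF i] E by (intro sum_mono) (simp add: abs_le_square_iff[symmetric])
      finally show ?thesis by simp
    qed
    then have "(\<Sum>i<n. ((A *\<^sub>v v) $ i)\<^sup>2) \<le> (\<Sum>i<n. n * E\<^sup>2)" by (intro sum_mono) simp
    also have "\<dots> = (E * n)\<^sup>2" by (simp add: power2_eq_square)
    finally show ?thesis using E A v
      by (subst euclidean_norm_vec_sum[of _ n]) (auto intro!: real_le_lsqrt sum_nonneg)
  qed
  have CS: "(\<Sum>i<n. x i * y i) \<le> sqrt (\<Sum>i<n. (x i)\<^sup>2) * sqrt (\<Sum>i<n. (y i)\<^sup>2)" for x y :: "nat \<Rightarrow> real"
    using Cauchy_Schwarz_ineq_sum[of x y "{..<n}"]
    by (simp add: real_sqrt_mult[symmetric] real_le_rsqrt)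
  have upB: "euclidean_norm_vec (B *\<^sub>v v) \<le> 1 / \<alpha>" if v: "v \<in> carrier_vec n" "euclidean_norm_vec v = 1" for v
  proof -
    define w where "w = B *\<^sub>v v"
    have w: "w \<in> carrier_vec n" using Bc v by (simp add: w_def)
    have v1: "(\<Sum>i<n. (v $ i)\<^sup>2) = 1" using v euclidean_norm_vec_sum[of v n] by simp
    let ?N = "euclidean_norm_vec w"
    have N: "?N \<ge> 0" "(\<Sum>i<n. (w $ i)\<^sup>2) = ?N\<^sup>2"
      using euclidean_norm_vec_sum[OF w] by (simp_all add: sum_nonneg)
    have "\<alpha> * ?N\<^sup>2 \<le> (\<Sum>i<n. w $ i * v $ i)"
      using lower[of "($) w"] form[OF w] inv[OF v(1)] N by (simp add: w_def)
    also have "\<dots> \<le> ?N" using CS[of "($) w" "($) v"] v1 euclidean_norm_vec_sum[OF w] by simp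
    finally have "\<alpha> * ?N * ?N \<le> 1 * ?N" by (simp add: power2_eq_square)
    then have "\<alpha> * ?N \<le> 1"
      using N(1) mult_right_le_imp_le[of "\<alpha> * ?N" ?N 1] by (cases "?N = 0") auto
    then show ?thesis using \<alpha> by (simp add: w_def field_simps)
  qed
  have posA: "spectral_norm A \<ge> 0" and posB: "spectral_norm B \<ge> 0"
  proof -
    define u where "u = Matrix.vec n a"
    have u: "u \<in> carrier_vec n" "euclidean_norm_vec u = 1"
      using a by (simp_all add: u_def euclidean_norm_vec_sum[of _ n])
    have nn: "euclidean_norm_vec (M *\<^sub>v u) \<ge> 0" if "M \<in> carrier_mat n n" for M
      using that u by (subst euclidean_norm_vec_sum[of _ n]) (auto simp: sum_nonneg)
    show "spectral_norm A \<ge> 0" "spectral_norm B \<ge> 0"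
      using spectral_norm_bounds(2)[OF A n upA u] spectral_norm_bounds(2)[OF Bc n upB u] nn[OF A] nn[OF Bc]
      by linarith+
  qed
  have cn: "cond_number A = spectral_norm A * spectral_norm B"
    by (simp add: cond_number_def B)
  have "cond_number A \<le> (E * n) * (1 / \<alpha>)"
    unfolding cn using spectral_norm_bounds(1)[OF A n upA] spectral_norm_bounds(1)[OF Bc n upB] posA posB
    by (intro mult_mono) auto
  then show "cond_number A \<le> E * n / \<alpha>" by simp
  have lowA: "mat_form A n b \<le> spectral_norm A"
  proof -
    define v where "v = Matrix.vec n b"
    have v: "v \<in> carrier_vec n" "euclidean_norm_vec v = 1"
      using b by (simp_all add: v_def euclidean_norm_vec_sum[of _ n])
    have "mat_form A n b = mat_form A n (($) v)"
      by (simp add: mat_form_def v_def)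
    also have "\<dots> = (\<Sum>i<n. v $ i * (A *\<^sub>v v) $ i)" by (rule form[OF v(1)])
    also have "\<dots> \<le> euclidean_norm_vec v * euclidean_norm_vec (A *\<^sub>v v)"
      using CS[of "($) v" "($) (A *\<^sub>v v)"] v A by (simp add: euclidean_norm_vec_sum[of _ n])
    also have "\<dots> \<le> spectral_norm A"
      using spectral_norm_bounds(2)[OF A n upA v] v by simp
    finally show ?thesis .
  qed
  have fa: "mat_form A n a > 0" using lower[of a] a \<alpha> by simp
  have lowB: "1 / mat_form A n a \<le> spectral_norm B"
  proof -
    define u where "u = Matrix.vec n a"
    have u: "u \<in> carrier_vec n" "euclidean_norm_vec u = 1"
      using a by (simp_all add: u_def euclidean_norm_vec_sum[of _ n])
    define w where "w = B *\<^sub>v u"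
    have w: "w \<in> carrier_vec n" using Bc u by (simp add: w_def)
    have Aw: "A *\<^sub>v w = u" unfolding w_def by (rule inv[OF u(1)])
    define f where "f = mat_form A n (($) w)"
    have fw: "f = (\<Sum>i<n. w $ i * u $ i)" unfolding f_def form[OF w] Aw ..
    also have "\<dots> \<le> euclidean_norm_vec w"
      using CS[of "($) w" "($) u"] u w by (simp add: euclidean_norm_vec_sum[of _ n])
    also have "\<dots> \<le> spectral_norm B"
      unfolding w_def by (rule spectral_norm_bounds(2)[OF Bc n upB u])
    finally have fB: "f \<le> spectral_norm B" .
    have uAw: "(\<Sum>i<n. a i * (\<Sum>j<n. A $$ (i, j) * w $ j)) = 1"
    proof -
      have "(\<Sum>j<n. A $$ (i, j) * w $ j) = a i" if "i < n" for i
        using arg_cong[OF Aw, of "\<lambda>x. Matrix.vec_index x i"] that A w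
        by (simp add: u_def scalar_prod_def lessThan_atLeast0)
      then show ?thesis using a by (simp add: power2_eq_square)
    qed
    \<comment> \<open>A nonnegative quadratic in \<open>t\<close>; at its minimiser
      \<open>- 1 / mat_form A n a\<close> it becomes Cauchy-Schwarz for the inner product given by
      \<open>A\<close>, namely \<open>1 \<le> f * mat_form A n a\<close>.\<close>
    have quad: "0 \<le> f + 2 * t + t\<^sup>2 * mat_form A n a" for t
    proof -
      have "0 \<le> mat_form A n (\<lambda>i. w $ i + t * a i)"
        using lower[of "\<lambda>i. w $ i + t * a i"] \<alpha>
        by (meson order_trans mult_nonneg_nonneg less_imp_le sum_nonneg zero_le_power2)
      also have "\<dots> = f + 2 * t * 1 + t\<^sup>2 * mat_form A n a"
        unfolding mat_form_def f_def
        by (subst quadratic_form_add) (use sym uAw in auto)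
      finally show ?thesis by simp
    qed
    have "0 \<le> f + 2 * (- 1 / mat_form A n a) + (- 1 / mat_form A n a)\<^sup>2 * mat_form A n a"
      by (rule quad)
    then have "1 / mat_form A n a \<le> f" using fa by (simp add: power2_eq_square)
    with fB show ?thesis by linarith
  qed
  show "mat_form A n b / mat_form A n a \<le> cond_number A"
  proof -
    have "mat_form A n b * (1 / mat_form A n a) \<le> spectral_norm A * spectral_norm B"
      using lowA lowB posA fa by (intro mult_mono) auto
    then show ?thesis by (simp add: cn)
  qed
qed

section \<open>Mass and stiffness matrices\<close>

definition kernel_matrix :: "real \<Rightarrow> nat \<Rightarrow> nat \<Rightarrow> nat \<Rightarrow> (nat \<Rightarrow> 'a::euclidean_space) \<Rightarrow> real mat" where
  "kernel_matrix \<gamma> s m n \<theta> = mat n n (\<lambda>(i, j). \<gamma> * tensor_kernel s m (\<theta> i) (\<theta> j))"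

lemma mass_matrix_eq_kernel_matrix: "mass_matrix k n \<theta> = kernel_matrix 1 0 k n \<theta>"
  by (simp add: mass_matrix_def kernel_matrix_def tensor_kernel_def ridge_kernel_def)

lemma stiffness_matrix_eq_kernel_matrix:
  assumes "s \<le> k" "\<And>j. j < n \<Longrightarrow> norm (\<theta> j) = 1"
  shows "stiffness_matrix s k n \<theta> = kernel_matrix ((fact k / fact (k - s))\<^sup>2) s (k - s) n \<theta>"
  unfolding stiffness_matrix_def kernel_matrix_def tensor_kernel_def
  using stiffness_entry[OF assms(1) assms(2) assms(2)] by (intro cong_mat) auto

lemma kernel_matrix_props:
  fixes \<theta> :: "nat \<Rightarrow> 'a::euclidean_space"
  shows "kernel_matrix \<gamma> s m n \<theta> \<in> carrier_mat n n"
    and "i < n \<Longrightarrow> j < n \<Longrightarrow> kernel_matrix \<gamma> s m n \<theta> $$ (i, j) = \<gamma> * tensor_kernel s m (\<theta> i) (\<theta> j)"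
    and "i < n \<Longrightarrow> j < n \<Longrightarrow> kernel_matrix \<gamma> s m n \<theta> $$ (i, j) = kernel_matrix \<gamma> s m n \<theta> $$ (j, i)"
    and "mat_form (kernel_matrix \<gamma> s m n \<theta>) n a = \<gamma> * tensor_form s m n \<theta> a"
  by (auto simp: kernel_matrix_def mat_form_def tensor_form_def sum_distrib_left tensor_kernel_commute
      mult_ac intro!: sum.cong)

lemma tensor_form_le:
  fixes \<theta> :: "nat \<Rightarrow> 'a::euclidean_space"
  assumes \<theta>: "\<And>j. j < n \<Longrightarrow> norm (\<theta> j) = 1"
  shows "tensor_form s m n \<theta> a \<le> real n * (\<Sum>j<n. (a j)\<^sup>2)"
proof -
  have "tensor_form s m n \<theta> a \<le> (\<Sum>i<n. \<Sum>j<n. \<bar>a i\<bar> * \<bar>a j\<bar>)"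
    unfolding tensor_form_def
  proof (intro sum_mono)
    fix i j assume "i \<in> {..<n}" "j \<in> {..<n}"
    then have "\<bar>tensor_kernel s m (\<theta> i) (\<theta> j)\<bar> \<le> 1" using \<theta> by (intro abs_tensor_kernel_le) auto
    then have "\<bar>a i * a j\<bar> * \<bar>tensor_kernel s m (\<theta> i) (\<theta> j)\<bar> \<le> \<bar>a i * a j\<bar> * 1"
      by (intro mult_left_mono) auto
    then show "a i * a j * tensor_kernel s m (\<theta> i) (\<theta> j) \<le> \<bar>a i\<bar> * \<bar>a j\<bar>"
      by (simp add: abs_mult[symmetric])
  qed
  also have "\<dots> = (\<Sum>j<n. 1 * \<bar>a j\<bar>)\<^sup>2" by (simp add: power2_eq_square sum_product)
  also have "\<dots> \<le> (\<Sum>j<n. 1\<^sup>2) * (\<Sum>j<n. \<bar>a j\<bar>\<^sup>2)" by (rule Cauchy_Schwarz_ineq_sum)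
  finally show ?thesis by simp
qed

lemma tensor_form_ones_ge:
  assumes D: "DIM('a::euclidean_space) \<ge> 2"
  shows "\<exists>c>0. \<forall>n. \<forall>\<theta> :: nat \<Rightarrow> 'a. (\<forall>j<n. norm (\<theta> j) = 1) \<longrightarrow>
    c * (real n)\<^sup>2 \<le> tensor_form s m n \<theta> (\<lambda>_. 1)"
proof -
  obtain u :: 'a where "u \<in> Basis" using nonempty_Basis by blast
  then have u: "norm u = 1" by simp
  define p where "p = (LINT w|sphere_measure. relu_pow (m + s) (u \<bullet> w))"
  have "0 < p" unfolding p_def by (rule relu_moment_pos[OF D u])
  moreover have "p\<^sup>2 * (real n)\<^sup>2 \<le> tensor_form s m n \<theta> (\<lambda>_. 1)"
    if \<theta>: "\<forall>j<n. norm (\<theta> j) = 1" for n and \<theta> :: "nat \<Rightarrow> 'a"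
  proof -
    have "(real n * p)\<^sup>2 \<le> (\<Sum>i<n. \<Sum>j<n. tensor_kernel s m (\<theta> i) (\<theta> j))"
      unfolding p_def using \<theta> by (intro tensor_kernel_sum_ge relu_moment_const[OF D _ u]) auto
    then show ?thesis by (simp add: tensor_form_def power_mult_distrib mult.commute)
  qed
  ultimately show ?thesis by (intro exI[of _ "p\<^sup>2"]) auto
qed

lemma tensor_form_scale: "tensor_form s m n \<theta> (\<lambda>_. r) = r\<^sup>2 * tensor_form s m n \<theta> (\<lambda>_. 1)"
  by (simp add: tensor_form_def sum_distrib_left power2_eq_square)

text \<open>Counting points controls the \<open>d\<close>-th powers of the two distances, while the
  eigenvalue bounds involve the power \<open>2 * m + 1\<close>.\<close>

lemma power_le_powr:
  fixes x y :: real
  assumes "0 < x" "x ^ d \<le> y" "d \<ge> 1"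
  shows "x ^ q \<le> y powr (real q / real d)"
proof -
  have "x ^ q = (x ^ d) powr (real q / real d)"
    using assms by (simp add: powr_realpow[symmetric] powr_powr)
  also have "\<dots> \<le> y powr (real q / real d)" using assms by (intro powr_mono2) auto
  finally show ?thesis .
qed

text \<open>The estimates are claimed for every \<open>C \<ge> C0\<close> so that the constants of
  the mass and the stiffness matrix can be merged by taking their maximum.\<close>

lemma kernel_matrix_eigenvalue_bounds:
  assumes D: "DIM('a::euclidean_space) = d + 1" "d \<ge> 1" and \<gamma>: "0 < \<gamma>"
  shows "\<exists>C0>0. \<forall>C\<ge>C0. \<forall>n\<ge>2. \<forall>\<theta> :: nat \<Rightarrow> 'a. (\<forall>j<n. norm (\<theta> j) = 1) \<longrightarrow>
    (let h = mesh_size n \<theta>; h' = antipodal_sep n \<theta>; A = kernel_matrix \<gamma> s m n \<theta>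
     in 1 / h ^ d \<le> C * eigval_desc A 1 \<and>
        ereal (eigval_desc A 1) \<le> ereal C * inverse (ereal h') ^ d \<and>
        h' ^ (2 * m + 1) \<le> C * eigval_desc A n \<and>
        eigval_desc A n \<le> C * h ^ (2 * m + 1))"
proof -
  have D2: "DIM('a) \<ge> 2" using D by simp
  obtain c1 where c1: "0 < c1" and ones: "\<forall>n. \<forall>\<theta> :: nat \<Rightarrow> 'a. (\<forall>j<n. norm (\<theta> j) = 1) \<longrightarrow>
      c1 * (real n)\<^sup>2 \<le> tensor_form s m n \<theta> (\<lambda>_. 1)"
    using tensor_form_ones_ge[OF D2] by blast
  obtain c2 where c2: "0 < c2" and small: "\<forall>n\<ge>2. \<forall>\<theta> :: nat \<Rightarrow> 'a. (\<forall>j<n. norm (\<theta> j) = 1) \<longrightarrow>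
      (\<exists>a. (\<Sum>j<n. (a j)\<^sup>2) = 1 \<and> tensor_form s m n \<theta> a \<le> c2 * mesh_size n \<theta> ^ (2 * m + 1))"
    using tensor_form_min_le[OF D] by blast
  obtain c3 where c3: "0 < c3" and low: "\<forall>n\<ge>2. \<forall>\<theta> :: nat \<Rightarrow> 'a. (\<forall>j<n. norm (\<theta> j) = 1) \<longrightarrow>
      (\<forall>a. c3 * antipodal_sep n \<theta> ^ (2 * m + 1) * (\<Sum>j<n. (a j)\<^sup>2) \<le> tensor_form s m n \<theta> a)"
    using tensor_form_ge[OF D] by blast
  have K0: "0 < real ((d + 1) * 12 ^ (d + 1))"
    unfolding of_nat_0_less_iff by (intro mult_pos_pos zero_less_power) simp_all
  define K where "K = real ((d + 1) * 12 ^ (d + 1))"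
  \<comment> \<open>One positive summand for each of the four estimates, so that \<open>C0\<close>
    dominates all of them.\<close>
  define C0 where "C0 = 2 ^ (d + 1) / (\<gamma> * c1) + \<gamma> * K + 1 / (\<gamma> * c3) + \<gamma> * c2"
  have parts: "0 < 2 ^ (d + 1) / (\<gamma> * c1)" "0 < \<gamma> * K" "0 < 1 / (\<gamma> * c3)" "0 < \<gamma> * c2"
    unfolding K_def using \<gamma> c1 c2 c3 K0
    by (auto intro!: mult_pos_pos divide_pos_pos simp del: of_nat_mult of_nat_power of_nat_add)
  show ?thesis unfolding Let_def
  proof (intro exI[of _ C0] conjI allI impI)
    show "0 < C0" unfolding C0_def by (intro add_pos_pos parts)
    fix C n and \<theta> :: "nat \<Rightarrow> 'a"
    assume C: "C0 \<le> C" and n: "2 \<le> (n::nat)" and \<theta>': "\<forall>j<n. norm (\<theta> j) = 1"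
    then have \<theta>: "\<And>j. j < n \<Longrightarrow> norm (\<theta> j) = 1" by blast
    have Cs: "2 ^ (d + 1) / (\<gamma> * c1) \<le> C" "\<gamma> * K \<le> C" "1 / (\<gamma> * c3) \<le> C" "\<gamma> * c2 \<le> C"
      using C parts unfolding C0_def by linarith+
    define A where "A = kernel_matrix \<gamma> s m n \<theta>"
    note A = kernel_matrix_props(1)[of \<gamma> s m n \<theta>, folded A_def]
    note sym = kernel_matrix_props(3)[of _ n _ \<gamma> s m \<theta>, folded A_def]
    note form = kernel_matrix_props(4)[of \<gamma> s m n \<theta>, folded A_def]
    have n1: "1 \<le> n" and n0: "0 < real n" using n by simp_all
    have h: "0 < mesh_size n \<theta>" "1 / mesh_size n \<theta> ^ d \<le> real n * 2 ^ (d + 1)"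
      by (rule card_ge_mesh_size(1)[OF \<theta> n D], assumption, rule card_ge_mesh_size(2)[OF \<theta> n D], assumption)
    have h': "0 \<le> antipodal_sep n \<theta>" by (rule antipodal_sep_bounds(1)[OF \<theta> n])
    have l1: "\<gamma> * c1 * real n \<le> eigval_desc A 1"
    proof -
      have "\<gamma> * (c1 * (real n)\<^sup>2) \<le> mat_form A n (\<lambda>_. 1)"
        unfolding form using \<gamma> ones[THEN spec, THEN spec, THEN mp, OF \<theta>'] by (intro mult_left_mono) auto
      also have "\<dots> \<le> eigval_desc A 1 * real n"
        using eigval_desc_first_ge[OF A sym n1, of "\<lambda>_. 1"] by simp
      finally have "(\<gamma> * c1 * real n) * real n \<le> eigval_desc A 1 * real n"
        by (simp add: power2_eq_square mult.assoc)
      then show ?thesis using n0 by simp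
    qed
    have l1_pos: "0 \<le> eigval_desc A 1"
      using l1 \<gamma> c1 n0 by (meson mult_nonneg_nonneg less_imp_le order_trans)
    show "1 / mesh_size n \<theta> ^ d \<le> C * eigval_desc (kernel_matrix \<gamma> s m n \<theta>) 1"
    proof -
      have "real n * 2 ^ (d + 1) = 2 ^ (d + 1) / (\<gamma> * c1) * (\<gamma> * c1 * real n)"
        using \<gamma> c1 by simp
      also have "\<dots> \<le> 2 ^ (d + 1) / (\<gamma> * c1) * eigval_desc A 1"
        using l1 parts(1) by (intro mult_left_mono) auto
      also have "\<dots> \<le> C * eigval_desc A 1" using Cs(1) l1_pos by (intro mult_right_mono) auto
      finally show ?thesis using h(2) by (simp add: A_def)
    qed
    have l1_le: "eigval_desc A 1 \<le> \<gamma> * real n"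
    proof (rule eigval_desc_first_le[OF A sym n1])
      show "mat_form A n a \<le> \<gamma> * real n * (\<Sum>i<n. (a i)\<^sup>2)" for a
        unfolding form mult.assoc using \<gamma> tensor_form_le[OF \<theta>] by (intro mult_left_mono) auto
    qed
    show "ereal (eigval_desc (kernel_matrix \<gamma> s m n \<theta>) 1) \<le> ereal C * inverse (ereal (antipodal_sep n \<theta>)) ^ d"
    proof (cases "antipodal_sep n \<theta> = 0")
      \<comment> \<open>In \<open>ereal\<close>, \<open>inverse 0\<close> is infinite, and so is its
        \<open>d\<close>-th power because \<open>d \<ge> 1\<close>; for \<open>C > 0\<close> the
        right-hand side is infinite.\<close>
      case True
      have "0 < C" using Cs(4) parts(4) by linarith
      then show ?thesis using True D(2) by (simp add: zero_ereal_def[symmetric] ereal_mult_infty)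
    next
      case False
      then have pos: "0 < antipodal_sep n \<theta>" using h' by simp
      have "real n * antipodal_sep n \<theta> ^ d \<le> K"
        unfolding K_def by (rule card_le_antipodal_sep[OF \<theta> n D(1) pos])
      then have "\<gamma> * real n \<le> \<gamma> * K / antipodal_sep n \<theta> ^ d"
        using \<gamma> pos by (simp add: field_simps)
      also have "\<dots> \<le> C / antipodal_sep n \<theta> ^ d" using Cs(2) pos by (intro divide_right_mono) auto
      finally have "eigval_desc A 1 \<le> C * (1 / antipodal_sep n \<theta>) ^ d"
        using l1_le by (simp add: power_divide)
      then show ?thesis using pos
        by (simp add: A_def inverse_eq_divide)
    qed
    have ln: "\<gamma> * (c3 * antipodal_sep n \<theta> ^ (2 * m + 1)) \<le> eigval_desc A n"
    proof (rule eigval_desc_last_ge[OF A sym n1])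
      show "\<gamma> * (c3 * antipodal_sep n \<theta> ^ (2 * m + 1)) * (\<Sum>i<n. (a i)\<^sup>2) \<le> mat_form A n a" for a
        unfolding form mult.assoc[of \<gamma>] using \<gamma> low[THEN spec, THEN mp, OF n, THEN spec, THEN mp, OF \<theta>', THEN spec] by (intro mult_left_mono) auto
    qed
    have ln_pos: "0 \<le> eigval_desc A n"
      using ln \<gamma> c3 h' by (meson mult_nonneg_nonneg less_imp_le order_trans zero_le_power)
    show "antipodal_sep n \<theta> ^ (2 * m + 1) \<le> C * eigval_desc (kernel_matrix \<gamma> s m n \<theta>) n"
    proof -
      have "antipodal_sep n \<theta> ^ (2 * m + 1) = 1 / (\<gamma> * c3) * (\<gamma> * (c3 * antipodal_sep n \<theta> ^ (2 * m + 1)))"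
        using \<gamma> c3 by simp
      also have "\<dots> \<le> 1 / (\<gamma> * c3) * eigval_desc A n" using ln parts(3) by (intro mult_left_mono) auto
      also have "\<dots> \<le> C * eigval_desc A n" using Cs(3) ln_pos by (intro mult_right_mono) auto
      finally show ?thesis by (simp add: A_def)
    qed
    show "eigval_desc (kernel_matrix \<gamma> s m n \<theta>) n \<le> C * mesh_size n \<theta> ^ (2 * m + 1)"
    proof -
      obtain a where a: "(\<Sum>j<n. (a j)\<^sup>2) = 1" "tensor_form s m n \<theta> a \<le> c2 * mesh_size n \<theta> ^ (2 * m + 1)"
        using small[THEN spec, THEN mp, OF n, THEN spec, THEN mp, OF \<theta>'] by blast
      have "eigval_desc A n \<le> mat_form A n a"
        using eigval_desc_last_le[OF A sym n1, of a] a(1) by simp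
      also have "\<dots> \<le> \<gamma> * (c2 * mesh_size n \<theta> ^ (2 * m + 1))"
        unfolding form using \<gamma> a(2) by (intro mult_left_mono) auto
      also have "\<dots> = \<gamma> * c2 * mesh_size n \<theta> ^ (2 * m + 1)" by simp
      also have "\<dots> \<le> C * mesh_size n \<theta> ^ (2 * m + 1)"
        using Cs(4) h(1) by (intro mult_right_mono) auto
      finally show ?thesis by (simp add: A_def)
    qed
  qed
qed

text \<open>The norm of \<open>A\<close> contributes \<open>n\<close>, and the norm of its inverse
  contributes \<open>n\<close> to the power \<open>(2 * m + 1) / d\<close>.\<close>

lemma kernel_matrix_cond_bounds:
  assumes D: "DIM('a::euclidean_space) = d + 1" "d \<ge> 1" and \<gamma>: "0 < \<gamma>" and B: "0 < B"
  shows "\<exists>C0>0. \<forall>C\<ge>C0. \<forall>n\<ge>2. \<forall>\<theta> :: nat \<Rightarrow> 'a. (\<forall>j<n. norm (\<theta> j) = 1) \<longrightarrow>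
    (let h = mesh_size n \<theta>; h' = antipodal_sep n \<theta>; A = kernel_matrix \<gamma> s m n \<theta>;
         p = real (d + 2 * m + 1) / real d
     in h \<le> B * h' \<longrightarrow> invertible_mat A \<and>
       cond_number A \<le> C * real n powr p \<and> real n powr p \<le> C * cond_number A)"
proof -
  have D2: "DIM('a) \<ge> 2" using D by simp
  obtain c1 where c1: "0 < c1" and ones: "\<forall>n. \<forall>\<theta> :: nat \<Rightarrow> 'a. (\<forall>j<n. norm (\<theta> j) = 1) \<longrightarrow>
      c1 * (real n)\<^sup>2 \<le> tensor_form s m n \<theta> (\<lambda>_. 1)"
    using tensor_form_ones_ge[OF D2] by blast
  obtain c2 where c2: "0 < c2" and small: "\<forall>n\<ge>2. \<forall>\<theta> :: nat \<Rightarrow> 'a. (\<forall>j<n. norm (\<theta> j) = 1) \<longrightarrow>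
      (\<exists>a. (\<Sum>j<n. (a j)\<^sup>2) = 1 \<and> tensor_form s m n \<theta> a \<le> c2 * mesh_size n \<theta> ^ (2 * m + 1))"
    using tensor_form_min_le[OF D] by blast
  obtain c3 where c3: "0 < c3" and low: "\<forall>n\<ge>2. \<forall>\<theta> :: nat \<Rightarrow> 'a. (\<forall>j<n. norm (\<theta> j) = 1) \<longrightarrow>
      (\<forall>a. c3 * antipodal_sep n \<theta> ^ (2 * m + 1) * (\<Sum>j<n. (a j)\<^sup>2) \<le> tensor_form s m n \<theta> a)"
    using tensor_form_ge[OF D] by blast
  define q where "q = 2 * m + 1"
  define r where "r = real q / real d"
  \<comment> \<open>Covering gives \<open>(1 / h') ^ d \<le> K1 * n\<close> and packing gives
    \<open>h ^ d \<le> K2 / n\<close>, each combined with \<open>h \<le> B * h'\<close>.\<close>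
  define K1 where "K1 = 2 ^ (d + 1) * B ^ d"
  define K2 where "K2 = B ^ d * real ((d + 1) * 12 ^ (d + 1))"
  have K0: "0 < real ((d + 1) * 12 ^ (d + 1))"
    unfolding of_nat_0_less_iff by (intro mult_pos_pos zero_less_power) simp_all
  have K: "0 < K1" "0 < K2"
    unfolding K1_def K2_def using B by (intro mult_pos_pos zero_less_power K0; simp)+
  \<comment> \<open>\<open>\<gamma>\<close> does not occur because scaling the matrix leaves its
    condition number unchanged.\<close>
  define C1 where "C1 = K1 powr r / c3"
  define C2 where "C2 = c2 * K2 powr r / c1"
  have C12: "0 < C1" "0 < C2" using c1 c2 c3 K by (simp_all add: C1_def C2_def)
  show ?thesis unfolding Let_def
  proof (intro exI[of _ "C1 + C2"] allI impI conjI)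
    show "0 < C1 + C2" using C12 by simp
    fix C n and \<theta> :: "nat \<Rightarrow> 'a"
    assume C: "C1 + C2 \<le> C" and n: "2 \<le> (n::nat)" and \<theta>': "\<forall>j<n. norm (\<theta> j) = 1"
      and hh: "mesh_size n \<theta> \<le> B * antipodal_sep n \<theta>"
    then have \<theta>: "\<And>j. j < n \<Longrightarrow> norm (\<theta> j) = 1" by blast
    define A where "A = kernel_matrix \<gamma> s m n \<theta>"
    define h where "h = mesh_size n \<theta>"
    define h' where "h' = antipodal_sep n \<theta>"
    note A = kernel_matrix_props(1)[of \<gamma> s m n \<theta>, folded A_def]
    note sym = kernel_matrix_props(3)[of _ n _ \<gamma> s m \<theta>, folded A_def]
    note form = kernel_matrix_props(4)[of \<gamma> s m n \<theta>, folded A_def]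
    have n1: "1 \<le> n" and n0: "0 < real n" using n by simp_all
    have h: "0 < h" "1 / h ^ d \<le> real n * 2 ^ (d + 1)"
      unfolding h_def
      by (rule card_ge_mesh_size(1)[OF \<theta> n D], assumption, rule card_ge_mesh_size(2)[OF \<theta> n D], assumption)
    have hB: "h \<le> B * h'" using hh by (simp add: h_def h'_def)
    \<comment> \<open>The mesh size of finitely many points is positive, so the comparison excludes
      coinciding and antipodal points; hence \<open>A\<close> is positive definite.\<close>
    have h': "0 < h'" using h(1) hB B by (metis less_le_trans zero_less_mult_pos)
    have packing: "real n * h' ^ d \<le> real ((d + 1) * 12 ^ (d + 1))"
      unfolding h'_def by (rule card_le_antipodal_sep[OF \<theta> n D(1) h'[unfolded h'_def]])
    define \<alpha> where "\<alpha> = \<gamma> * (c3 * h' ^ q)"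
    have \<alpha>: "0 < \<alpha>" using \<gamma> c3 h' by (simp add: \<alpha>_def)
    have lower: "\<alpha> * (\<Sum>i<n. (a i)\<^sup>2) \<le> mat_form A n a" for a
      unfolding form \<alpha>_def mult.assoc[of \<gamma>] h'_def q_def using \<gamma> low[THEN spec, THEN mp, OF n, THEN spec, THEN mp, OF \<theta>', THEN spec] by (intro mult_left_mono) auto
    have entries: "\<bar>A $$ (i, j)\<bar> \<le> \<gamma>" if "i < n" "j < n" for i j
    proof -
      have "\<gamma> * \<bar>tensor_kernel s m (\<theta> i) (\<theta> j)\<bar> \<le> \<gamma> * 1"
        using \<gamma> that \<theta> by (intro mult_left_mono abs_tensor_kernel_le) auto
      then show ?thesis using \<gamma> that by (simp add: A_def kernel_matrix_props abs_mult)
    qed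
    obtain a where a: "(\<Sum>j<n. (a j)\<^sup>2) = 1" "tensor_form s m n \<theta> a \<le> c2 * h ^ q"
      using small[THEN spec, THEN mp, OF n, THEN spec, THEN mp, OF \<theta>'] unfolding h_def q_def by blast
    \<comment> \<open>The normalised constant vector, on which the form has the order of
      \<open>n\<close>.\<close>
    define b where "b = (\<lambda>_::nat. 1 / sqrt (real n))"
    have b: "(\<Sum>j<n. (b j)\<^sup>2) = 1" using n0 by (simp add: b_def power_divide)
    have cond: "invertible_mat A" "cond_number A \<le> \<gamma> * real n / \<alpha>"
      "mat_form A n b / mat_form A n a \<le> cond_number A"
      by (rule cond_number_bounds[OF A sym n1 \<alpha> lower entries a(1) b]; assumption)+
    show "invertible_mat (kernel_matrix \<gamma> s m n \<theta>)" using cond(1) by (simp add: A_def)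
    have p_eq: "real n powr (real (d + 2 * m + 1) / real d) = real n * real n powr r"
    proof -
      have "real (d + 2 * m + 1) / real d = 1 + r"
        using D(2) by (simp add: r_def q_def add_divide_distrib)
      then show ?thesis using n0 by (simp add: powr_add)
    qed
    show "cond_number (kernel_matrix \<gamma> s m n \<theta>) \<le> C * real n powr (real (d + 2 * m + 1) / real d)"
    proof -
      have "(1 / h') ^ d \<le> B ^ d / h ^ d"
      proof -
        have "h ^ d \<le> (B * h') ^ d" using h hB by (intro power_mono) auto
        then show ?thesis using h h' by (simp add: power_mult_distrib field_simps)
      qed
      also have "\<dots> = B ^ d * (1 / h ^ d)" by simp
      also have "\<dots> \<le> B ^ d * (real n * 2 ^ (d + 1))" using h(2) B by (intro mult_left_mono) auto
      finally have "(1 / h') ^ d \<le> K1 * real n" by (simp add: K1_def mult_ac)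
      then have "(1 / h') ^ q \<le> (K1 * real n) powr r"
        unfolding r_def using h' D(2) by (intro power_le_powr) auto
      also have "\<dots> = K1 powr r * real n powr r" using K by (simp add: powr_mult)
      finally have hq: "1 / h' ^ q \<le> K1 powr r * real n powr r" by (simp add: power_divide)
      have "cond_number A \<le> \<gamma> * real n / \<alpha>" by (rule cond(2))
      also have "\<dots> = real n / c3 * (1 / h' ^ q)" using \<gamma> by (simp add: \<alpha>_def)
      also have "\<dots> \<le> real n / c3 * (K1 powr r * real n powr r)"
        using hq c3 by (intro mult_left_mono) auto
      also have "\<dots> = C1 * (real n * real n powr r)" by (simp add: C1_def)
      also have "\<dots> \<le> C * (real n * real n powr r)"
        using C C12 by (intro mult_right_mono) auto
      finally show ?thesis unfolding p_eq by (simp add: A_def)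
    qed
    show "real n powr (real (d + 2 * m + 1) / real d) \<le> C * cond_number (kernel_matrix \<gamma> s m n \<theta>)"
    proof -
      have "h ^ d \<le> (B * h') ^ d" using h hB by (intro power_mono) auto
      also have "\<dots> = B ^ d * h' ^ d" by (rule power_mult_distrib)
      also have "\<dots> \<le> B ^ d * (real ((d + 1) * 12 ^ (d + 1)) / real n)"
        using packing n0 B by (intro mult_left_mono) (auto simp: pos_le_divide_eq mult.commute)
      also have "\<dots> = K2 / real n" by (simp add: K2_def)
      finally have "h ^ q \<le> (K2 / real n) powr r"
        unfolding r_def using h D(2) by (intro power_le_powr) auto
      then have hq: "h ^ q \<le> K2 powr r / real n powr r" using K n0 by (simp add: powr_divide)
      have fa_pos: "0 < mat_form A n a" using lower[of a] a(1) \<alpha> by simp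
      have fa: "mat_form A n a \<le> \<gamma> * (c2 * (K2 powr r / real n powr r))"
      proof -
        have "c2 * h ^ q \<le> c2 * (K2 powr r / real n powr r)" using hq c2 by (intro mult_left_mono) auto
        then show ?thesis unfolding form using \<gamma> a(2) by (intro mult_left_mono) auto
      qed
      have fb: "\<gamma> * (c1 * real n) \<le> mat_form A n b"
      proof -
        have "c1 * real n = (1 / sqrt (real n))\<^sup>2 * (c1 * (real n)\<^sup>2)"
          using n0 by (simp add: power_divide power2_eq_square)
        also have "\<dots> \<le> (1 / sqrt (real n))\<^sup>2 * tensor_form s m n \<theta> (\<lambda>_. 1)"
          using ones[THEN spec, THEN spec, THEN mp, OF \<theta>'] by (intro mult_left_mono) auto
        also have "\<dots> = tensor_form s m n \<theta> b" unfolding b_def by (rule tensor_form_scale[symmetric])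
        finally show ?thesis unfolding form using \<gamma> by (intro mult_left_mono) auto
      qed
      have np: "0 < real n powr r" using n0 by simp
      have "real n * real n powr r = C2 * (\<gamma> * (c1 * real n) / (\<gamma> * (c2 * (K2 powr r / real n powr r))))"
        using \<gamma> c1 c2 K np by (simp add: C2_def field_simps)
      also have "\<dots> \<le> C2 * (mat_form A n b / mat_form A n a)"
      proof (intro mult_left_mono frac_le)
        show "0 \<le> mat_form A n b" using lower[of b] b \<alpha> by simp
      qed (use fa fb fa_pos C12 in auto)
      also have "\<dots> \<le> C2 * cond_number A" using cond(3) C12 by (intro mult_left_mono) auto
      also have "\<dots> \<le> C * cond_number A"
      proof (rule mult_right_mono)
        have "0 \<le> mat_form A n b / mat_form A n a"
          using lower[of b] b \<alpha> fa_pos by (intro divide_nonneg_pos) auto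
        then show "0 \<le> cond_number A" using cond(3) by linarith
      qed (use C C12 in simp)
      finally show ?thesis unfolding p_eq by (simp add: A_def)
    qed
  qed
qed

lemma ex_common_constant:
  fixes P Q :: "real \<Rightarrow> bool"
  assumes "\<exists>C0>0. \<forall>C\<ge>C0. P C" "\<exists>C0>0. \<forall>C\<ge>C0. Q C"
  shows "\<exists>C>0. P C \<and> Q C"
proof -
  obtain C1 C2 where "0 < C1" "\<forall>C\<ge>C1. P C" "0 < C2" "\<forall>C\<ge>C2. Q C" using assms by blast
  then show ?thesis by (intro exI[of _ "max C1 C2"]) auto
qed

theorem theorem1:
  fixes d k s :: nat
  assumes "d \<ge> 1" and "CARD('n::finite) = d + 1" and "s \<le> k"
  shows
    "(\<exists>C>0. \<forall>n\<ge>2. \<forall>\<theta> :: nat \<Rightarrow> real ^ 'n. (\<forall>j<n. \<theta> j \<in> sphere 0 1) \<longrightarrow>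
       (let h = mesh_size n \<theta>; h' = antipodal_sep n \<theta>;
            M = mass_matrix k n \<theta>; K = stiffness_matrix s k n \<theta>
        in 1 / h ^ d \<le> C * eigval_desc M 1 \<and>
           ereal (eigval_desc M 1) \<le> ereal C * inverse (ereal h') ^ d \<and>
           h' ^ (2 * k + 1) \<le> C * eigval_desc M n \<and>
           eigval_desc M n \<le> C * h ^ (2 * k + 1) \<and>
           1 / h ^ d \<le> C * eigval_desc K 1 \<and>
           ereal (eigval_desc K 1) \<le> ereal C * inverse (ereal h') ^ d \<and>
           h' ^ (2 * (k - s) + 1) \<le> C * eigval_desc K n \<and>
           eigval_desc K n \<le> C * h ^ (2 * (k - s) + 1))) \<and>
     (\<forall>C\<^sub>0>0. \<exists>C>0. \<forall>n\<ge>2. \<forall>\<theta> :: nat \<Rightarrow> real ^ 'n. (\<forall>j<n. \<theta> j \<in> sphere 0 1) \<longrightarrow>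
       (let h = mesh_size n \<theta>; h' = antipodal_sep n \<theta>;
            M = mass_matrix k n \<theta>; K = stiffness_matrix s k n \<theta>;
            p = real (d + 2 * k + 1) / real d; q = real (d + 2 * (k - s) + 1) / real d
        in h' / C\<^sub>0 \<le> h \<and> h \<le> C\<^sub>0 * h' \<longrightarrow>
           invertible_mat M \<and>
           cond_number M \<le> C * real n powr p \<and> real n powr p \<le> C * cond_number M \<and>
           invertible_mat K \<and>
           cond_number K \<le> C * real n powr q \<and> real n powr q \<le> C * cond_number K))"
proof -
  have D: "DIM(real ^ 'n) = d + 1" "d \<ge> 1" using assms(1,2) by simp_all
  let ?\<gamma> = "(fact k / fact (k - s))\<^sup>2 :: real"
  have \<gamma>: "0 < ?\<gamma>" by simp
  have S: "stiffness_matrix s k n \<theta> = kernel_matrix ?\<gamma> s (k - s) n \<theta>"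
    if "\<forall>j<n. norm (\<theta> j) = 1" for n and \<theta> :: "nat \<Rightarrow> real ^ 'n"
    using stiffness_matrix_eq_kernel_matrix[OF assms(3)] that by blast
  have one: "0 < (1::real)" by simp
  show ?thesis
  proof (intro conjI allI impI, goal_cases)
    case 1
    \<comment> \<open>The mass matrix is the instance with factor 1, \<open>s = 0\<close>,
      \<open>m = k\<close>; the stiffness matrix the one with the squared factorial quotient and
      \<open>m = k - s\<close>.\<close>
    show ?case
      by (rule ex_forward[OF ex_common_constant[OF
            kernel_matrix_eigenvalue_bounds[OF D one, of 0 k]
            kernel_matrix_eigenvalue_bounds[OF D \<gamma>, of s "k - s"]]])
        (simp add: Let_def S mass_matrix_eq_kernel_matrix)
  next
    case (2 B)
    show ?case
      by (rule ex_forward[OF ex_common_constant[OF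
            kernel_matrix_cond_bounds[OF D one 2, of 0 k]
            kernel_matrix_cond_bounds[OF D \<gamma> 2, of s "k - s"]]])
        (simp add: Let_def S mass_matrix_eq_kernel_matrix)
  qed
qed

end
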